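(* Let $\Omega\subset\mathbb{R}^n$ be a bounded domain, let $2\le k\le n$, let $q\le 1$ be a real number, and let $H=H(x,z)$ be a smooth positive function. Suppose $g\in C^4(\Omega)\cap C^2(\overline{\Omega})$ is an admissible solution of $$\sigma_k(\lambda)=\frac{H(x,g)}{(1+|Dg|^2)^{q/2}}\qquad\text{in }\Omega,$$ where $\lambda=(\lambda_1,\dots,\lambda_n)$ denotes the principal curvatures of the graph of $g$. Then the second fundamental form $A$ of the graph of $g$ satisfies $$\sup_{\Omega}|A|\le C\left(1+\sup_{\partial\Omega}|A|\right),$$ where, $k$ and $q$ being fixed, $C$ depends only on $n$, $\|g\|_{C^1(\Omega)}$, and $H$ on $\overline{\Omega}\times[\inf_{\partial\Omega}g,\ \sup_{\partial\Omega}g]$.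
   Context: The graph of $g$ is $M=\{(x,g(x)):x\in\Omega\}\subset\mathbb{R}^{n+1}$, with upward unit normal $\nu=(-Dg,1)/\sqrt{1+|Dg|^2}$. The second fundamental form $A=[h_{ij}]$ and its eigenvalues, the principal curvatures $\lambda=(\lambda_1,\dots,\lambda_n)$, are taken with respect to the upward normal, with the sign convention that graphs of convex functions have nonnegative principal curvatures. For $1\le l\le n$, $$\sigma_l(\lambda)=\sum_{1\le i_1<\cdots<i_l\le n}\lambda_{i_1}\cdots\lambda_{i_l}.$$ Let $\Gamma_k=\{\lambda\in\mathbb{R}^n:\sigma_l(\lambda)>0,\ l=1,\dots,k\}$. The solution $g$ is called admissible if $\lambda\in\Gamma_k$ at every point of its graph.
   Formalization: The constant C depends on H on the closure of Ω times [inf over Ω of g, sup over ∂Ω of g]; with inf over ∂Ω as the lower end the claim is false, since g may lie below its boundary infimum, where H would be uncontrolled. *)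

theory Defs
  imports "HOL-Analysis.Analysis"
begin

fun iter_partial :: "'a::euclidean_space list \<Rightarrow> ('a \<Rightarrow> real) \<Rightarrow> 'a \<Rightarrow> real" where
  "iter_partial [] f = f"
| "iter_partial (b # bs) f = (\<lambda>x. frechet_derivative (iter_partial bs f) (at x) b)"

text \<open>\<open>C\<^sup>m(U)\<close>, meant for open \<open>U\<close>: all partial derivatives of order at most \<open>m\<close> exist and
  are continuous. Those of order below \<open>m\<close> are then totally differentiable, which has to be
  required explicitly because \<^const>\<open>frechet_derivative\<close> is unspecified elsewhere.\<close>

definition Ck_on :: "nat \<Rightarrow> 'a::euclidean_space set \<Rightarrow> ('a \<Rightarrow> real) \<Rightarrow> bool" where
  "Ck_on m U f \<longleftrightarrow>
     (\<forall>bs \<in> lists Basis.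
        (length bs < m \<longrightarrow> (\<forall>x\<in>U. iter_partial bs f differentiable (at x))) \<and>
        (length bs \<le> m \<longrightarrow> continuous_on U (iter_partial bs f)))"

text \<open>\<open>C\<^sup>m\<close> on the closure of the open set \<open>U\<close>: the derivatives up to order \<open>m\<close>, taken in \<open>U\<close>,
  extend continuously to \<open>closure U\<close>. No regularity of the boundary and no extension of \<open>f\<close>
  beyond \<open>closure U\<close> is assumed.\<close>

definition Ck_closure :: "nat \<Rightarrow> 'a::euclidean_space set \<Rightarrow> ('a \<Rightarrow> real) \<Rightarrow> bool" where
  "Ck_closure m U f \<longleftrightarrow>
     continuous_on (closure U) f \<and> Ck_on m U f \<and>
     (\<forall>bs \<in> lists Basis. length bs \<le> m \<longrightarrow>
        (\<exists>F. continuous_on (closure U) F \<and> (\<forall>x\<in>U. F x = iter_partial bs f x)))"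

definition smooth_closure :: "'a::euclidean_space set \<Rightarrow> ('a \<Rightarrow> real) \<Rightarrow> bool" where
  "smooth_closure U f \<longleftrightarrow> (\<forall>m. Ck_closure m U f)"

text \<open>The value of \<open>f\<close> in \<open>\<Omega>\<close> and of its continuous extension (when there is one) on the frontier.\<close>

definition cont_ext :: "'a::topological_space set \<Rightarrow> ('a \<Rightarrow> 'b::t2_space) \<Rightarrow> 'a \<Rightarrow> 'b" where
  "cont_ext \<Omega> f x = (if x \<in> \<Omega> then f x else Lim (at x within \<Omega>) f)"

definition grad :: "(real^'n) set \<Rightarrow> (real^'n \<Rightarrow> real) \<Rightarrow> real^'n \<Rightarrow> real^'n" where
  "grad \<Omega> g = cont_ext \<Omega> (\<lambda>x. \<chi> i. iter_partial [axis i 1] g x)"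

definition hess :: "(real^'n) set \<Rightarrow> (real^'n \<Rightarrow> real) \<Rightarrow> real^'n \<Rightarrow> real^'n^'n" where
  "hess \<Omega> g = cont_ext \<Omega> (\<lambda>x. \<chi> i j. iter_partial [axis i 1, axis j 1] g x)"

text \<open>Geometry of the graph, in the parametrization \<open>X(x) = (x, g x)\<close> with ambient space
  \<^typ>\<open>(real^'n) \<times> real\<close>.\<close>

definition tangent :: "(real^'n) set \<Rightarrow> (real^'n \<Rightarrow> real) \<Rightarrow> real^'n \<Rightarrow> 'n \<Rightarrow> (real^'n) \<times> real" where
  "tangent \<Omega> g x i = (axis i 1, grad \<Omega> g x $ i)"

definition upward_normal :: "(real^'n) set \<Rightarrow> (real^'n \<Rightarrow> real) \<Rightarrow> real^'n \<Rightarrow> (real^'n) \<times> real" where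
  "upward_normal \<Omega> g x = (1 / sqrt (1 + (norm (grad \<Omega> g x))\<^sup>2)) *\<^sub>R (- grad \<Omega> g x, 1)"

definition first_form :: "(real^'n) set \<Rightarrow> (real^'n \<Rightarrow> real) \<Rightarrow> real^'n \<Rightarrow> real^'n^'n" where
  "first_form \<Omega> g x = (\<chi> i j. tangent \<Omega> g x i \<bullet> tangent \<Omega> g x j)"

text \<open>\<open>h\<^sub>i\<^sub>j = \<langle>\<partial>\<^sub>i\<partial>\<^sub>jX, \<nu>\<rangle>\<close>, where \<open>\<partial>\<^sub>i\<partial>\<^sub>jX = (0, \<partial>\<^sub>i\<partial>\<^sub>jg)\<close>; nonnegative for convex \<open>g\<close>.\<close>

definition second_form :: "(real^'n) set \<Rightarrow> (real^'n \<Rightarrow> real) \<Rightarrow> real^'n \<Rightarrow> real^'n^'n" where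
  "second_form \<Omega> g x = (\<chi> i j. (0, hess \<Omega> g x $ i $ j) \<bullet> upward_normal \<Omega> g x)"

definition shape_operator :: "(real^'n) set \<Rightarrow> (real^'n \<Rightarrow> real) \<Rightarrow> real^'n \<Rightarrow> real^'n^'n" where
  "shape_operator \<Omega> g x = matrix_inv (first_form \<Omega> g x) ** second_form \<Omega> g x"

text \<open>\<open>\<kappa>\<close> lists, in some order and with multiplicity, the eigenvalues of the second fundamental
  form relative to the induced metric. All later uses are symmetric in \<open>\<kappa>\<close>.\<close>

definition principal_curvatures ::
    "(real^'n) set \<Rightarrow> (real^'n \<Rightarrow> real) \<Rightarrow> real^'n \<Rightarrow> real^'n \<Rightarrow> bool" where
  "principal_curvatures \<Omega> g x \<kappa> \<longleftrightarrow>
     (\<forall>t. det (mat t - shape_operator \<Omega> g x) = (\<Prod>i\<in>UNIV. t - \<kappa> $ i))"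

text \<open>\<open>|A|\<^sup>2 = g\<^sup>i\<^sup>k g\<^sup>j\<^sup>l h\<^sub>i\<^sub>j h\<^sub>k\<^sub>l\<close>, the norm in the induced metric.\<close>

definition norm_A :: "(real^'n) set \<Rightarrow> (real^'n \<Rightarrow> real) \<Rightarrow> real^'n \<Rightarrow> real" where
  "norm_A \<Omega> g x =
     (let G = matrix_inv (first_form \<Omega> g x); h = second_form \<Omega> g x
      in sqrt (\<Sum>i\<in>UNIV. \<Sum>j\<in>UNIV. \<Sum>k\<in>UNIV. \<Sum>l\<in>UNIV.
                 G $ i $ k * G $ j $ l * h $ i $ j * h $ k $ l))"

definition sigma :: "nat \<Rightarrow> real^'n \<Rightarrow> real" where
  "sigma l \<kappa> = (\<Sum>I | I \<subseteq> UNIV \<and> card I = l. \<Prod>i\<in>I. \<kappa> $ i)"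

definition Gamma_cone :: "nat \<Rightarrow> (real^'n) set" where
  "Gamma_cone k = {\<kappa>. \<forall>l\<in>{1..k}. sigma l \<kappa> > 0}"

definition C1_norm :: "(real^'n) set \<Rightarrow> (real^'n \<Rightarrow> real) \<Rightarrow> real" where
  "C1_norm \<Omega> g = (SUP x\<in>\<Omega>. \<bar>g x\<bar>) + (SUP x\<in>\<Omega>. norm (grad \<Omega> g x))"

text \<open>The part of \<open>H\<close> that the constant may depend on: \<open>H\<close> as a partial function with domain
  \<open>closure \<Omega> \<times> [inf\<^sub>\<Omega> g, sup\<^sub>\<partial>\<^sub>\<Omega> g]\<close>. Admissible \<open>g\<close> are strictly subharmonic for the induced
  metric, so \<open>g \<le> sup\<^sub>\<partial>\<^sub>\<Omega> g\<close>, but \<open>g\<close> may take values below \<open>inf\<^sub>\<partial>\<^sub>\<Omega> g\<close>. With \<open>inf\<^sub>\<partial>\<^sub>\<Omega> g\<close> as the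
  lower end the estimate fails: for \<open>g = 0\<close> on the boundary that interval is \<open>{0}\<close>, and \<open>H(x,0)\<close>
  does not control \<open>H\<close> along the graph. The two intervals agree whenever \<open>g \<ge> inf\<^sub>\<partial>\<^sub>\<Omega> g\<close>.\<close>

definition H_data :: "(real^'n) set \<Rightarrow> (real^'n \<Rightarrow> real) \<Rightarrow> ((real^'n) \<times> real \<Rightarrow> real) \<Rightarrow>
    ((real^'n) \<times> real \<rightharpoonup> real)" where
  "H_data \<Omega> g H =
     (\<lambda>p. Some (H p)) |` (closure \<Omega> \<times> {(INF x\<in>\<Omega>. g x)..(SUP x\<in>frontier \<Omega>. g x)})"

end

theory Submission
  imports Defs
begin

text \<open>The estimate is a maximum principle for the mean curvature \<open>\<sigma>\<^sub>1\<close> divided by the last component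
\<open>v = (1 + |Dg|\<^sup>2)\<^sup>-\<^sup>1\<^sup>/\<^sup>2\<close> of the upward normal. On the cone \<open>\<Gamma>\<^sub>k\<close> with \<open>k \<ge> 2\<close> one has
\<open>|A|\<^sup>2 = \<sigma>\<^sub>1\<^sup>2 - 2 \<sigma>\<^sub>2 \<le> \<sigma>\<^sub>1\<^sup>2\<close>, and always \<open>\<sigma>\<^sub>1\<^sup>2 \<le> n |A|\<^sup>2\<close>, so bounding \<open>|A|\<close> amounts to
bounding \<open>\<sigma>\<^sub>1\<close>, which unlike the largest principal curvature is a smooth function.
If \<open>\<sigma>\<^sub>1 / v\<close> is largest at a boundary point, the estimate is immediate.

Let \<open>x\<close> be an interior maximum point. The horizontal part \<open>N = v Dg\<close> of the downward normal has the
shape operator as its Jacobian, \<open>S = DN\<close>, the inverse of the induced metric is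
\<open>G = 1 - N N\<^sup>T\<close>, and \<open>S G\<close> is symmetric. These facts replace covariant differentiation: the Codazzi
equation is the first derivative of the symmetry of \<open>S G\<close>, and Simons' identity is its second
derivative (lemmas \<open>b_codazzi\<close> and \<open>simons\<close>). All this is done in a constant frame that is
orthonormal for the metric at \<open>x\<close> and makes \<open>S\<close> diagonal there, with diagonal \<open>\<lambda>\<close>; let \<open>n\<^sub>p\<close> be the
components of \<open>N\<close> at \<open>x\<close>. Then \<open>\<partial>\<^sub>p log v = - n\<^sub>p \<lambda>\<^sub>p\<close>.

Differentiate \<open>log \<sigma>\<^sub>k = log H + q log v\<close> twice along each frame vector and add. Combined with Simons'
identity and with the second-order conditions for \<open>log \<sigma>\<^sub>1 - log v\<close>, weighted by
\<open>T\<^sub>m = \<partial> log \<sigma>\<^sub>k / \<partial>\<lambda>\<^sub>m > 0\<close>, everything of uncontrolled sign cancels, and what remains is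
\<open>\<Sum>\<^sub>p \<partial>\<^sub>p\<^sup>2 log H + (k - q) |A|\<^sup>2 + (1 - q) \<Sum>\<^sub>p n\<^sub>p\<^sup>2 \<lambda>\<^sub>p\<^sup>2 \<le> 0\<close>
(lemma \<open>curvature_inequality_at_maximum\<close>). The condition \<open>q \<le> 1\<close> enters here: the right-hand side
of the equation produces \<open>- q |\<nabla> log v|\<^sup>2 = - q \<Sum>\<^sub>p n\<^sub>p\<^sup>2 \<lambda>\<^sub>p\<^sup>2\<close>, and the concavity of
\<open>log \<sigma>\<^sub>k - log \<sigma>\<^sub>1\<close> on \<open>\<Gamma>\<^sub>k\<close> provides the compensating \<open>|\<nabla> log \<sigma>\<^sub>1|\<^sup>2\<close>, which equals
\<open>|\<nabla> log v|\<^sup>2\<close> at the maximum. Because \<open>H\<close> is evaluated along the graph, \<open>\<Sum>\<^sub>p \<partial>\<^sub>p\<^sup>2 log H\<close> is at least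
\<open>- C (1 + \<sigma>\<^sub>1)\<close>, whereas \<open>|A|\<^sup>2 \<ge> \<sigma>\<^sub>1\<^sup>2 / n\<close>; hence \<open>\<sigma>\<^sub>1\<close> is bounded at \<open>x\<close>.

The concavity (lemma \<open>esym_log_quotient_concave\<close>) follows from the theorem of Marcus and Lopes
that each quotient \<open>\<sigma>\<^sub>j\<^sub>+\<^sub>1 / \<sigma>\<^sub>j\<close> is superadditive on \<open>\<Gamma>\<^sub>j\<^sub>+\<^sub>1\<close>, since \<open>\<sigma>\<^sub>k / \<sigma>\<^sub>1\<close> is a product of such
quotients.

The constant uses bounds for \<open>H\<close> and its first two derivatives over the range of \<open>(x, g x)\<close>. The
values of \<open>H\<close> there determine them: by the strict maximum principle the interval of heights is
nondegenerate, so derivatives at interior points can be read off and the bounds extend by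
continuity (lemma \<open>source_bound_transfer\<close>).\<close>

section \<open>Elementary symmetric functions on the Garding cones\<close>

text \<open>The polynomial \<open>\<sigma>\<^sub>l\<close> in the variables indexed by \<open>A\<close>. The index set is explicit because the
inductions below remove variables one at a time.\<close>

definition esym :: "'i set \<Rightarrow> nat \<Rightarrow> ('i \<Rightarrow> real) \<Rightarrow> real" where
  "esym A l f = (\<Sum>I | I \<subseteq> A \<and> card I = l. \<Prod>i\<in>I. f i)"

lemma esym_0 [simp]: "finite A \<Longrightarrow> esym A 0 f = 1"
proof -
  assume "finite A"
  then have "{I. I \<subseteq> A \<and> card I = 0} = {{}}"
    by (auto simp: finite_subset)
  then show ?thesis by (simp add: esym_def)
qed

lemma esym_empty_Suc [simp]: "esym {} (Suc l) f = 0"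
  by (auto simp: esym_def intro!: sum.neutral)

lemma esym_insert:
  assumes "finite A" "x \<notin> A"
  shows "esym (insert x A) (Suc l) f = esym A (Suc l) f + f x * esym A l f"
proof -
  have split: "{I. I \<subseteq> insert x A \<and> card I = Suc l} =
     {I. I \<subseteq> A \<and> card I = Suc l} \<union> insert x ` {I. I \<subseteq> A \<and> card I = l}" (is "?L = ?R1 \<union> ?R2")
  proof (intro equalityI subsetI)
    fix I assume I: "I \<in> ?L"
    show "I \<in> ?R1 \<union> ?R2"
    proof (cases "x \<in> I")
      case True
      have "finite I" using I assms(1) by (auto intro: finite_subset)
      then have "I = insert x (I - {x})" "I - {x} \<subseteq> A" "card (I - {x}) = l"
        using True I by auto
      then show ?thesis by blast
    qed (use I in auto)
  next
    fix I assume "I \<in> ?R1 \<union> ?R2"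
    moreover have "card (insert x J) = Suc l" if "J \<subseteq> A" "card J = l" for J
      using that assms finite_subset by (subst card_insert_disjoint) auto
    ultimately show "I \<in> ?L" by auto
  qed
  have fin: "finite ?R1" "finite {I. I \<subseteq> A \<and> card I = l}"
    using assms(1) by auto
  have inj: "inj_on (insert x) {I. I \<subseteq> A \<and> card I = l}"
    using assms(2) by (auto intro!: inj_onI)
  have "esym (insert x A) (Suc l) f
      = (\<Sum>I\<in>?R1. \<Prod>i\<in>I. f i) + (\<Sum>I\<in>?R2. \<Prod>i\<in>I. f i)"
    unfolding esym_def split by (rule sum.union_disjoint) (use fin assms(2) in auto)
  also have "(\<Sum>I\<in>?R2. \<Prod>i\<in>I. f i) = (\<Sum>I | I \<subseteq> A \<and> card I = l. \<Prod>i\<in>insert x I. f i)"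
    by (subst sum.reindex[OF inj]) simp
  also have "\<dots> = (\<Sum>I | I \<subseteq> A \<and> card I = l. f x * (\<Prod>i\<in>I. f i))"
    using assms by (intro sum.cong refl prod.insert) (auto intro: finite_subset)
  finally show ?thesis by (simp add: esym_def sum_distrib_left)
qed

lemma esym_remove:
  assumes "finite A" "i \<in> A"
  shows "esym A (Suc l) f = esym (A - {i}) (Suc l) f + f i * esym (A - {i}) l f"
  using esym_insert[of "A - {i}" i l f] assms by (simp add: insert_absorb)

lemma esym_1: "finite A \<Longrightarrow> esym A (Suc 0) f = sum f A"
  by (induction A rule: finite_induct) (auto simp: esym_insert)

text \<open>Euler's identity: \<open>\<sigma>\<^sub>l\<close> without the variable \<open>i\<close> is the \<open>i\<close>-th partial derivative of \<open>\<sigma>\<^sub>l\<^sub>+\<^sub>1\<close>,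
which is homogeneous of degree \<open>l + 1\<close>.\<close>

lemma esym_euler:
  assumes "finite A"
  shows "(\<Sum>i\<in>A. f i * esym (A - {i}) l f) = real (Suc l) * esym A (Suc l) f"
  using assms
proof (induction A arbitrary: l rule: finite_induct)
  case (insert x A)
  have eq: "insert x A - {i} = insert x (A - {i})" if "i \<in> A" for i
    using that insert.hyps by auto
  have "(\<Sum>i\<in>insert x A. f i * esym (insert x A - {i}) l f)
      = f x * esym A l f + (\<Sum>i\<in>A. f i * esym (insert x (A - {i})) l f)"
    using insert.hyps by (simp add: eq)
  also have "\<dots> = real (Suc l) * esym (insert x A) (Suc l) f"
  proof (cases l)
    case 0
    then show ?thesis using insert.hyps by (simp add: esym_1)
  next
    case (Suc l')
    have "(\<Sum>i\<in>A. f i * esym (insert x (A - {i})) l f)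
        = (\<Sum>i\<in>A. f i * esym (A - {i}) l f + f x * (f i * esym (A - {i}) l' f))"
    proof (rule sum.cong[OF refl])
      fix i assume i: "i \<in> A"
      have "esym (insert x (A - {i})) (Suc l') f = esym (A - {i}) (Suc l') f + f x * esym (A - {i}) l' f"
        by (rule esym_insert) (use insert.hyps in auto)
      then show "f i * esym (insert x (A - {i})) l f
          = f i * esym (A - {i}) l f + f x * (f i * esym (A - {i}) l' f)"
        unfolding Suc by (simp add: distrib_left)
    qed
    also have "\<dots>
        = (\<Sum>i\<in>A. f i * esym (A - {i}) l f) + f x * (\<Sum>i\<in>A. f i * esym (A - {i}) l' f)"
      by (simp add: sum.distrib sum_distrib_left)
    also have "\<dots> = real (Suc l) * esym A (Suc l) f + f x * (real l * esym A l f)"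
      using insert.IH[of l] insert.IH[of l'] by (simp only: Suc)
    finally have S: "(\<Sum>i\<in>A. f i * esym (insert x (A - {i})) l f)
        = real (Suc l) * esym A (Suc l) f + f x * (real l * esym A l f)" .
    show ?thesis
      unfolding esym_insert[OF insert.hyps] S of_nat_Suc by algebra
  qed
  finally show ?case .
qed simp

lemma esym_scale: "finite A \<Longrightarrow> esym A l (\<lambda>i. c * f i) = c ^ l * esym A l f"
  unfolding esym_def sum_distrib_left by (intro sum.cong) (auto simp: prod.distrib)

lemma esym_eq_0: "finite A \<Longrightarrow> card A < l \<Longrightarrow> esym A l f = 0"
proof -
  assume A: "finite A" "card A < l"
  then have "{I. I \<subseteq> A \<and> card I = l} = {}"
    using card_mono[OF A(1)] by (auto simp: not_le[symmetric])
  then show ?thesis unfolding esym_def by (simp only: sum.empty)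
qed

lemma esym_pos:
  assumes "finite A" "l \<le> card A" "\<And>i. i \<in> A \<Longrightarrow> f i > 0"
  shows "esym A l f > 0"
  unfolding esym_def
proof (rule sum_pos)
  show "finite {I. I \<subseteq> A \<and> card I = l}" using assms(1) by simp
  obtain I where "I \<subseteq> A" "card I = l" using obtain_subset_with_card_n assms(2) by metis
  then show "{I. I \<subseteq> A \<and> card I = l} \<noteq> {}" by blast
  show "prod f I > 0" if "I \<in> {I. I \<subseteq> A \<and> card I = l}" for I
    using that assms(3) by (intro prod_pos) auto
qed

lemma esym_line_deriv:
  assumes "finite A"
  shows "((\<lambda>s. esym A (Suc l) (\<lambda>i. f i + s * g i)) has_field_derivative
     (\<Sum>i\<in>A. g i * esym (A - {i}) l (\<lambda>i. f i + s * g i))) (at s)"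
  using assms
proof (induction A arbitrary: l rule: finite_induct)
  case (insert x A)
  have eq: "insert x A - {i} = insert x (A - {i})" if "i \<in> A" for i
    using that insert.hyps by auto
  let ?h = "\<lambda>s i. f i + s * g i"
  show ?case
  proof (cases l)
    case 0
    have "((\<lambda>s. sum (?h s) (insert x A)) has_field_derivative sum g (insert x A)) (at s)"
      by (auto intro!: derivative_eq_intros)
    then show ?thesis using insert.hyps by (simp add: 0 esym_1 eq)
  next
    case (Suc l')
    have "((\<lambda>s. esym A (Suc l) (?h s) + ?h s x * esym A l (?h s)) has_field_derivative
      (\<Sum>i\<in>A. g i * esym (A - {i}) l (?h s)) + (g x * esym A l (?h s)
        + (\<Sum>i\<in>A. g i * esym (A - {i}) l' (?h s)) * ?h s x)) (at s)"
      unfolding Suc by (auto intro!: derivative_eq_intros insert.IH)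
    moreover have "(\<Sum>i\<in>A. g i * esym (A - {i}) l (?h s)) + (g x * esym A l (?h s)
        + (\<Sum>i\<in>A. g i * esym (A - {i}) l' (?h s)) * ?h s x)
      = (\<Sum>i\<in>insert x A. g i * esym (insert x A - {i}) l (?h s))"
    proof -
      have "(\<Sum>i\<in>A. g i * esym (insert x A - {i}) l (?h s))
         = (\<Sum>i\<in>A. g i * (esym (A - {i}) l (?h s) + ?h s x * esym (A - {i}) l' (?h s)))"
        using insert.hyps by (intro sum.cong) (simp_all add: eq Suc esym_insert)
      also have "\<dots> = (\<Sum>i\<in>A. g i * esym (A - {i}) l (?h s))
          + ?h s x * (\<Sum>i\<in>A. g i * esym (A - {i}) l' (?h s))"
        by (simp add: sum_distrib_left algebra_simps sum.distrib)
      finally show ?thesis using insert.hyps by (simp add: algebra_simps)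
    qed
    ultimately show ?thesis using insert.hyps by (simp add: esym_insert)
  qed
qed simp

lemma esym_line_continuous:
  assumes "finite A"
  shows "continuous_on S (\<lambda>s. esym A l (\<lambda>i. f i + s * g i))"
  unfolding esym_def by (intro continuous_intros)

lemma sum_esym_remove:
  assumes "finite A" "l \<le> card A"
  shows "(\<Sum>i\<in>A. esym (A - {i}) l f) = real (card A - l) * esym A l f"
proof (cases l)
  case 0
  then show ?thesis using assms by simp
next
  case (Suc l')
  have "(\<Sum>i\<in>A. esym (A - {i}) l f) = (\<Sum>i\<in>A. esym A l f - f i * esym (A - {i}) l' f)"
    using assms by (intro sum.cong) (simp_all add: Suc esym_remove[of A])
  also have "\<dots> = real (card A) * esym A l f - real l * esym A l f"
    using esym_euler[OF assms(1), of f l'] by (simp add: sum_subtractf Suc)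
  finally show ?thesis using assms(2) by (simp add: of_nat_diff algebra_simps)
qed

lemma esym_2:
  assumes "finite A"
  shows "2 * esym A 2 f = (sum f A)\<^sup>2 - (\<Sum>i\<in>A. (f i)\<^sup>2)"
proof -
  have "2 * esym A 2 f = (\<Sum>i\<in>A. f i * esym (A - {i}) (Suc 0) f)"
    using esym_euler[OF assms, of f "Suc 0"] by (simp add: numeral_2_eq_2)
  also have "\<dots> = (\<Sum>i\<in>A. f i * (sum f A - f i))"
    using assms by (intro sum.cong) (simp_all add: esym_1 sum_diff1)
  also have "\<dots> = (sum f A)\<^sup>2 - (\<Sum>i\<in>A. (f i)\<^sup>2)"
    by (simp add: right_diff_distrib sum_subtractf power2_eq_square sum_distrib_right)
  finally show ?thesis .
qed

definition garding_cone :: "'i set \<Rightarrow> nat \<Rightarrow> ('i \<Rightarrow> real) set" where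
  "garding_cone A k = {f. \<forall>l\<in>{1..k}. esym A l f > 0}"

lemma garding_coneD:
  "f \<in> garding_cone A k \<Longrightarrow> l \<le> k \<Longrightarrow> finite A \<Longrightarrow> esym A l f > 0"
  by (cases "l = 0") (auto simp: garding_cone_def)

lemma garding_cone_mono: "f \<in> garding_cone A k \<Longrightarrow> l \<le> k \<Longrightarrow> f \<in> garding_cone A l"
  by (auto simp: garding_cone_def)

lemma garding_cone_Suc:
  "f \<in> garding_cone A (Suc k) \<longleftrightarrow> f \<in> garding_cone A k \<and> esym A (Suc k) f > 0"
  by (auto simp: garding_cone_def le_Suc_eq)

text \<open>Along \<open>f + s\<close> the derivative of \<open>\<sigma>\<^sub>l\<^sub>+\<^sub>1\<close> is a nonnegative multiple of \<open>\<sigma>\<^sub>l\<close>, so positivity for all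
\<open>s \<ge> 0\<close> passes from \<open>l\<close> to \<open>l + 1\<close>.\<close>

lemma garding_cone_shift:
  assumes "finite A" "f \<in> garding_cone A k" "s \<ge> 0"
  shows "(\<lambda>i. f i + s) \<in> garding_cone A k"
proof -
  have "esym A l (\<lambda>i. f i + s) > 0" if "l \<le> k" "s \<ge> 0" for l s
    using that
  proof (induction l arbitrary: s)
    case (Suc l)
    let ?F = "\<lambda>t. esym A (Suc l) (\<lambda>i. f i + t * 1)"
    have lA: "Suc l \<le> card A"
      using garding_coneD[OF assms(2) Suc.prems(1) assms(1)] esym_eq_0[OF assms(1)]
      by (metis less_irrefl not_less)
    have "?F 0 \<le> ?F s"
    proof (rule DERIV_nonneg_imp_nondecreasing[OF \<open>0 \<le> s\<close>])
      fix t :: real assume t: "0 \<le> t" "t \<le> s"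
      have "(?F has_field_derivative real (card A - l) * esym A l (\<lambda>i. f i + t)) (at t)"
        using esym_line_deriv[OF assms(1), of l f "\<lambda>_. 1" t] lA assms(1)
        by (simp add: sum_esym_remove)
      moreover have "esym A l (\<lambda>i. f i + t) > 0"
        using Suc t by auto
      ultimately show "\<exists>y. (?F has_field_derivative y) (at t) \<and> 0 \<le> y"
        by (metis less_imp_le mult_nonneg_nonneg of_nat_0_le_iff)
    qed
    moreover have "?F 0 > 0"
      using garding_coneD[OF assms(2) Suc.prems(1) assms(1)] by simp
    ultimately show ?case by simp
  qed (simp add: assms)
  then show ?thesis using assms(3) by (simp add: garding_cone_def)
qed

lemma esym_quotient_le:
  fixes x y z :: real
  assumes "x + y > 0" "y \<le> z"
  shows "x * y / (x + y) \<le> x * z / (x + z)"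
proof -
  have "x * z / (x + z) - x * y / (x + y) = x\<^sup>2 * (z - y) / ((x + y) * (x + z))"
    using assms by (simp add: divide_simps power2_eq_square) (simp add: algebra_simps)
  also have "\<dots> \<ge> 0" using assms by (intro divide_nonneg_nonneg mult_nonneg_nonneg) auto
  finally show ?thesis by simp
qed

text \<open>The parallel sum \<open>x y / (x + y)\<close> is homogeneous of degree one and concave where \<open>x + y > 0\<close>, even for
negative \<open>x\<close>: it equals \<open>x - x\<^sup>2 / (x + y)\<close>.\<close>

lemma parallel_sum_superadditive:
  fixes x y x' y' :: real
  assumes "x + y > 0" "x' + y' > 0"
  shows "x * y / (x + y) + x' * y' / (x' + y') \<le> (x + x') * (y + y') / ((x + x') + (y + y'))"
proof -
  have "(x + x') * (y + y') / ((x + x') + (y + y')) - (x * y / (x + y) + x' * y' / (x' + y'))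
     = (x * y' - x' * y)\<^sup>2 / ((x + y) * (x' + y') * ((x + y) + (x' + y')))"
  proof -
    define a b where "a = x + y" and "b = x' + y'"
    have ab: "a > 0" "b > 0" "y = a - x" "y' = b - x'" "x + x' + (y + y') = a + b"
      using assms by (auto simp: a_def b_def)
    show ?thesis unfolding ab(5) using ab(1,2) unfolding a_def[symmetric] b_def[symmetric]
      unfolding ab(3,4)
      by (simp add: divide_simps add_pos_pos) (simp add: power2_eq_square algebra_simps)
  qed
  also have "\<dots> \<ge> 0" using assms by (intro divide_nonneg_nonneg mult_nonneg_nonneg) auto
  finally show ?thesis by simp
qed

lemma garding_cone_sum_squares_le:
  assumes "finite A" "f \<in> garding_cone A k" "2 \<le> k"
  shows "(\<Sum>i\<in>A. (f i)\<^sup>2) \<le> (sum f A)\<^sup>2"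
  using esym_2[OF assms(1), of f] garding_coneD[OF assms(2,3,1)] by simp

lemma garding_cone_sum_pos: "f \<in> garding_cone A k \<Longrightarrow> 1 \<le> k \<Longrightarrow> finite A \<Longrightarrow> sum f A > 0"
  using garding_coneD[of f A k 1] by (simp add: esym_1)

text \<open>The quotient \<open>\<sigma>\<^sub>l\<^sub>+\<^sub>1 / \<sigma>\<^sub>l\<close> is, up to a factor, the sum of the parallel sums of each \<open>f i\<close> with the preceding
quotient in the other variables. This makes induction on the degree possible, because the parallel
sum is monotone and superadditive.\<close>

lemma esym_quotient_recursion:
  assumes "finite A" "esym A l f > 0" "\<And>i. i \<in> A \<Longrightarrow> l > 0 \<Longrightarrow> esym (A - {i}) (l - 1) f > 0" "l > 0"
  shows "real (Suc l) * (esym A (Suc l) f / esym A l f)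
    = (\<Sum>i\<in>A. f i * (esym (A - {i}) l f / esym (A - {i}) (l - 1) f)
        / (f i + esym (A - {i}) l f / esym (A - {i}) (l - 1) f))"
    "\<And>i. i \<in> A \<Longrightarrow> f i + esym (A - {i}) l f / esym (A - {i}) (l - 1) f > 0"
proof -
  have *: "f i + esym (A - {i}) l f / esym (A - {i}) (l - 1) f = esym A l f / esym (A - {i}) (l - 1) f"
    if "i \<in> A" for i
    using assms(3)[OF that \<open>l > 0\<close>] esym_remove[OF assms(1) that, of "l - 1" f] assms(4)
    by (simp add: divide_simps)
  show pos: "f i + esym (A - {i}) l f / esym (A - {i}) (l - 1) f > 0" if "i \<in> A" for i
    unfolding *[OF that] using assms(2) assms(3)[OF that assms(4)] by simp
  have "real (Suc l) * (esym A (Suc l) f / esym A l f)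
      = (\<Sum>i\<in>A. f i * esym (A - {i}) l f) / esym A l f"
    using esym_euler[OF assms(1), of f l] by simp
  also have "\<dots> = (\<Sum>i\<in>A. f i * (esym (A - {i}) l f / esym (A - {i}) (l - 1) f)
        / (f i + esym (A - {i}) l f / esym (A - {i}) (l - 1) f))"
    unfolding sum_divide_distrib
  proof (rule sum.cong[OF refl])
    fix i assume i: "i \<in> A"
    show "f i * esym (A - {i}) l f / esym A l f
      = f i * (esym (A - {i}) l f / esym (A - {i}) (l - 1) f)
        / (f i + esym (A - {i}) l f / esym (A - {i}) (l - 1) f)"
      unfolding *[OF i] using assms(2) assms(3)[OF i assms(4)] by simp
  qed
  finally show "real (Suc l) * (esym A (Suc l) f / esym A l f)
    = (\<Sum>i\<in>A. f i * (esym (A - {i}) l f / esym (A - {i}) (l - 1) f)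
        / (f i + esym (A - {i}) l f / esym (A - {i}) (l - 1) f))" .
qed

text \<open>Two facts are proved by one induction on the number of variables: removing a variable maps \<open>\<Gamma>\<^sub>k\<^sub>+\<^sub>1\<close>
into \<open>\<Gamma>\<^sub>k\<close>, and a weak Newton inequality holds on \<open>\<Gamma>\<^sub>k\<close>. The Newton inequality for \<open>A\<close> follows from the
recursion for the quotients and from its instances for \<open>A - {i}\<close>, once the first fact places the
restrictions in the cone.

For the first fact, suppose \<open>\<sigma>\<^sub>k\<close> without \<open>i\<close> is not positive and shift \<open>f\<close> upwards until the last zero
of this polynomial. Just beyond it the Newton inequality for \<open>A - {i}\<close> applies, and in the limit it
gives \<open>\<sigma>\<^sub>k\<^sub>+\<^sub>1 \<le> 0\<close> for \<open>A - {i}\<close>. But at the zero this value is also the value for \<open>A\<close>,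
which is positive.\<close>

lemma garding_cone_remove_newton:
  assumes "finite A"
  shows "(\<forall>k f. f \<in> garding_cone A (Suc k) \<longrightarrow> (\<forall>i\<in>A. f \<in> garding_cone (A - {i}) k))
    \<and> (\<forall>k f. f \<in> garding_cone A (Suc k) \<longrightarrow>
         esym A (Suc (Suc k)) f * esym A k f \<le> (esym A (Suc k) f)\<^sup>2)"
  using assms
proof (induction "card A" arbitrary: A rule: less_induct)
  case less
  note finA = less.prems
  have IH: "esym (A - {i}) (Suc (Suc k)) f * esym (A - {i}) k f \<le> (esym (A - {i}) (Suc k) f)\<^sup>2"
    if "i \<in> A" "f \<in> garding_cone (A - {i}) (Suc k)" for i k f
    using less.hyps[OF card_Diff1_less[OF finA that(1)]] that(2) finA by blast
  have remove: "f \<in> garding_cone (A - {i}) k" if "f \<in> garding_cone A (Suc k)" "i \<in> A" for f i k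
    using that(1)
  proof (induction k arbitrary: f)
    case 0
    then show ?case by (simp add: garding_cone_def)
  next
    case (Suc k)
    let ?B = "A - {i}"
    have finB: "finite ?B" using finA by simp
    have fB: "f \<in> garding_cone ?B k"
      using Suc.IH Suc.prems garding_cone_Suc by blast
    have "esym ?B (Suc k) f > 0"
    proof (rule ccontr)
      assume "\<not> esym ?B (Suc k) f > 0"
      define F where "F l s = esym ?B l (\<lambda>j. f j + s)" for l s
      have F0: "F (Suc k) 0 \<le> 0" using \<open>\<not> esym ?B (Suc k) f > 0\<close> by (simp add: F_def)
      have cont: "continuous_on S (F l)" for l S
        using esym_line_continuous[OF finB, of S l f "\<lambda>_. 1"] by (simp add: F_def)
      have kB: "Suc k \<le> card ?B"
      proof -
        have "Suc (Suc k) \<le> card A"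
          using garding_coneD[OF Suc.prems order.refl finA] esym_eq_0[OF finA]
          by (metis less_irrefl not_less)
        then show ?thesis using that(2) finA by simp
      qed
      \<comment> \<open>From \<open>r\<close> on all entries of \<open>f + s\<close> are positive.\<close>
      define r where "r = (\<Sum>j\<in>A. \<bar>f j\<bar>) + 1"
      have large: "F (Suc k) s > 0" if "s \<ge> r" for s
        unfolding F_def
      proof (rule esym_pos[OF finB kB])
        fix j assume "j \<in> ?B"
        then have "\<bar>f j\<bar> \<le> (\<Sum>j\<in>A. \<bar>f j\<bar>)"
          using member_le_sum[of j A "\<lambda>j. \<bar>f j\<bar>"] finA by auto
        then show "f j + s > 0" using that unfolding r_def by linarith
      qed
      have r0: "r > 0" unfolding r_def by (simp add: add_nonneg_pos sum_nonneg)
      define Z where "Z = {s \<in> {0..r}. F (Suc k) s \<le> 0}"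
      have Zeq: "Z = {0..r} \<inter> F (Suc k) -` {..0}" by (auto simp: Z_def)
      have "closed Z" unfolding Zeq
        by (intro continuous_closed_preimage cont) auto
      moreover have Zne: "Z \<noteq> {}" "bdd_above Z"
        using F0 r0 by (auto simp: Z_def intro!: exI[of _ 0] bdd_aboveI[of _ r])
      \<comment> \<open>the last zero\<close>
      define t where "t = Sup Z"
      have tZ: "t \<in> Z" unfolding t_def using closed_contains_Sup[OF Zne(1,2) \<open>closed Z\<close>] .
      then have t: "0 \<le> t" "t \<le> r" "F (Suc k) t \<le> 0" by (auto simp: Z_def)
      have after: "F (Suc k) s > 0" if "s > t" for s
      proof (rule ccontr)
        assume "\<not> F (Suc k) s > 0"
        moreover from this have "s < r" using large[of s] by (meson not_le)
        ultimately have "s \<in> Z" using that t(1) by (simp add: Z_def not_less)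
        then have "s \<le> t" unfolding t_def using Zne(2) by (rule cSup_upper)
        then show False using that by simp
      qed
      have lim: "(F l \<longlongrightarrow> F l t) (at_right t)" for l
        using cont[of UNIV l] by (simp add: continuous_on_eq_continuous_at continuous_at_imp_continuous_at_within
            flip: continuous_within)
      have "F (Suc k) t \<ge> 0"
        by (rule tendsto_lowerbound[OF lim])
           (auto simp: eventually_at_right_field intro!: less_imp_le after exI[of _ "t + 1"])
      then have Ft: "F (Suc k) t = 0" using t by simp
      have coneA: "(\<lambda>j. f j + s) \<in> garding_cone A (Suc (Suc k))" if "s \<ge> 0" for s
        using garding_cone_shift[OF finA Suc.prems that] .
      have coneB: "(\<lambda>j. f j + s) \<in> garding_cone ?B k" if "s \<ge> 0" for s
        using garding_cone_shift[OF finB fB that] .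
      have "F (Suc (Suc k)) s * F k s \<le> (F (Suc k) s)\<^sup>2" if "s > t" for s
        unfolding F_def
        by (rule IH[OF \<open>i \<in> A\<close>])
           (use coneB[of s] after[OF that] that t in \<open>simp add: garding_cone_Suc F_def\<close>)
      then have "F (Suc (Suc k)) t * F k t \<le> (F (Suc k) t)\<^sup>2"
        by (intro tendsto_le[OF _ tendsto_power[OF lim] tendsto_mult[OF lim lim]])
           (auto simp: eventually_at_right_field intro!: exI[of _ "t + 1"])
      moreover have "F k t > 0"
        unfolding F_def using garding_coneD[OF coneB[OF t(1)] order.refl finB] .
      moreover have "F (Suc (Suc k)) t > 0"
        using garding_coneD[OF coneA[OF t(1)] order.refl finA] Ft
          esym_remove[OF finA that(2), of "Suc k" "\<lambda>j. f j + t"]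
        by (simp add: F_def)
      ultimately show False using Ft by (simp add: mult_le_0_iff)
    qed
    then show ?case using fB by (simp add: garding_cone_Suc)
  qed
  have newton: "esym A (Suc (Suc k)) f * esym A k f \<le> (esym A (Suc k) f)\<^sup>2"
    if f: "f \<in> garding_cone A (Suc k)" for f k
  proof (cases "esym A (Suc (Suc k)) f \<le> 0")
    case True
    have "esym A k f > 0" using garding_coneD[OF f _ finA] by simp
    then have "esym A (Suc (Suc k)) f * esym A k f \<le> 0"
      using True by (simp add: mult_nonpos_nonneg)
    then show ?thesis by (meson order_trans zero_le_power2)
  next
    case False
    have pos: "esym A k f > 0" "esym A (Suc k) f > 0"
      using garding_coneD[OF f _ finA] by auto
    have f2: "f \<in> garding_cone A (Suc (Suc k))"
      using False f by (simp add: garding_cone_Suc)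
    define q where "q l B = esym B (Suc l) f / esym B l f" for l and B :: "'a set"
    have cone: "f \<in> garding_cone (A - {i}) (Suc k)" if "i \<in> A" for i
      using remove[OF f2 that] .
    have posB: "esym (A - {i}) l f > 0" if "i \<in> A" "l \<le> Suc k" for i l
      using garding_coneD[OF cone[OF that(1)] that(2)] finA by simp
    have rec: "real (Suc (Suc k)) * q (Suc k) A = (\<Sum>i\<in>A. f i * q k (A - {i}) / (f i + q k (A - {i})))"
      using esym_quotient_recursion(1)[OF finA pos(2)] posB by (simp add: q_def)
    have "real (Suc (Suc k)) * q (Suc k) A \<le> real (Suc k) * q k A"
    proof (cases k)
      case 0
      have "2 * esym A 2 f \<le> (sum f A)\<^sup>2"
        using esym_2[OF finA, of f] sum_nonneg[of A "\<lambda>i. (f i)\<^sup>2"] by simp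
      then show ?thesis using pos finA unfolding q_def 0
        by (simp add: esym_1 divide_simps power2_eq_square numeral_2_eq_2)
    next
      case (Suc k')
      have "(\<Sum>i\<in>A. f i * q k (A - {i}) / (f i + q k (A - {i})))
         \<le> (\<Sum>i\<in>A. f i * q k' (A - {i}) / (f i + q k' (A - {i})))"
      proof (rule sum_mono)
        fix i assume i: "i \<in> A"
        have "esym (A - {i}) (Suc (Suc k')) f * esym (A - {i}) k' f \<le> (esym (A - {i}) (Suc k') f)\<^sup>2"
          using IH[OF i] cone[OF i] Suc garding_cone_Suc by blast
        then have "q k (A - {i}) \<le> q k' (A - {i})"
          using posB[OF i, of k] posB[OF i, of k'] Suc
          by (simp add: q_def divide_simps power2_eq_square mult.commute)
        moreover have "f i + q k (A - {i}) > 0"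
          using esym_quotient_recursion(2)[OF finA pos(2) _ _ i] posB by (simp add: q_def)
        ultimately show "f i * q k (A - {i}) / (f i + q k (A - {i}))
             \<le> f i * q k' (A - {i}) / (f i + q k' (A - {i}))"
          by (rule esym_quotient_le[rotated])
      qed
      also have "\<dots> = real (Suc k) * q k A"
        using esym_quotient_recursion(1)[OF finA, of "Suc k'" f] pos posB Suc by (simp add: q_def)
      finally show ?thesis using rec by simp
    qed
    also have "\<dots> \<le> real (Suc (Suc k)) * q k A"
      using pos by (intro mult_right_mono) (auto simp: q_def)
    finally have "q (Suc k) A \<le> q k A" by simp
    then show ?thesis using pos by (simp add: q_def divide_simps power2_eq_square mult.commute)
  qed
  show ?case using remove newton by blast
qed

lemma garding_cone_remove:
  "finite A \<Longrightarrow> f \<in> garding_cone A (Suc k) \<Longrightarrow> i \<in> A \<Longrightarrow> f \<in> garding_cone (A - {i}) k"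
  using garding_cone_remove_newton by blast

text \<open>The theorem of Marcus and Lopes, together with the convexity of the cone, by induction on the degree
through the recursion for the quotients.\<close>

lemma garding_cone_add:
  assumes "finite A" "f \<in> garding_cone A (Suc k)" "g \<in> garding_cone A (Suc k)"
  shows "(\<lambda>i. f i + g i) \<in> garding_cone A (Suc k) \<and>
    esym A (Suc k) f / esym A k f + esym A (Suc k) g / esym A k g
      \<le> esym A (Suc k) (\<lambda>i. f i + g i) / esym A k (\<lambda>i. f i + g i)"
  using assms
proof (induction k arbitrary: A)
  case 0
  then show ?case by (simp add: garding_cone_def esym_1 sum.distrib)
next
  case (Suc k)
  define h where "h = (\<lambda>i. f i + g i)"
  define q where "q l B u = esym B (Suc l) u / esym B l u" for l and B :: "'a set" and u
  note fin = Suc.prems(1)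
  have fg: "f \<in> garding_cone A (Suc k)" "g \<in> garding_cone A (Suc k)"
    using Suc.prems by (auto simp: garding_cone_Suc)
  have hk: "h \<in> garding_cone A (Suc k)"
    using Suc.IH[OF fin fg] by (simp add: h_def)
  have cone: "u \<in> garding_cone (A - {i}) (Suc k)" if "i \<in> A" "u \<in> {f, g}" for u i
    using that Suc.prems garding_cone_remove[OF fin] by auto
  have B: "h \<in> garding_cone (A - {i}) (Suc k)" "q k (A - {i}) f + q k (A - {i}) g \<le> q k (A - {i}) h"
    if "i \<in> A" for i
    using Suc.IH[of "A - {i}"] cone[OF that] fin by (simp_all add: h_def q_def)
  have cone': "u \<in> garding_cone (A - {i}) (Suc k)" if "i \<in> A" "u \<in> {f, g, h}" for u i
    using that cone B by auto
  have pos: "esym A (Suc k) u > 0" "i \<in> A \<Longrightarrow> esym (A - {i}) k u > 0" if "u \<in> {f, g, h}" for u i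
    using that fg hk garding_coneD[OF _ order.refl fin] garding_coneD[OF cone', of i u k] fin by auto
  have rec: "real (Suc (Suc k)) * q (Suc k) A u = (\<Sum>i\<in>A. u i * q k (A - {i}) u / (u i + q k (A - {i}) u))"
    and den: "i \<in> A \<Longrightarrow> u i + q k (A - {i}) u > 0" if "u \<in> {f, g, h}" for u i
    using esym_quotient_recursion[OF fin pos(1)[OF that]] pos(2)[OF that] by (simp_all add: q_def)
  have "real (Suc (Suc k)) * (q (Suc k) A f + q (Suc k) A g) =
     (\<Sum>i\<in>A. f i * q k (A - {i}) f / (f i + q k (A - {i}) f) + g i * q k (A - {i}) g / (g i + q k (A - {i}) g))"
    using rec[of f] rec[of g] by (simp add: distrib_left sum.distrib)
  also have "\<dots> \<le> (\<Sum>i\<in>A. h i * q k (A - {i}) h / (h i + q k (A - {i}) h))"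
  proof (rule sum_mono)
    fix i assume i: "i \<in> A"
    let ?y = "q k (A - {i}) f + q k (A - {i}) g"
    have "f i * q k (A - {i}) f / (f i + q k (A - {i}) f) + g i * q k (A - {i}) g / (g i + q k (A - {i}) g)
       \<le> h i * ?y / (h i + ?y)"
      unfolding h_def by (rule parallel_sum_superadditive) (use den[OF _ i] in auto)
    also have "\<dots> \<le> h i * q k (A - {i}) h / (h i + q k (A - {i}) h)"
    proof (rule esym_quotient_le[OF _ B(2)[OF i]])
      show "0 < h i + ?y" using den[of f i] den[of g i] i by (simp add: h_def)
    qed
    finally show "f i * q k (A - {i}) f / (f i + q k (A - {i}) f) + g i * q k (A - {i}) g / (g i + q k (A - {i}) g)
      \<le> h i * q k (A - {i}) h / (h i + q k (A - {i}) h)" .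
  qed
  also have "\<dots> = real (Suc (Suc k)) * q (Suc k) A h" using rec[of h] by simp
  finally have le: "q (Suc k) A f + q (Suc k) A g \<le> q (Suc k) A h" by simp
  moreover have "q (Suc k) A f > 0" "q (Suc k) A g > 0"
    using Suc.prems(2,3) garding_coneD[OF _ order.refl fin] pos(1) by (auto simp: q_def intro!: divide_pos_pos)
  ultimately have "q (Suc k) A h > 0" by linarith
  then have "esym A (Suc (Suc k)) h > 0" using pos(1)[of h] by (simp add: q_def zero_less_divide_iff)
  then show ?case using hk le by (simp add: h_def q_def garding_cone_Suc)
qed

lemma esym_line_deriv2:
  assumes "finite A"
  shows "((\<lambda>s. \<Sum>i\<in>A. g i * esym (A - {i}) (Suc l) (\<lambda>i. f i + s * g i)) has_field_derivative
     (\<Sum>i\<in>A. \<Sum>j\<in>A - {i}. g i * g j * esym (A - {i} - {j}) l (\<lambda>i. f i + s * g i))) (at s)"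
proof -
  have "((\<lambda>s. g i * esym (A - {i}) (Suc l) (\<lambda>i. f i + s * g i)) has_field_derivative
    (\<Sum>j\<in>A - {i}. g i * g j * esym (A - {i} - {j}) l (\<lambda>i. f i + s * g i))) (at s)" for i
    using DERIV_cmult[OF esym_line_deriv[of "A - {i}" l f g s], of "g i"] assms
    by (simp add: sum_distrib_left mult.assoc)
  then show ?thesis by (intro DERIV_sum)
qed

lemma second_derivative_test_min:
  fixes f f' :: "real \<Rightarrow> real"
  assumes f: "\<forall>\<^sub>F t in at 0. (f has_field_derivative f' t) (at t)" "(f has_field_derivative f' 0) (at 0)"
    and f': "(f' has_field_derivative c) (at 0)"
    and min: "\<forall>\<^sub>F t in at 0. f 0 \<le> f t"
  shows "f' 0 = 0" "c \<ge> 0"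
proof -
  show f'0: "f' 0 = 0"
  proof -
    obtain d where "d > 0" "\<forall>t. t \<noteq> 0 \<and> dist t 0 < d \<longrightarrow> f 0 \<le> f t"
      using min unfolding eventually_at by auto
    then have "\<forall>y. \<bar>0 - y\<bar> < d \<longrightarrow> f 0 \<le> f y" by (metis abs_minus_commute dist_real_def order.refl)
    with \<open>d > 0\<close> show ?thesis using DERIV_local_min[OF f(2)] by blast
  qed
  show "c \<ge> 0"
  proof (rule ccontr)
    assume "\<not> c \<ge> 0"
    then have c: "c < 0" by simp
    obtain d1 where d1: "d1 > 0" "\<And>h. 0 < h \<Longrightarrow> h < d1 \<Longrightarrow> f' (0 + h) < f' 0"
      using DERIV_neg_dec_right[OF f' c] by blast
    obtain d2 where d2: "d2 > 0" "\<And>t. t \<noteq> 0 \<Longrightarrow> dist t 0 < d2 \<Longrightarrow> (f has_field_derivative f' t) (at t)"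
      using f(1) unfolding eventually_at by auto
    obtain d3 where d3: "d3 > 0" "\<And>t. t \<noteq> 0 \<Longrightarrow> dist t 0 < d3 \<Longrightarrow> f 0 \<le> f t"
      using min unfolding eventually_at by auto
    define e where "e = min d1 (min d2 d3) / 2"
    have e: "e > 0" "e < d1" "e < d2" "e < d3" using d1(1) d2(1) d3(1) by (auto simp: e_def)
    have "f e < f 0"
    proof (rule DERIV_neg_imp_decreasing_open[OF e(1)])
      fix x assume x: "0 < x" "x < e"
      show "\<exists>y. (f has_field_derivative y) (at x) \<and> y < 0"
        using d2(2)[of x] d1(2)[of x] x e f'0 by (auto simp: dist_real_def)
    next
      show "continuous_on {0..e} f"
      proof (rule continuous_at_imp_continuous_on, rule ballI)
        fix x assume x: "x \<in> {0..e}"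
        show "isCont f x"
          using d2(2)[of x] f(2) x e DERIV_isCont by (cases "x = 0") (auto simp: dist_real_def)
      qed
    qed
    moreover have "f 0 \<le> f e" using d3(2)[of e] e by (auto simp: dist_real_def)
    ultimately show False by simp
  qed
qed

lemma garding_cone_open_line:
  assumes "finite A" "f \<in> garding_cone A k"
  shows "\<forall>\<^sub>F s in nhds 0. (\<lambda>i. f i + s * g i) \<in> garding_cone A k"
proof -
  have "\<forall>\<^sub>F s in nhds 0. esym A l (\<lambda>i. f i + s * g i) > 0" if "l \<in> {1..k}" for l
  proof -
    have "isCont (\<lambda>s. esym A l (\<lambda>i. f i + s * g i)) 0"
      using esym_line_continuous[OF assms(1), of UNIV l f g] by (simp add: continuous_on_eq_continuous_at)
    then have "((\<lambda>s. esym A l (\<lambda>i. f i + s * g i)) \<longlongrightarrow> esym A l (\<lambda>i. f i + 0 * g i)) (nhds 0)"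
      using tendsto_at_iff_tendsto_nhds[of "\<lambda>s. esym A l (\<lambda>i. f i + s * g i)" 0]
      by (simp only: isCont_def)
    then show ?thesis
      using assms(2) that by (intro order_tendstoD(1)) (auto simp: garding_cone_def)
  qed
  then show ?thesis
    unfolding garding_cone_def by (simp add: eventually_ball_finite)
qed

text \<open>Superadditivity and homogeneity bound the arithmetic, hence the geometric, mean of a quotient
\<open>\<sigma>\<^sub>j\<^sub>+\<^sub>1 / \<sigma>\<^sub>j\<close> at \<open>f + g\<close> and \<open>f - g\<close> by its value at \<open>f\<close>. The product over \<open>j\<close> telescopes to \<open>\<sigma>\<^sub>k / \<sigma>\<^sub>1\<close>.\<close>

lemma esym_quotient_line_midpoint:
  assumes "finite A" "f \<in> garding_cone A (Suc k)" "(\<lambda>i. f i + g i) \<in> garding_cone A (Suc k)"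
    "(\<lambda>i. f i - g i) \<in> garding_cone A (Suc k)"
  shows "esym A (Suc k) (\<lambda>i. f i + g i) * esym A (Suc k) (\<lambda>i. f i - g i) * (esym A 1 f)\<^sup>2
    \<le> (esym A (Suc k) f)\<^sup>2 * (esym A 1 (\<lambda>i. f i + g i) * esym A 1 (\<lambda>i. f i - g i))"
  using assms(2-4)
proof (induction k)
  case 0
  then show ?case by (simp add: mult.commute)
next
  case (Suc k)
  define a b c where "a l = esym A l (\<lambda>i. f i + g i)" and "b l = esym A l (\<lambda>i. f i - g i)"
    and "c l = esym A l f" for l
  have pos: "a l > 0" "b l > 0" "c l > 0" if "l \<le> Suc (Suc k)" for l
    using Suc.prems garding_coneD[OF _ that assms(1)] by (auto simp: a_def b_def c_def)
  have IH: "a (Suc k) * b (Suc k) * (c 1)\<^sup>2 \<le> (c (Suc k))\<^sup>2 * (a 1 * b 1)"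
    using Suc garding_cone_mono[OF _ le_SucI[OF order.refl]] unfolding a_def b_def c_def by blast
  have "a (Suc (Suc k)) / a (Suc k) + b (Suc (Suc k)) / b (Suc k)
     \<le> esym A (Suc (Suc k)) (\<lambda>i. 2 * f i) / esym A (Suc k) (\<lambda>i. 2 * f i)"
  proof -
    have eq: "(\<lambda>i. (f i + g i) + (f i - g i)) = (\<lambda>i. 2 * f i)" by (rule ext) simp
    show ?thesis
      using garding_cone_add[OF assms(1) Suc.prems(2,3)] unfolding eq a_def b_def by blast
  qed
  also have "\<dots> = 2 * (c (Suc (Suc k)) / c (Suc k))"
    by (simp add: esym_scale[OF assms(1)] c_def)
  finally have sum: "a (Suc (Suc k)) / a (Suc k) + b (Suc (Suc k)) / b (Suc k) \<le> 2 * (c (Suc (Suc k)) / c (Suc k))" .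
  define x y z where "x = a (Suc (Suc k)) / a (Suc k)" and "y = b (Suc (Suc k)) / b (Suc k)"
    and "z = c (Suc (Suc k)) / c (Suc k)"
  have xyz: "x > 0" "y > 0" "z > 0" "x + y \<le> 2 * z"
    using pos sum by (auto simp: x_def y_def z_def)
  have "4 * (x * y) \<le> (x + y)\<^sup>2"
    using zero_le_power2[of "x - y"] by (simp add: power2_eq_square algebra_simps)
  also have "\<dots> \<le> (2 * z)\<^sup>2" using xyz by (intro power_mono) auto
  finally have xy: "x * y \<le> z\<^sup>2" by (simp add: power2_eq_square)
  have eqs: "a (Suc (Suc k)) = x * a (Suc k)" "b (Suc (Suc k)) = y * b (Suc k)" "c (Suc (Suc k)) = z * c (Suc k)"
    using pos[of "Suc k"] by (simp_all add: x_def y_def z_def)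
  have "(x * y) * (a (Suc k) * b (Suc k) * (c 1)\<^sup>2) \<le> z\<^sup>2 * ((c (Suc k))\<^sup>2 * (a 1 * b 1))"
    by (intro mult_mono IH xy) (use pos[of "Suc k"] pos[of 1] in auto)
  then have "a (Suc (Suc k)) * b (Suc (Suc k)) * (c 1)\<^sup>2 \<le> (c (Suc (Suc k)))\<^sup>2 * (a 1 * b 1)"
    unfolding eqs by (simp add: power_mult_distrib ac_simps)
  then show ?case by (simp only: a_def b_def c_def)
qed

text \<open>The Hessian of \<open>log \<sigma>\<^sub>k - log \<sigma>\<^sub>1\<close> is nonpositive in the direction \<open>g\<close>. The midpoint inequality says
that a function of the step \<open>s\<close>, vanishing at \<open>0\<close>, is nonnegative, and this is its second-order condition.\<close>

lemma esym_log_quotient_concave: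
  assumes fin: "finite A" and f: "f \<in> garding_cone A (Suc (Suc k))"
  defines "c \<equiv> esym A (Suc (Suc k)) f"
  shows "(\<Sum>i\<in>A. esym (A - {i}) (Suc k) f / c * g i)\<^sup>2
     - (\<Sum>i\<in>A. \<Sum>j\<in>A - {i}. esym (A - {i} - {j}) k f / c * (g i * g j)) \<ge> (sum g A / sum f A)\<^sup>2"
proof -
  let ?l = "\<lambda>s i. f i + s * g i"
  define Z Z1 Z2 where "Z s = esym A (Suc (Suc k)) (?l s)"
    and "Z1 s = (\<Sum>i\<in>A. g i * esym (A - {i}) (Suc k) (?l s))"
    and "Z2 s = (\<Sum>i\<in>A. \<Sum>j\<in>A - {i}. g i * g j * esym (A - {i} - {j}) k (?l s))" for s
  have Z: "(Z has_field_derivative Z1 s) (at s)" "(Z1 has_field_derivative Z2 s) (at s)" for s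
    unfolding Z_def Z1_def Z2_def by (rule esym_line_deriv[OF fin] esym_line_deriv2[OF fin])+
  have Zm: "((\<lambda>s. Z (- s)) has_field_derivative - Z1 (- s)) (at s)"
    "((\<lambda>s. Z1 (- s)) has_field_derivative - Z2 (- s)) (at s)" for s
    using DERIV_chain2[OF Z(1)[of "- s"] DERIV_minus[OF DERIV_ident]]
      DERIV_chain2[OF Z(2)[of "- s"] DERIV_minus[OF DERIV_ident]] by simp_all
  define y0 y1 where "y0 = sum f A" and "y1 = sum g A"
  \<comment> \<open>The midpoint inequality for the step \<open>s * g\<close> states \<open>W s \<ge> 0\<close>.\<close>
  define W where "W s = (Z 0)\<^sup>2 * ((y0 + s * y1) * (y0 - s * y1)) - Z s * Z (- s) * y0\<^sup>2" for s
  define W1 where "W1 s = (Z 0)\<^sup>2 * (- 2 * s * y1\<^sup>2) - (Z1 s * Z (- s) - Z s * Z1 (- s)) * y0\<^sup>2" for s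
  have W1: "(W has_field_derivative W1 s) (at s)" for s
    unfolding W_def W1_def
    by (rule derivative_eq_intros Z Zm refl)+ (simp add: algebra_simps power2_eq_square)
  have W2: "(W1 has_field_derivative
      (Z 0)\<^sup>2 * (- 2 * y1\<^sup>2) - (Z2 0 * Z (- 0) - 2 * Z1 0 * Z1 (- 0) + Z 0 * Z2 (- 0)) * y0\<^sup>2) (at 0)"
    unfolding W1_def
    by (rule derivative_eq_intros Z Zm refl)+ (simp add: algebra_simps power2_eq_square)
  have "\<forall>\<^sub>F s in nhds 0. ?l s \<in> garding_cone A (Suc (Suc k))"
       "\<forall>\<^sub>F s in nhds 0. (\<lambda>i. f i + s * - g i) \<in> garding_cone A (Suc (Suc k))"
    by (rule garding_cone_open_line[OF fin f])+
  then have "\<forall>\<^sub>F s in nhds 0. W 0 \<le> W s"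
  proof eventually_elim
    case (elim s)
    have "Z s * Z (- s) * y0\<^sup>2 \<le> (Z 0)\<^sup>2 * ((y0 + s * y1) * (y0 - s * y1))"
      using esym_quotient_line_midpoint[OF fin f, of "\<lambda>i. s * g i"] elim fin
      by (simp add: Z_def y0_def y1_def esym_1 sum.distrib sum_subtractf sum_distrib_left)
    then show ?case by (simp add: W_def power2_eq_square)
  qed
  then have "\<forall>\<^sub>F s in at 0. W 0 \<le> W s" unfolding eventually_at_filter by eventually_elim simp
  then have "(Z 0)\<^sup>2 * (- 2 * y1\<^sup>2) - (Z2 0 * Z (- 0) - 2 * Z1 0 * Z1 (- 0) + Z 0 * Z2 (- 0)) * y0\<^sup>2 \<ge> 0"
    by (intro second_derivative_test_min(2)[of W W1, OF _ W1 W2]) (simp_all add: W1)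
  then have main: "(Z 0 * y1)\<^sup>2 \<le> ((Z1 0)\<^sup>2 - Z 0 * Z2 0) * y0\<^sup>2"
    by (simp add: algebra_simps power2_eq_square)
  have c: "c > 0" "Z 0 = c" using garding_coneD[OF f order.refl fin] by (simp_all add: c_def Z_def)
  have y0: "y0 > 0" unfolding y0_def by (rule garding_cone_sum_pos[OF f _ fin]) simp
  have "(y1 / y0)\<^sup>2 \<le> ((Z1 0)\<^sup>2 - c * Z2 0) / c\<^sup>2"
    using main c y0 by (simp add: divide_simps power_mult_distrib power_divide ac_simps)
  also have "\<dots> = (Z1 0 / c)\<^sup>2 - Z2 0 / c"
    using c(1) by (simp add: diff_divide_distrib power_divide power2_eq_square)
  also have "Z1 0 / c = (\<Sum>i\<in>A. esym (A - {i}) (Suc k) f / c * g i)"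
    unfolding Z1_def sum_divide_distrib by (intro sum.cong) (simp_all add: mult.commute)
  also have "Z2 0 / c = (\<Sum>i\<in>A. \<Sum>j\<in>A - {i}. esym (A - {i} - {j}) k f / c * (g i * g j))"
    unfolding Z2_def sum_divide_distrib by (intro sum.cong) (simp_all add: mult.commute)
  finally show ?thesis by (simp add: y0_def y1_def)
qed

section \<open>Sums of principal minors\<close>

lemma det_has_field_derivative:
  fixes A :: "real \<Rightarrow> real^'n^'n"
  assumes "\<And>i j. ((\<lambda>s. A s $ i $ j) has_field_derivative A' $ i $ j) (at s)"
  shows "((\<lambda>s. det (A s)) has_field_derivative
     (\<Sum>r\<in>UNIV. det (\<chi> i. if i = r then A' $ i else A s $ i))) (at s)"
proof -
  have "((\<lambda>s. of_int (sign p) * (\<Prod>i\<in>UNIV. A s $ i $ p i)) has_field_derivative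
      of_int (sign p) * (\<Sum>r\<in>UNIV. A' $ r $ p r * (\<Prod>i\<in>UNIV - {r}. A s $ i $ p i))) (at s)" for p
    by (intro DERIV_cmult has_field_derivative_prod assms)
  then have "((\<lambda>s. det (A s)) has_field_derivative
     (\<Sum>p | p permutes UNIV. of_int (sign p) * (\<Sum>r\<in>UNIV. A' $ r $ p r * (\<Prod>i\<in>UNIV - {r}. A s $ i $ p i)))) (at s)"
    unfolding det_def by (intro DERIV_sum)
  also have "(\<Sum>p | p permutes UNIV. of_int (sign p) * (\<Sum>r\<in>UNIV. A' $ r $ p r * (\<Prod>i\<in>UNIV - {r}. A s $ i $ p i)))
    = (\<Sum>r\<in>UNIV. det (\<chi> i. if i = r then A' $ i else A s $ i))"
    unfolding det_def sum_distrib_left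
  proof (subst sum.swap, intro sum.cong refl arg_cong2[where f = "(*)"])
    fix r :: 'n and p :: "'n \<Rightarrow> 'n"
    have "(\<Prod>i\<in>UNIV. (\<chi> i. if i = r then A' $ i else A s $ i) $ i $ p i)
      = A' $ r $ p r * (\<Prod>i\<in>UNIV - {r}. (\<chi> i. if i = r then A' $ i else A s $ i) $ i $ p i)"
      by (subst prod.remove[of UNIV r]) auto
    also have "(\<Prod>i\<in>UNIV - {r}. (\<chi> i. if i = r then A' $ i else A s $ i) $ i $ p i)
      = (\<Prod>i\<in>UNIV - {r}. A s $ i $ p i)"
      by (intro prod.cong) auto
    finally show "A' $ r $ p r * (\<Prod>i\<in>UNIV - {r}. A s $ i $ p i)
      = (\<Prod>i\<in>UNIV. (\<chi> i. if i = r then A' $ i else A s $ i) $ i $ p i)" ..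
  qed
  finally show ?thesis .
qed

lemma det_diagonal_replace_row:
  fixes c :: "'n::finite \<Rightarrow> real" and a :: "real^'n"
  shows "det (\<chi> l. if l = i then a else c l *s axis l 1) = a $ i * (\<Prod>l\<in>UNIV - {i}. c l)"
proof -
  let ?A = "(\<chi> l. if l = i then a else c l *s axis l 1) :: real^'n^'n"
  have zero: "(\<Prod>l\<in>UNIV. ?A $ l $ p l) = 0" if p: "p permutes UNIV" "p \<noteq> id" for p
  proof -
    have "\<exists>l. l \<noteq> i \<and> p l \<noteq> l"
    proof (rule ccontr)
      assume "\<not> ?thesis"
      then have "p permutes {i}" using p(1) by (auto simp: permutes_def)
      then show False using p(2) by simp
    qed
    then obtain l where "l \<noteq> i" "p l \<noteq> l" by blast
    then have "?A $ l $ p l = 0" by (simp add: axis_def)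
    then show ?thesis by (meson UNIV_I finite prod_zero)
  qed
  have "det ?A = (\<Sum>p\<in>{id}. of_int (sign p) * (\<Prod>l\<in>UNIV. ?A $ l $ p l))"
    unfolding det_def by (rule sum.mono_neutral_right) (use zero in \<open>auto simp: permutes_id\<close>)
  also have "\<dots> = a $ i * (\<Prod>l\<in>UNIV - {i}. ?A $ l $ l)"
    by (simp add: prod.remove[of UNIV i])
  also have "(\<Prod>l\<in>UNIV - {i}. ?A $ l $ l) = (\<Prod>l\<in>UNIV - {i}. c l)"
    by (intro prod.cong) (auto simp: axis_def)
  finally show ?thesis .
qed

text \<open>In the Leibniz formula only the identity and the transposition of \<open>i\<close> and \<open>j\<close> survive.\<close>

lemma det_diagonal_replace_two_rows:
  fixes c :: "'n::finite \<Rightarrow> real" and a b :: "real^'n"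
  assumes "i \<noteq> j"
  shows "det (\<chi> l. if l = i then a else if l = j then b else c l *s axis l 1)
     = (a $ i * b $ j - a $ j * b $ i) * (\<Prod>l\<in>UNIV - {i} - {j}. c l)"
proof -
  let ?A = "(\<chi> l. if l = i then a else if l = j then b else c l *s axis l 1) :: real^'n^'n"
  let ?t = "Transposition.transpose i j"
  have zero: "(\<Prod>l\<in>UNIV. ?A $ l $ p l) = 0" if p: "p permutes UNIV" "p \<noteq> id" "p \<noteq> ?t" for p
  proof -
    have "\<exists>l. l \<noteq> i \<and> l \<noteq> j \<and> p l \<noteq> l"
    proof (rule ccontr)
      assume "\<not> ?thesis"
      then have "p permutes {i, j}" using p(1) by (auto simp: permutes_def)
      then show False using p(2,3) by (simp add: permutes_doubleton_iff)
    qed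
    then obtain l where "l \<noteq> i" "l \<noteq> j" "p l \<noteq> l" by blast
    then have "?A $ l $ p l = 0" by (simp add: axis_def)
    then show ?thesis by (meson UNIV_I finite prod_zero)
  qed
  have rest: "(\<Prod>l\<in>UNIV - {i} - {j}. ?A $ l $ p l) = (\<Prod>l\<in>UNIV - {i} - {j}. c l)" if "p \<in> {id, ?t}" for p
    using that by (intro prod.cong) (auto simp: axis_def Transposition.transpose_def)
  have "?t \<noteq> id" using assms by (metis id_apply transpose_apply_first)
  have split: "(\<Prod>l\<in>UNIV. ?A $ l $ p l) = ?A $ i $ p i * (?A $ j $ p j * (\<Prod>l\<in>UNIV - {i} - {j}. ?A $ l $ p l))" for p
    using assms by (subst prod.remove[of UNIV i]; simp) (subst prod.remove[of "UNIV - {i}" j]; simp)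
  have "det ?A = (\<Sum>p\<in>{id, ?t}. of_int (sign p) * (\<Prod>l\<in>UNIV. ?A $ l $ p l))"
    unfolding det_def
    by (rule sum.mono_neutral_right) (use zero in \<open>auto simp: permutes_id permutes_swap_id\<close>)
  also have "\<dots> = (\<Prod>l\<in>UNIV. ?A $ l $ l) - (\<Prod>l\<in>UNIV. ?A $ l $ ?t l)"
    using \<open>?t \<noteq> id\<close> assms by (simp add: sign_swap_id)
  also have "\<dots> = (a $ i * b $ j - a $ j * b $ i) * (\<Prod>l\<in>UNIV - {i} - {j}. c l)"
    unfolding split[of ?t] split[of "\<lambda>l. l"] rest[of ?t, simplified] using rest[of id] assms
    by (simp add: algebra_simps)
  finally show ?thesis .
qed

text \<open>Unit rows outside \<open>I\<close> turn the principal minor with index set \<open>I\<close> into a determinant over the full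
index type.\<close>

definition minor_rows :: "'n set \<Rightarrow> real^'n^'n \<Rightarrow> real^'n^'n" where
  "minor_rows I M = (\<chi> i. if i \<in> I then M $ i else axis i 1)"

text \<open>The elementary symmetric function of the eigenvalues as a polynomial in the entries, which can be
differentiated along a curve of matrices.\<close>

definition minor_sum :: "nat \<Rightarrow> real^'n^'n \<Rightarrow> real" where
  "minor_sum l M = (\<Sum>I | card I = l. det (minor_rows I M))"

lemma det_shift_minors:
  fixes M :: "real^'n^'n"
  shows "det (mat t - M) = (\<Sum>I\<in>UNIV. (- 1) ^ card I * t ^ (CARD('n) - card I) * det (minor_rows I M))"
proof -
  have "det (mat t - M) = (\<Sum>p | p permutes UNIV. of_int (sign p) *
      (\<Prod>i\<in>UNIV. - M $ i $ p i + (if p i = i then t else 0)))"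
    unfolding det_def by (intro sum.cong prod.cong arg_cong2[where f = "(*)"]) (auto simp: mat_def)
  also have "\<dots> = (\<Sum>p | p permutes UNIV. \<Sum>I\<in>UNIV. of_int (sign p) *
      ((\<Prod>i\<in>I. - M $ i $ p i) * (\<Prod>i\<in>UNIV - I. if p i = i then t else 0)))"
    by (simp only: prod_add[OF finite] sum_distrib_left Pow_UNIV)
  also have "\<dots> = (\<Sum>p | p permutes UNIV. \<Sum>I\<in>UNIV. of_int (sign p) *
      ((- 1) ^ card I * t ^ (CARD('n) - card I) * (\<Prod>i\<in>UNIV. minor_rows I M $ i $ p i)))"
  proof (intro sum.cong refl)
    fix p :: "'n \<Rightarrow> 'n" and I :: "'n set"
    have 1: "(\<Prod>i\<in>I. - M $ i $ p i) = (- 1) ^ card I * (\<Prod>i\<in>I. minor_rows I M $ i $ p i)"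
      by (subst prod_uminus) (auto simp: minor_rows_def)
    have "(\<Prod>i\<in>UNIV - I. if p i = i then t else 0) = (\<Prod>i\<in>UNIV - I. t * minor_rows I M $ i $ p i)"
      by (intro prod.cong) (auto simp: minor_rows_def axis_def)
    also have "\<dots> = t ^ (CARD('n) - card I) * (\<Prod>i\<in>UNIV - I. minor_rows I M $ i $ p i)"
      by (simp add: prod.distrib card_Diff_subset)
    finally have 2: "(\<Prod>i\<in>UNIV - I. if p i = i then t else 0)
      = t ^ (CARD('n) - card I) * (\<Prod>i\<in>UNIV - I. minor_rows I M $ i $ p i)" .
    have 3: "(\<Prod>i\<in>UNIV. minor_rows I M $ i $ p i)
       = (\<Prod>i\<in>UNIV - I. minor_rows I M $ i $ p i) * (\<Prod>i\<in>I. minor_rows I M $ i $ p i)"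
      by (rule prod.subset_diff) auto
    show "of_int (sign p) * ((\<Prod>i\<in>I. - M $ i $ p i) * (\<Prod>i\<in>UNIV - I. if p i = i then t else 0))
      = of_int (sign p) * ((- 1) ^ card I * t ^ (CARD('n) - card I) * (\<Prod>i\<in>UNIV. minor_rows I M $ i $ p i))"
      unfolding 1 2 3 by simp
  qed
  also have "\<dots> = (\<Sum>I\<in>UNIV. (- 1) ^ card I * t ^ (CARD('n) - card I) * det (minor_rows I M))"
    unfolding det_def sum_distrib_left by (subst sum.swap) (intro sum.cong; simp)
  finally show ?thesis .
qed

lemma sum_by_card:
  fixes F :: "'n::finite set \<Rightarrow> real"
  shows "(\<Sum>I\<in>UNIV. t ^ (CARD('n) - card I) * F I)
    = (\<Sum>m\<le>CARD('n). (\<Sum>I | card I = CARD('n) - m. F I) * t ^ m)"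
proof -
  have "(\<Sum>I\<in>UNIV. t ^ (CARD('n) - card I) * F I)
      = (\<Sum>m\<le>CARD('n). \<Sum>I | I \<in> UNIV \<and> CARD('n) - card I = m. t ^ (CARD('n) - card I) * F I)"
    by (rule sum.group[symmetric]) auto
  also have "\<dots> = (\<Sum>m\<le>CARD('n). (\<Sum>I | card I = CARD('n) - m. F I) * t ^ m)"
  proof (rule sum.cong[OF refl])
    fix m assume m: "m \<in> {..CARD('n)}"
    have "{I :: 'n set. I \<in> UNIV \<and> CARD('n) - card I = m} = {I. card I = CARD('n) - m}"
    proof -
      have "card I \<le> CARD('n)" for I :: "'n set" by (rule card_mono) auto
      then show ?thesis using m by auto
    qed
    then show "(\<Sum>I | I \<in> UNIV \<and> CARD('n) - card I = m. t ^ (CARD('n) - card I) * F I)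
      = (\<Sum>I | card I = CARD('n) - m. F I) * t ^ m"
      using m by (auto simp: sum_distrib_left mult.commute intro!: sum.cong)
  qed
  finally show ?thesis .
qed

text \<open>Both sides are, up to sign, a coefficient of the characteristic polynomial.\<close>

lemma minor_sum_eq_sigma:
  fixes M :: "real^'n^'n" and \<kappa> :: "real^'n"
  assumes "\<forall>t. det (mat t - M) = (\<Prod>i\<in>UNIV. t - \<kappa> $ i)" "l \<le> CARD('n)"
  shows "minor_sum l M = sigma l \<kappa>"
proof -
  let ?n = "CARD('n)"
  let ?F = "\<lambda>I. (- 1) ^ card I * det (minor_rows I M)" and ?G = "\<lambda>I. (- 1) ^ card I * (\<Prod>i\<in>I. \<kappa> $ i)"
  have "(\<Sum>m\<le>?n. (\<Sum>I | card I = ?n - m. ?F I) * t ^ m) = (\<Sum>m\<le>?n. (\<Sum>I | card I = ?n - m. ?G I) * t ^ m)" for t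
  proof -
    have "(\<Sum>m\<le>?n. (\<Sum>I | card I = ?n - m. ?F I) * t ^ m) = det (mat t - M)"
      unfolding sum_by_card[symmetric] det_shift_minors by (intro sum.cong) auto
    also have "\<dots> = (\<Prod>i\<in>UNIV. t - \<kappa> $ i)" using assms(1) by simp
    also have "\<dots> = (\<Sum>I\<in>UNIV. t ^ (?n - card I) * ?G I)"
      by (simp add: prod_diff_conv_sum card_Diff_subset mult_ac)
    also have "\<dots> = (\<Sum>m\<le>?n. (\<Sum>I | card I = ?n - m. ?G I) * t ^ m)" by (rule sum_by_card)
    finally show ?thesis .
  qed
  then have "\<forall>m\<le>?n. (\<Sum>I | card I = ?n - m. ?F I) = (\<Sum>I | card I = ?n - m. ?G I)"
    by (subst polyfun_eq_coeffs[symmetric]) auto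
  from this[rule_format, of "?n - l"] assms(2)
  have "(\<Sum>I | card I = l. ?F I) = (\<Sum>I | card I = l. ?G I)" by simp
  moreover have "(\<Sum>I | card I = l. (- 1) ^ card I * f I) = (- 1) ^ l * (\<Sum>I | card I = l. f I)"
    for f :: "'n set \<Rightarrow> real"
    unfolding sum_distrib_left by (intro sum.cong) auto
  ultimately show ?thesis by (simp add: sigma_def minor_sum_def)
qed

text \<open>Double counting of the pairs of a set \<open>I\<close> and an element \<open>i\<close> of it, as pairs of \<open>i\<close> and \<open>I - {i}\<close>.\<close>

lemma sum_card_pick:
  assumes "finite A"
  shows "(\<Sum>I | I \<subseteq> A \<and> card I = Suc l. \<Sum>i\<in>I. F i (I - {i}))
    = (\<Sum>i\<in>A. \<Sum>J | J \<subseteq> A - {i} \<and> card J = l. F i J)"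
proof -
  have finI: "finite {I. I \<subseteq> A \<and> card I = m}" for m using assms by simp
  have "(\<Sum>I | I \<subseteq> A \<and> card I = Suc l. \<Sum>i\<in>I. F i (I - {i}))
     = (\<Sum>I | I \<subseteq> A \<and> card I = Suc l. \<Sum>i | i \<in> A \<and> i \<in> I. F i (I - {i}))"
    by (intro sum.cong refl) auto
  also have "\<dots> = (\<Sum>i\<in>A. \<Sum>I | I \<in> {I. I \<subseteq> A \<and> card I = Suc l} \<and> i \<in> I. F i (I - {i}))"
    by (rule sum.swap_restrict[OF finI assms])
  also have "\<dots> = (\<Sum>i\<in>A. \<Sum>J | J \<subseteq> A - {i} \<and> card J = l. F i J)"
  proof (rule sum.cong[OF refl])
    fix i assume i: "i \<in> A"
    show "(\<Sum>I | I \<in> {I. I \<subseteq> A \<and> card I = Suc l} \<and> i \<in> I. F i (I - {i}))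
       = (\<Sum>J | J \<subseteq> A - {i} \<and> card J = l. F i J)"
    proof (rule sum.reindex_bij_witness[where i = "insert i" and j = "\<lambda>I. I - {i}"])
      fix J assume J: "J \<in> {J. J \<subseteq> A - {i} \<and> card J = l}"
      then have "finite J" "i \<notin> J" using assms by (auto intro: finite_subset)
      then show "insert i J \<in> {I. I \<in> {I. I \<subseteq> A \<and> card I = Suc l} \<and> i \<in> I}"
        using J i by auto
    qed (use assms finite_subset in \<open>auto simp: insert_absorb\<close>)
  qed
  finally show ?thesis .
qed

definition minor_sum_deriv :: "nat \<Rightarrow> real^'n^'n \<Rightarrow> real^'n^'n \<Rightarrow> real" where
  "minor_sum_deriv l M M' = (\<Sum>I | card I = l. \<Sum>r\<in>I. det (\<chi> i. if i = r then M' $ i else minor_rows I M $ i))"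

lemma minor_sum_has_derivative:
  fixes A :: "real \<Rightarrow> real^'n^'n"
  assumes "\<And>i j. ((\<lambda>s. A s $ i $ j) has_field_derivative A' $ i $ j) (at s)"
  shows "((\<lambda>s. minor_sum l (A s)) has_field_derivative minor_sum_deriv l (A s) A') (at s)"
proof -
  have "((\<lambda>s. det (minor_rows I (A s))) has_field_derivative
     (\<Sum>r\<in>I. det (\<chi> i. if i = r then A' $ i else minor_rows I (A s) $ i))) (at s)" for I
  proof -
    let ?A' = "(\<chi> i. if i \<in> I then A' $ i else 0) :: real^'n^'n"
    have "((\<lambda>s. det (minor_rows I (A s))) has_field_derivative
     (\<Sum>r\<in>UNIV. det (\<chi> i. if i = r then ?A' $ i else minor_rows I (A s) $ i))) (at s)"
      by (rule det_has_field_derivative) (use assms in \<open>auto simp: minor_rows_def\<close>)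
    also have "(\<Sum>r\<in>UNIV. det (\<chi> i. if i = r then ?A' $ i else minor_rows I (A s) $ i))
      = (\<Sum>r\<in>I. det (\<chi> i. if i = r then ?A' $ i else minor_rows I (A s) $ i))"
      by (rule sum.mono_neutral_right) (auto intro!: det_zero_row(1) simp: row_def vec_eq_iff)
    also have "\<dots> = (\<Sum>r\<in>I. det (\<chi> i. if i = r then A' $ i else minor_rows I (A s) $ i))"
      by (intro sum.cong refl arg_cong[where f = det]) (auto simp: vec_eq_iff)
    finally show ?thesis .
  qed
  then show ?thesis unfolding minor_sum_def minor_sum_deriv_def by (intro DERIV_sum)
qed

lemma minor_sum_deriv_has_derivative:
  fixes A :: "real \<Rightarrow> real^'n^'n"
  assumes A: "\<And>i j. ((\<lambda>s. A s $ i $ j) has_field_derivative A1 s $ i $ j) (at s)"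
    and A1: "\<And>i j. ((\<lambda>s. A1 s $ i $ j) has_field_derivative A2 $ i $ j) (at s)"
  shows "((\<lambda>s. minor_sum_deriv l (A s) (A1 s)) has_field_derivative
    (\<Sum>I | card I = l. \<Sum>r\<in>I. (det (\<chi> i. if i = r then A2 $ i else minor_rows I (A s) $ i)
       + (\<Sum>q\<in>I - {r}. det (\<chi> i. if i = r then A1 s $ r else if i = q then A1 s $ q else minor_rows I (A s) $ i)))))
    (at s)"
proof -
  have "((\<lambda>s. det (\<chi> i. if i = r then A1 s $ i else minor_rows I (A s) $ i)) has_field_derivative
     (det (\<chi> i. if i = r then A2 $ i else minor_rows I (A s) $ i)
       + (\<Sum>q\<in>I - {r}. det (\<chi> i. if i = r then A1 s $ r else if i = q then A1 s $ q else minor_rows I (A s) $ i)))) (at s)"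
    if r: "r \<in> I" for I r
  proof -
    let ?B = "\<lambda>s. (\<chi> i. if i = r then A1 s $ i else minor_rows I (A s) $ i) :: real^'n^'n"
    let ?B' = "(\<chi> i. if i = r then A2 $ i else if i \<in> I then A1 s $ i else 0) :: real^'n^'n"
    have "((\<lambda>s. det (?B s)) has_field_derivative
     (\<Sum>q\<in>UNIV. det (\<chi> i. if i = q then ?B' $ i else ?B s $ i))) (at s)"
      by (rule det_has_field_derivative) (use A A1 in \<open>auto simp: minor_rows_def\<close>)
    also have "(\<Sum>q\<in>UNIV. det (\<chi> i. if i = q then ?B' $ i else ?B s $ i))
      = (\<Sum>q\<in>I. det (\<chi> i. if i = q then ?B' $ i else ?B s $ i))"
      by (rule sum.mono_neutral_right) (use r in \<open>auto intro!: det_zero_row(1) simp: row_def vec_eq_iff\<close>)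
    also have "\<dots> = det (\<chi> i. if i = r then ?B' $ i else ?B s $ i)
      + (\<Sum>q\<in>I - {r}. det (\<chi> i. if i = q then ?B' $ i else ?B s $ i))"
      by (rule sum.remove) (use r in auto)
    also have "det (\<chi> i. if i = r then ?B' $ i else ?B s $ i)
      = det (\<chi> i. if i = r then A2 $ i else minor_rows I (A s) $ i)"
      by (intro arg_cong[where f = det]) (auto simp: vec_eq_iff)
    also have "(\<Sum>q\<in>I - {r}. det (\<chi> i. if i = q then ?B' $ i else ?B s $ i))
      = (\<Sum>q\<in>I - {r}. det (\<chi> i. if i = r then A1 s $ r else if i = q then A1 s $ q else minor_rows I (A s) $ i))"
      by (intro sum.cong refl arg_cong[where f = det]) (auto simp: vec_eq_iff)
    finally show ?thesis .
  qed
  then show ?thesis unfolding minor_sum_deriv_def by (intro DERIV_sum) simp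
qed

lemma minor_rows_diagonal:
  assumes "\<And>i j. i \<noteq> j \<Longrightarrow> M $ i $ j = 0"
  shows "minor_rows I M $ l = (if l \<in> I then M $ l $ l else 1) *s axis l 1"
  using assms by (auto simp: minor_rows_def vec_eq_iff axis_def)

lemma minor_sum_deriv_diagonal:
  fixes M :: "real^'n^'n"
  assumes diag: "\<And>i j. i \<noteq> j \<Longrightarrow> M $ i $ j = 0"
  shows "minor_sum_deriv (Suc l) M M'
    = (\<Sum>i\<in>UNIV. esym (UNIV - {i}) l (\<lambda>i. M $ i $ i) * M' $ i $ i)"
proof -
  have "det (\<chi> i. if i = r then M' $ i else minor_rows I M $ i) = M' $ r $ r * (\<Prod>l\<in>I - {r}. M $ l $ l)"
    if "r \<in> I" for I r
  proof -
    have "det (\<chi> i. if i = r then M' $ i else minor_rows I M $ i)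
       = det (\<chi> l. if l = r then M' $ r else (if l \<in> I then M $ l $ l else 1) *s axis l 1)"
      by (intro arg_cong[where f = det]) (simp add: vec_eq_iff minor_rows_diagonal[of M, OF diag])
    also have "\<dots> = M' $ r $ r * (\<Prod>l\<in>UNIV - {r}. if l \<in> I then M $ l $ l else 1)"
      by (rule det_diagonal_replace_row)
    also have "(\<Prod>l\<in>UNIV - {r}. if l \<in> I then M $ l $ l else 1) = (\<Prod>l\<in>I - {r}. M $ l $ l)"
      by (rule prod.mono_neutral_cong_right) auto
    finally show ?thesis .
  qed
  then have "minor_sum_deriv (Suc l) M M'
    = (\<Sum>I | I \<subseteq> UNIV \<and> card I = Suc l. \<Sum>r\<in>I. M' $ r $ r * (\<Prod>l\<in>I - {r}. M $ l $ l))"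
    unfolding minor_sum_deriv_def by (intro sum.cong) auto
  also have "\<dots> = (\<Sum>r\<in>UNIV. \<Sum>J | J \<subseteq> UNIV - {r} \<and> card J = l. M' $ r $ r * (\<Prod>l\<in>J. M $ l $ l))"
    by (rule sum_card_pick) simp
  finally show ?thesis by (simp add: esym_def sum_distrib_left mult.commute)
qed

text \<open>At a diagonal matrix the second derivative of a determinant involves the diagonal of the second
derivative and the two-by-two minors of the first. The off-diagonal products
\<open>- A1 i j * A1 j i\<close> are what distinguishes this formula from the one for \<open>\<sigma>\<^sub>l\<close> of the diagonal entries.\<close>

lemma minor_sum_second_derivative:
  fixes A :: "real \<Rightarrow> real^'n^'n"
  assumes A: "\<And>i j. ((\<lambda>s. A s $ i $ j) has_field_derivative A1 s $ i $ j) (at s)"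
    and A1: "\<And>i j. ((\<lambda>s. A1 s $ i $ j) has_field_derivative A2 $ i $ j) (at s)"
    and diag: "\<And>i j. i \<noteq> j \<Longrightarrow> A s $ i $ j = 0"
  shows "((\<lambda>s. minor_sum_deriv (Suc (Suc l)) (A s) (A1 s)) has_field_derivative
    ((\<Sum>i\<in>UNIV. esym (UNIV - {i}) (Suc l) (\<lambda>i. A s $ i $ i) * A2 $ i $ i)
     + (\<Sum>i\<in>UNIV. \<Sum>j\<in>UNIV - {i}. esym (UNIV - {i} - {j}) l (\<lambda>i. A s $ i $ i)
         * (A1 s $ i $ i * A1 s $ j $ j - A1 s $ i $ j * A1 s $ j $ i)))) (at s)"
proof -
  define m where "m = (\<lambda>i. A s $ i $ i)"
  define c where "c i j = A1 s $ i $ i * A1 s $ j $ j - A1 s $ i $ j * A1 s $ j $ i" for i j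
  have two: "det (\<chi> i. if i = r then A1 s $ r else if i = q then A1 s $ q else minor_rows I (A s) $ i)
     = c r q * (\<Prod>l\<in>I - {r} - {q}. m l)" if "r \<noteq> q" for I r q
  proof -
    have "det (\<chi> i. if i = r then A1 s $ r else if i = q then A1 s $ q else minor_rows I (A s) $ i)
       = det (\<chi> l. if l = r then A1 s $ r else if l = q then A1 s $ q else (if l \<in> I then m l else 1) *s axis l 1)"
      by (intro arg_cong[where f = det]) (simp add: vec_eq_iff minor_rows_diagonal[of "A s", OF diag] m_def)
    also have "\<dots> = c r q * (\<Prod>l\<in>UNIV - {r} - {q}. if l \<in> I then m l else 1)"
      unfolding c_def by (rule det_diagonal_replace_two_rows[OF that])
    also have "(\<Prod>l\<in>UNIV - {r} - {q}. if l \<in> I then m l else 1) = (\<Prod>l\<in>I - {r} - {q}. m l)"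
      by (rule prod.mono_neutral_cong_right) auto
    finally show ?thesis .
  qed
  let ?S = "\<lambda>F. \<Sum>I | card I = Suc (Suc l). \<Sum>r\<in>I. F I r"
  have "?S (\<lambda>I r. det (\<chi> i. if i = r then A2 $ i else minor_rows I (A s) $ i)
       + (\<Sum>q\<in>I - {r}. det (\<chi> i. if i = r then A1 s $ r else if i = q then A1 s $ q else minor_rows I (A s) $ i)))
    = minor_sum_deriv (Suc (Suc l)) (A s) A2 + ?S (\<lambda>I r. \<Sum>q\<in>I - {r}. c r q * (\<Prod>l\<in>I - {r} - {q}. m l))"
    unfolding minor_sum_deriv_def sum.distrib using two by (intro arg_cong2[where f = "(+)"] sum.cong refl) auto
  also have "?S (\<lambda>I r. \<Sum>q\<in>I - {r}. c r q * (\<Prod>l\<in>I - {r} - {q}. m l))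
    = (\<Sum>I | I \<subseteq> UNIV \<and> card I = Suc (Suc l). \<Sum>r\<in>I. \<Sum>q\<in>I - {r}. c r q * (\<Prod>l\<in>I - {r} - {q}. m l))"
    by simp
  also have "\<dots> = (\<Sum>r\<in>UNIV. \<Sum>J | J \<subseteq> UNIV - {r} \<and> card J = Suc l. \<Sum>q\<in>J. c r q * (\<Prod>l\<in>J - {q}. m l))"
    by (rule sum_card_pick) simp
  also have "\<dots> = (\<Sum>r\<in>UNIV. \<Sum>q\<in>UNIV - {r}. \<Sum>J | J \<subseteq> UNIV - {r} - {q} \<and> card J = l. c r q * (\<Prod>l\<in>J. m l))"
    by (intro sum.cong refl sum_card_pick) simp
  also have "\<dots> = (\<Sum>r\<in>UNIV. \<Sum>q\<in>UNIV - {r}. esym (UNIV - {r} - {q}) l m * c r q)"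
    by (simp add: esym_def sum_distrib_left mult.commute)
  finally have eq: "?S (\<lambda>I r. det (\<chi> i. if i = r then A2 $ i else minor_rows I (A s) $ i)
       + (\<Sum>q\<in>I - {r}. det (\<chi> i. if i = r then A1 s $ r else if i = q then A1 s $ q else minor_rows I (A s) $ i)))
    = minor_sum_deriv (Suc (Suc l)) (A s) A2 + (\<Sum>r\<in>UNIV. \<Sum>q\<in>UNIV - {r}. esym (UNIV - {r} - {q}) l m * c r q)" .
  have d: "minor_sum_deriv (Suc (Suc l)) (A s) A2 = (\<Sum>i\<in>UNIV. esym (UNIV - {i}) (Suc l) (\<lambda>i. A s $ i $ i) * A2 $ i $ i)"
    by (rule minor_sum_deriv_diagonal) (rule diag)
  show ?thesis
    using minor_sum_deriv_has_derivative[OF A A1, where l = "Suc (Suc l)"]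
    unfolding eq d m_def c_def .
qed

lemma minor_sum_diagonal:
  fixes M :: "real^'n^'n"
  assumes diag: "\<And>i j. i \<noteq> j \<Longrightarrow> M $ i $ j = 0"
  shows "minor_sum l M = esym UNIV l (\<lambda>i. M $ i $ i)"
proof -
  have "det (minor_rows I M) = (\<Prod>i\<in>I. M $ i $ i)" for I
  proof -
    have "det (minor_rows I M) = (\<Prod>i\<in>UNIV. minor_rows I M $ i $ i)"
      by (rule det_diagonal) (auto simp: minor_rows_def axis_def diag)
    also have "\<dots> = (\<Prod>i\<in>I. M $ i $ i)"
      by (rule prod.mono_neutral_cong_right) (auto simp: minor_rows_def)
    finally show ?thesis .
  qed
  then show ?thesis by (simp add: minor_sum_def esym_def)
qed

section \<open>Directional derivatives and differentiability classes\<close>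

abbreviation dderiv :: "'a::real_normed_vector \<Rightarrow> ('a \<Rightarrow> real) \<Rightarrow> 'a \<Rightarrow> real" where
  "dderiv v f x \<equiv> frechet_derivative f (at x) v"

text \<open>The class \<open>C\<^sup>m\<close> on an open set, through the derivatives along all vectors instead of the basis
vectors only, because the frames below are adapted to a point.\<close>

primrec cdiff :: "nat \<Rightarrow> 'a::euclidean_space set \<Rightarrow> ('a \<Rightarrow> real) \<Rightarrow> bool" where
  "cdiff 0 U f = continuous_on U f"
| "cdiff (Suc m) U f = ((\<forall>x\<in>U. f differentiable (at x)) \<and> (\<forall>v. cdiff m U (dderiv v f)))"

lemma dderiv_cong:
  assumes "open U" "x \<in> U" "\<And>y. y \<in> U \<Longrightarrow> f y = g y"
  shows "dderiv v f x = dderiv v g x"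
proof -
  have "(f has_derivative D) (at x) \<longleftrightarrow> (g has_derivative D) (at x)" for D
    using has_derivative_transform_within_open[OF _ assms(1,2)] assms(3) by metis
  then show ?thesis unfolding frechet_derivative_def by simp
qed

lemma differentiable_cong_open:
  assumes "open U" "x \<in> U" "\<And>y. y \<in> U \<Longrightarrow> f y = g y" "f differentiable (at x)"
  shows "g differentiable (at x)"
  using assms has_derivative_transform_within_open[OF _ assms(1,2)] unfolding differentiable_def by metis

lemma cdiff_cong:
  assumes "open U" "\<And>y. y \<in> U \<Longrightarrow> f y = g y" "cdiff m U f"
  shows "cdiff m U g"
  using assms(2,3)
proof (induction m arbitrary: f g)
  case 0
  then show ?case using continuous_on_cong[of U U f g] by simp
next
  case (Suc m)
  have "g differentiable at x" if "x \<in> U" for x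
    by (rule differentiable_cong_open[OF assms(1) that Suc.prems(1)]) (use Suc.prems(2) that in auto)
  moreover have "cdiff m U (dderiv v g)" for v
    by (rule Suc.IH[of "dderiv v f"])
       (use Suc.prems in \<open>auto intro!: dderiv_cong[OF assms(1)]\<close>)
  ultimately show ?case by simp
qed

lemma cdiff_continuous: "cdiff m U f \<Longrightarrow> open U \<Longrightarrow> continuous_on U f"
  by (cases m) (auto intro!: continuous_at_imp_continuous_on differentiable_imp_continuous_within)

lemma cdiff_SucD: "cdiff (Suc m) U f \<Longrightarrow> open U \<Longrightarrow> cdiff m U f"
proof (induction m arbitrary: f)
  case 0
  then show ?case using cdiff_continuous[OF 0] by simp
qed simp

lemma cdiff_mono: "cdiff m U f \<Longrightarrow> l \<le> m \<Longrightarrow> open U \<Longrightarrow> cdiff l U f"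
proof (induction m)
  case (Suc m)
  show ?case
  proof (cases "l = Suc m")
    case False
    then show ?thesis using Suc.IH Suc.prems cdiff_SucD[OF Suc.prems(1,3)] by simp
  qed (use Suc.prems in simp)
qed simp

lemma dderiv_eqI: "(f has_derivative D) (at x) \<Longrightarrow> dderiv v f x = D v"
  by (metis frechet_derivative_at)

lemma has_derivative_dderiv: "f differentiable (at x) \<Longrightarrow> (f has_derivative (\<lambda>v. dderiv v f x)) (at x)"
  by (simp add: frechet_derivative_works)

lemma dderiv_const [simp]: "dderiv v (\<lambda>x. c) x = 0"
  by (rule dderiv_eqI[of _ "\<lambda>_. 0"]) simp

lemma dderiv_add:
  "f differentiable (at x) \<Longrightarrow> g differentiable (at x) \<Longrightarrow> dderiv v (\<lambda>x. f x + g x) x = dderiv v f x + dderiv v g x"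
  by (rule dderiv_eqI) (intro has_derivative_add has_derivative_dderiv)

lemma dderiv_mult:
  "f differentiable (at x) \<Longrightarrow> g differentiable (at x) \<Longrightarrow>
    dderiv v (\<lambda>x. f x * g x) x = f x * dderiv v g x + dderiv v f x * g x"
  by (rule dderiv_eqI) (intro has_derivative_mult has_derivative_dderiv)

lemma dderiv_sum:
  "(\<And>i. i \<in> I \<Longrightarrow> f i differentiable (at x)) \<Longrightarrow> dderiv v (\<lambda>x. \<Sum>i\<in>I. f i x) x = (\<Sum>i\<in>I. dderiv v (f i) x)"
  by (rule dderiv_eqI) (intro has_derivative_sum has_derivative_dderiv)

lemma dderiv_cmult: "f differentiable (at x) \<Longrightarrow> dderiv v (\<lambda>x. c * f x) x = c * dderiv v f x"
  using dderiv_mult[of "\<lambda>_. c" x f v] by simp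

lemma dderiv_diff:
  "f differentiable (at x) \<Longrightarrow> g differentiable (at x) \<Longrightarrow> dderiv v (\<lambda>x. f x - g x) x = dderiv v f x - dderiv v g x"
  by (rule dderiv_eqI) (intro has_derivative_diff has_derivative_dderiv)

lemma cdiff_const: "cdiff m U (\<lambda>x. c)"
  by (induction m arbitrary: c) simp_all

lemma cdiff_add:
  assumes "open U" "cdiff m U f" "cdiff m U g"
  shows "cdiff m U (\<lambda>x. f x + g x)"
  using assms(2,3)
proof (induction m arbitrary: f g)
  case (Suc m)
  have "cdiff m U (dderiv v (\<lambda>x. f x + g x))" for v
    by (rule cdiff_cong[OF assms(1) _ Suc.IH[of "dderiv v f" "dderiv v g"]])
       (use Suc.prems in \<open>auto simp: dderiv_add\<close>)
  then show ?case using Suc.prems by simp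
qed (auto intro: continuous_intros)

lemma cdiff_mult:
  assumes "open U" "cdiff m U f" "cdiff m U g"
  shows "cdiff m U (\<lambda>x. f x * g x)"
  using assms(2,3)
proof (induction m arbitrary: f g)
  case (Suc m)
  have "cdiff m U (dderiv v (\<lambda>x. f x * g x))" for v
    by (rule cdiff_cong[OF assms(1) _ cdiff_add[OF assms(1) Suc.IH[of f "dderiv v g"] Suc.IH[of "dderiv v f" g]]])
       (use Suc.prems cdiff_SucD[OF _ assms(1)] in \<open>auto simp: dderiv_mult\<close>)
  then show ?case using Suc.prems by simp
qed (auto intro: continuous_intros)

lemma cdiff_cmult: "open U \<Longrightarrow> cdiff m U f \<Longrightarrow> cdiff m U (\<lambda>x. c * f x)"
  using cdiff_mult[OF _ cdiff_const] .

lemma cdiff_diff: "open U \<Longrightarrow> cdiff m U f \<Longrightarrow> cdiff m U g \<Longrightarrow> cdiff m U (\<lambda>x. f x - g x)"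
  using cdiff_add[of U m f "\<lambda>x. - 1 * g x"] cdiff_cmult[of U m g "- 1"] by simp

lemma cdiff_sum:
  assumes "open U" "\<And>i. i \<in> I \<Longrightarrow> cdiff m U (f i)"
  shows "cdiff m U (\<lambda>x. \<Sum>i\<in>I. f i x)"
proof (cases "finite I")
  case True
  then show ?thesis using assms(2)
    by (induction I rule: finite_induct) (auto intro: cdiff_const cdiff_add[OF assms(1)])
qed (simp add: cdiff_const)

lemma dderiv_linear:
  "f differentiable (at x) \<Longrightarrow> linear (\<lambda>v. dderiv v f x)"
  using linear_frechet_derivative .

lemma dderiv_linear_sum:
  assumes "f differentiable (at x)" "v = (\<Sum>i\<in>I. c i *\<^sub>R e i)"
  shows "dderiv v f x = (\<Sum>i\<in>I. c i * dderiv (e i) f x)"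
proof -
  interpret linear "\<lambda>v. dderiv v f x" by (rule dderiv_linear[OF assms(1)])
  show ?thesis by (simp add: assms(2) sum scale)
qed

lemma iter_partial_append: "iter_partial (bs @ bs') f = iter_partial bs (iter_partial bs' f)"
  by (induction bs) simp_all

lemma cdiff_Basis:
  assumes "open U" "\<And>x. x \<in> U \<Longrightarrow> f differentiable (at x)" "\<And>b. b \<in> Basis \<Longrightarrow> cdiff m U (dderiv b f)"
  shows "cdiff (Suc m) U f"
proof -
  have "cdiff m U (dderiv v f)" for v
  proof (rule cdiff_cong[OF assms(1)])
    show "cdiff m U (\<lambda>x. \<Sum>b\<in>Basis. (v \<bullet> b) * dderiv b f x)"
      by (intro cdiff_sum cdiff_cmult assms)
    show "(\<Sum>b\<in>Basis. (v \<bullet> b) * dderiv b f y) = dderiv v f y" if "y \<in> U" for y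
      by (rule dderiv_linear_sum[symmetric, OF assms(2)[OF that]]) (simp add: euclidean_representation)
  qed
  then show ?thesis using assms(2) by simp
qed

lemma Ck_on_imp_cdiff:
  assumes "open U" "Ck_on m U f"
  shows "cdiff m U f"
  using assms(2)
proof (induction m arbitrary: f)
  case 0
  then have "length [] \<le> (0::nat) \<longrightarrow> continuous_on U (iter_partial [] f)"
    unfolding Ck_on_def by blast
  then show ?case by simp
next
  case (Suc m)
  have diff: "iter_partial bs f differentiable (at x)" if "bs \<in> lists Basis" "length bs < Suc m" "x \<in> U" for bs x
    using Suc.prems that unfolding Ck_on_def by blast
  have cont: "continuous_on U (iter_partial bs f)" if "bs \<in> lists Basis" "length bs \<le> Suc m" for bs
    using Suc.prems that unfolding Ck_on_def by blast
  have "cdiff m U (dderiv b f)" if "b \<in> Basis" for b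
  proof (rule Suc.IH)
    have eq: "iter_partial bs (dderiv b f) = iter_partial (bs @ [b]) f" for bs
      by (simp add: iter_partial_append)
    show "Ck_on m U (dderiv b f)"
      unfolding Ck_on_def eq
    proof (intro ballI conjI impI)
      fix bs :: "'a list" and x assume "bs \<in> lists Basis" "length bs < m" "x \<in> U"
      then show "iter_partial (bs @ [b]) f differentiable at x" using that by (intro diff) auto
    next
      fix bs :: "'a list" assume "bs \<in> lists Basis" "length bs \<le> m"
      then show "continuous_on U (iter_partial (bs @ [b]) f)" using that by (intro cont) auto
    qed
  qed
  then show ?case by (intro cdiff_Basis assms(1)) (use diff[of "[]"] in auto)
qed

lemma has_derivative_along_line:
  assumes "f differentiable (at (x + t *\<^sub>R v))"
  shows "((\<lambda>t. f (x + t *\<^sub>R v)) has_field_derivative dderiv v f (x + t *\<^sub>R v)) (at t)"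
proof -
  have "((\<lambda>t. x + t *\<^sub>R v) has_derivative (\<lambda>s. s *\<^sub>R v)) (at t)"
    by (auto intro!: derivative_eq_intros)
  from diff_chain_at[OF this has_derivative_dderiv[OF assms]]
  have "((\<lambda>t. f (x + t *\<^sub>R v)) has_derivative (\<lambda>s. dderiv (s *\<^sub>R v) f (x + t *\<^sub>R v))) (at t)"
    by (simp add: o_def)
  moreover have "dderiv (s *\<^sub>R v) f (x + t *\<^sub>R v) = dderiv v f (x + t *\<^sub>R v) * s" for s
    using linear_scale[OF dderiv_linear[OF assms]] by simp
  ultimately show ?thesis unfolding has_field_derivative_def by simp
qed

text \<open>Two applications of the mean value theorem to the second difference quotient.\<close>

lemma dderiv_commute_limit:
  assumes U: "open U" "x \<in> U" and f: "cdiff 2 U f"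
  shows "\<forall>e>0. \<exists>d>0. \<forall>h. 0 < h \<and> h < d \<longrightarrow>
     \<bar>(f (x + h *\<^sub>R u + h *\<^sub>R v) - f (x + h *\<^sub>R u) - f (x + h *\<^sub>R v) + f x) / h\<^sup>2 - dderiv v (dderiv u f) x\<bar> < e"
proof (intro allI impI)
  fix e :: real assume "e > 0"
  have f1: "\<And>y. y \<in> U \<Longrightarrow> f differentiable (at y)" "\<And>y. y \<in> U \<Longrightarrow> dderiv u f differentiable (at y)"
    "continuous_on U (dderiv v (dderiv u f))"
    using f by (auto simp: numeral_2_eq_2)
  obtain r where r: "r > 0" "ball x r \<subseteq> U" using U open_contains_ball by metis
  have "isCont (dderiv v (dderiv u f)) x"
    using f1(3) U by (simp add: continuous_on_eq_continuous_at)
  then obtain d where d: "d > 0" "\<And>y. dist y x < d \<Longrightarrow> \<bar>dderiv v (dderiv u f) y - dderiv v (dderiv u f) x\<bar> < e"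
    using \<open>e > 0\<close> unfolding continuous_at_eps_delta dist_real_def by metis
  define K where "K = norm u + norm v + 1"
  have K: "K > 0" unfolding K_def by (simp add: add_nonneg_pos)
  have inside: "x + a *\<^sub>R u + b *\<^sub>R v \<in> U" "dist (x + a *\<^sub>R u + b *\<^sub>R v) x < d"
    if "0 \<le> a" "a \<le> h" "0 \<le> b" "b \<le> h" "h < min r d / K" for a b h
  proof -
    have "dist (x + a *\<^sub>R u + b *\<^sub>R v) x = norm (a *\<^sub>R u + b *\<^sub>R v)" by (simp add: dist_norm)
    also have "\<dots> \<le> a * norm u + b * norm v"
      using norm_triangle_ineq[of "a *\<^sub>R u" "b *\<^sub>R v"] that by simp
    also have "\<dots> \<le> h * norm u + h * norm v" using that by (intro add_mono mult_right_mono) auto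
    also have "\<dots> = h * (norm u + norm v)" by (simp add: distrib_left)
    also have "\<dots> \<le> h * K" using that by (intro mult_left_mono) (auto simp: K_def)
    also have "\<dots> < min r d" using that(5) K by (simp add: pos_less_divide_eq)
    finally have "dist (x + a *\<^sub>R u + b *\<^sub>R v) x < min r d" .
    then show "x + a *\<^sub>R u + b *\<^sub>R v \<in> U" "dist (x + a *\<^sub>R u + b *\<^sub>R v) x < d"
      using that r(2) by (auto simp: dist_commute)
  qed
  show "\<exists>d>0. \<forall>h. 0 < h \<and> h < d \<longrightarrow>
     \<bar>(f (x + h *\<^sub>R u + h *\<^sub>R v) - f (x + h *\<^sub>R u) - f (x + h *\<^sub>R v) + f x) / h\<^sup>2 - dderiv v (dderiv u f) x\<bar> < e"
  proof (intro exI[of _ "min r d / K"] conjI allI impI)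
    show "min r d / K > 0" using r d K by simp
    fix h assume h: "0 < h \<and> h < min r d / K"
    define F where "F a = f (x + h *\<^sub>R v + a *\<^sub>R u) - f (x + a *\<^sub>R u)" for a
    have "(F has_field_derivative dderiv u f (x + h *\<^sub>R v + a *\<^sub>R u) - dderiv u f (x + a *\<^sub>R u)) (at a)"
      if "0 \<le> a" "a \<le> h" for a
      unfolding F_def
      by (intro DERIV_diff has_derivative_along_line f1)
         (use inside(1)[of a h h] inside(1)[of a h 0] that h in \<open>auto simp: algebra_simps\<close>)
    from MVT2[of 0 h F, OF _ this] h
    obtain a where a: "0 < a" "a < h"
      "F h - F 0 = h * (dderiv u f (x + h *\<^sub>R v + a *\<^sub>R u) - dderiv u f (x + a *\<^sub>R u))" by auto
    define G where "G b = dderiv u f (x + a *\<^sub>R u + b *\<^sub>R v)" for b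
    have "(G has_field_derivative dderiv v (dderiv u f) (x + a *\<^sub>R u + b *\<^sub>R v)) (at b)"
      if "0 \<le> b" "b \<le> h" for b
      unfolding G_def by (intro has_derivative_along_line f1) (use inside(1)[of a h b] that a h in auto)
    from MVT2[of 0 h G, OF _ this] h
    obtain b where b: "0 < b" "b < h" "G h - G 0 = h * dderiv v (dderiv u f) (x + a *\<^sub>R u + b *\<^sub>R v)" by auto
    have "f (x + h *\<^sub>R u + h *\<^sub>R v) - f (x + h *\<^sub>R u) - f (x + h *\<^sub>R v) + f x = F h - F 0"
      by (simp add: F_def algebra_simps)
    also have "\<dots> = h * (G h - G 0)" unfolding a(3) by (simp add: G_def algebra_simps)
    also have "\<dots> = h\<^sup>2 * dderiv v (dderiv u f) (x + a *\<^sub>R u + b *\<^sub>R v)"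
      unfolding b(3) by (simp add: power2_eq_square)
    finally have "(f (x + h *\<^sub>R u + h *\<^sub>R v) - f (x + h *\<^sub>R u) - f (x + h *\<^sub>R v) + f x) / h\<^sup>2
       = dderiv v (dderiv u f) (x + a *\<^sub>R u + b *\<^sub>R v)" using h by simp
    then show "\<bar>(f (x + h *\<^sub>R u + h *\<^sub>R v) - f (x + h *\<^sub>R u) - f (x + h *\<^sub>R v) + f x) / h\<^sup>2 - dderiv v (dderiv u f) x\<bar> < e"
      using d(2)[OF inside(2)[of a h b]] a b h by auto
  qed
qed

text \<open>The second difference quotient is symmetric in \<open>u\<close> and \<open>v\<close>.\<close>

lemma dderiv_commute:
  assumes U: "open U" "x \<in> U" and f: "cdiff 2 U f"
  shows "dderiv v (dderiv u f) x = dderiv u (dderiv v f) x"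
proof (rule ccontr)
  let ?A = "dderiv v (dderiv u f) x" and ?B = "dderiv u (dderiv v f) x"
  assume "?A \<noteq> ?B"
  then have e: "\<bar>?A - ?B\<bar> / 2 > 0" by simp
  let ?q = "\<lambda>h u v. (f (x + h *\<^sub>R u + h *\<^sub>R v) - f (x + h *\<^sub>R u) - f (x + h *\<^sub>R v) + f x) / h\<^sup>2"
  obtain d1 where d1: "d1 > 0" "\<And>h. 0 < h \<Longrightarrow> h < d1 \<Longrightarrow> \<bar>?q h u v - ?A\<bar> < \<bar>?A - ?B\<bar> / 2"
    using dderiv_commute_limit[OF U f, where u = u and v = v, rule_format, OF e] by auto
  obtain d2 where d2: "d2 > 0" "\<And>h. 0 < h \<Longrightarrow> h < d2 \<Longrightarrow> \<bar>?q h v u - ?B\<bar> < \<bar>?A - ?B\<bar> / 2"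
    using dderiv_commute_limit[OF U f, where u = v and v = u, rule_format, OF e] by auto
  define h where "h = min d1 d2 / 2"
  have h: "0 < h" "h < d1" "h < d2" using d1(1) d2(1) by (auto simp: h_def)
  have "?q h u v = ?q h v u" by (simp add: add.commute add.left_commute)
  moreover have "\<not> (\<bar>q - a\<bar> < \<bar>a - b\<bar> / 2 \<and> \<bar>q - b\<bar> < \<bar>a - b\<bar> / 2)" for q a b :: real
  proof -
    have "\<bar>a - b\<bar> \<le> \<bar>q - a\<bar> + \<bar>q - b\<bar>" by arith
    then show ?thesis by (intro notI, elim conjE) linarith
  qed
  ultimately show False using d1(2)[OF h(1,2)] d2(2)[OF h(1,3)] by metis
qed

lemma cdiff_line_derivs:
  assumes "open U" "x \<in> U" "cdiff 2 U f"
  shows "\<forall>\<^sub>F t in at 0. ((\<lambda>t. f (x + t *\<^sub>R v)) has_field_derivative dderiv v f (x + t *\<^sub>R v)) (at t)"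
    "((\<lambda>t. f (x + t *\<^sub>R v)) has_field_derivative dderiv v f x) (at 0)"
    "((\<lambda>t. dderiv v f (x + t *\<^sub>R v)) has_field_derivative dderiv v (dderiv v f) x) (at 0)"
proof -
  have d: "f differentiable at y" "dderiv v f differentiable at y" if "y \<in> U" for y
    using assms(3) that by (auto simp: numeral_2_eq_2)
  have "((\<lambda>t. x + t *\<^sub>R v) \<longlongrightarrow> x + 0 *\<^sub>R v) (at 0)" by (intro tendsto_intros)
  then have "\<forall>\<^sub>F t in at 0. x + t *\<^sub>R v \<in> U"
    using assms(1,2) by (auto dest: topological_tendstoD)
  then show "\<forall>\<^sub>F t in at 0. ((\<lambda>t. f (x + t *\<^sub>R v)) has_field_derivative dderiv v f (x + t *\<^sub>R v)) (at t)"
    by eventually_elim (intro has_derivative_along_line d)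
  show "((\<lambda>t. f (x + t *\<^sub>R v)) has_field_derivative dderiv v f x) (at 0)"
    using has_derivative_along_line[of f x 0 v] d assms(2) by simp
  show "((\<lambda>t. dderiv v f (x + t *\<^sub>R v)) has_field_derivative dderiv v (dderiv v f) x) (at 0)"
    using has_derivative_along_line[of "dderiv v f" x 0 v] d assms(2) by simp
qed

lemma eventually_line:
  fixes x :: "'a::real_normed_vector"
  assumes "open U" "x \<in> U"
  shows "\<forall>\<^sub>F t in nhds 0. x + t *\<^sub>R v \<in> U"
proof -
  have "((\<lambda>t. x + t *\<^sub>R v) \<longlongrightarrow> x + 0 *\<^sub>R v) (at 0)" by (intro tendsto_intros)
  then have "\<forall>\<^sub>F t in at 0. x + t *\<^sub>R v \<in> U"
    using assms(1,2) by (auto dest: topological_tendstoD)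
  then show ?thesis unfolding eventually_at_filter
    by (rule eventually_mono) (use assms in auto)
qed

lemma cdiff_local_max:
  assumes "open U" "x \<in> U" "cdiff 2 U f" "\<And>y. y \<in> U \<Longrightarrow> f y \<le> f x"
  shows "dderiv v f x = 0" "dderiv v (dderiv v f) x \<le> 0"
proof -
  note d = cdiff_line_derivs[OF assms(1-3), of v]
  have 1: "\<forall>\<^sub>F t in at 0. ((\<lambda>t. - f (x + t *\<^sub>R v)) has_field_derivative - dderiv v f (x + t *\<^sub>R v)) (at t)"
    using d(1) by (rule eventually_mono) (rule DERIV_minus)
  have 2: "((\<lambda>t. - f (x + t *\<^sub>R v)) has_field_derivative - dderiv v f (x + 0 *\<^sub>R v)) (at 0)"
    using DERIV_minus[OF d(2)] by simp
  have 3: "\<forall>\<^sub>F t in at 0. - f (x + 0 *\<^sub>R v) \<le> - f (x + t *\<^sub>R v)"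
    using eventually_line[OF assms(1,2), of v] unfolding eventually_at_filter
    by (rule eventually_mono) (use assms(4) in auto)
  note t = second_derivative_test_min[OF 1 2 DERIV_minus[OF d(3)] 3]
  show "dderiv v f x = 0" using t(1) by simp
  show "dderiv v (dderiv v f) x \<le> 0" using t(2) by simp
qed

section \<open>Codazzi and Simons identities in a constant frame\<close>

text \<open>The horizontal part of the downward normal near the point \<open>x\<close>, through its components \<open>N i\<close> in a
constant frame \<open>e\<close>. The matrix \<open>C\<close> contains the inner products of the dual frame, so
\<open>C i j - N i * N j\<close> is the inverse metric; \<open>B\<close> contains the inner products of \<open>e\<close> itself, and \<open>V\<close> is the
square of the last component of the unit normal. At \<open>x\<close> the frame is orthonormal for the induced
metric and diagonalizes the Jacobian of \<open>N\<close>, which is the shape operator.\<close>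

locale adapted_frame =
  fixes U :: "'a::euclidean_space set" and x :: 'a and N :: "'n::finite \<Rightarrow> 'a \<Rightarrow> real" and e :: "'n \<Rightarrow> 'a"
    and C B :: "'n \<Rightarrow> 'n \<Rightarrow> real" and lam n :: "'n \<Rightarrow> real" and V :: "'a \<Rightarrow> real"
  assumes U: "open U" "x \<in> U"
    and N_C3: "\<And>i. cdiff 3 U (N i)"
    and symmetric: "\<And>i j y. y \<in> U \<Longrightarrow>
      (\<Sum>l\<in>UNIV. dderiv (e l) (N i) y * (C l j - N l y * N j y)) = (\<Sum>l\<in>UNIV. dderiv (e l) (N j) y * (C l i - N l y * N i y))"
    and n: "\<And>i. N i x = n i"
    and orthonormal: "\<And>i j. C i j = (if i = j then 1 else 0) + n i * n j"
    and diagonal: "\<And>i j. dderiv (e j) (N i) x = (if i = j then lam i else 0)"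
    and V: "\<And>y. y \<in> U \<Longrightarrow> V y = 1 - (\<Sum>i\<in>UNIV. \<Sum>j\<in>UNIV. B i j * (N i y * N j y))"
    and B: "\<And>i j. B i j = (if i = j then 1 else 0) - V x * (n i * n j)"
    and V0: "V x * (1 + (\<Sum>i\<in>UNIV. (n i)\<^sup>2)) = 1"
begin

abbreviation "M i j \<equiv> dderiv (e j) (N i)"

definition b :: "'n \<Rightarrow> 'n \<Rightarrow> 'n \<Rightarrow> real" where "b i j l = dderiv (e l) (M i j) x"

definition d2 :: "'n \<Rightarrow> 'n \<Rightarrow> real" where "d2 i m = dderiv (e m) (dderiv (e m) (M i i)) x"

lemma C_at: "C i j - N i x * N j x = (if i = j then 1 else 0)"
  by (simp add: n orthonormal)

lemma N_diff: "y \<in> U \<Longrightarrow> N i differentiable at y"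
  using N_C3 by (simp add: numeral_3_eq_3)

lemma M_C2: "cdiff 2 U (M i j)"
  using N_C3 by (simp add: numeral_3_eq_3 numeral_2_eq_2)

lemma M_diff: "y \<in> U \<Longrightarrow> M i j differentiable at y"
  using M_C2 by (simp add: numeral_2_eq_2)

lemma dM_diff: "y \<in> U \<Longrightarrow> dderiv (e l) (M i j) differentiable at y"
  using M_C2 by (simp add: numeral_2_eq_2)

lemma dM_swap: "y \<in> U \<Longrightarrow> dderiv (e l) (M i j) y = dderiv (e j) (M i l) y"
  by (rule dderiv_commute[OF U(1) _ cdiff_mono[OF N_C3 _ U(1)]]) auto

lemma b_swap: "b i j l = b i l j"
  unfolding b_def by (rule dM_swap[OF U(2)])

definition dG :: "'n \<Rightarrow> 'n \<Rightarrow> 'n \<Rightarrow> 'a \<Rightarrow> real" where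
  "dG j a l y = - (N a y * M l j y + M a j y * N l y)"

lemma dderiv_G: "y \<in> U \<Longrightarrow> dderiv (e j) (\<lambda>y. C a l - N a y * N l y) y = dG j a l y"
  unfolding dG_def
  by (subst dderiv_diff) (auto simp: dderiv_mult N_diff intro!: differentiable_mult)

lemma G_diff: "y \<in> U \<Longrightarrow> (\<lambda>y. C a l - N a y * N l y) differentiable at y"
  by (auto intro!: derivative_intros N_diff differentiable_mult)

lemma dG_diff: "y \<in> U \<Longrightarrow> dG j a l differentiable at y"
  unfolding dG_def[abs_def] by (auto intro!: derivative_intros N_diff M_diff differentiable_mult differentiable_minus)

lemma dderiv_dG:
  "y \<in> U \<Longrightarrow> dderiv (e i) (dG j a l) y = - (N a y * dderiv (e i) (M l j) y + M a i y * M l j y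
      + M a j y * M l i y + dderiv (e i) (M a j) y * N l y)"
proof -
  assume y: "y \<in> U"
  have "dderiv (e i) (\<lambda>y. - 1 * (N a y * M l j y + M a j y * N l y)) y
     = - 1 * dderiv (e i) (\<lambda>y. N a y * M l j y + M a j y * N l y) y"
    by (rule dderiv_cmult) (auto intro!: differentiable_add differentiable_mult N_diff M_diff y)
  also have "dderiv (e i) (\<lambda>y. N a y * M l j y + M a j y * N l y) y
     = dderiv (e i) (\<lambda>y. N a y * M l j y) y + dderiv (e i) (\<lambda>y. M a j y * N l y) y"
    by (rule dderiv_add) (auto intro!: differentiable_mult N_diff M_diff y)
  also have "\<dots> = N a y * dderiv (e i) (M l j) y + M a i y * M l j y
      + (M a j y * M l i y + dderiv (e i) (M a j) y * N l y)"
    by (simp add: dderiv_mult N_diff M_diff y)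
  finally show ?thesis unfolding dG_def[abs_def] by simp
qed

lemma first_derivative_symmetry:
  assumes y: "y \<in> U"
  shows "(\<Sum>a\<in>UNIV. M i a y * dG j a l y + dderiv (e j) (M i a) y * (C a l - N a y * N l y))
    = (\<Sum>a\<in>UNIV. M l a y * dG j a i y + dderiv (e j) (M l a) y * (C a i - N a y * N i y))"
proof -
  have "dderiv (e j) (\<lambda>y. \<Sum>a\<in>UNIV. M i a y * (C a l - N a y * N l y)) y
     = (\<Sum>a\<in>UNIV. M i a y * dG j a l y + dderiv (e j) (M i a) y * (C a l - N a y * N l y))" for i l
    by (subst dderiv_sum) (auto intro!: differentiable_mult M_diff G_diff y simp: dderiv_mult M_diff G_diff y dderiv_G)
  moreover have "dderiv (e j) (\<lambda>y. \<Sum>a\<in>UNIV. M i a y * (C a l - N a y * N l y)) y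
     = dderiv (e j) (\<lambda>y. \<Sum>a\<in>UNIV. M l a y * (C a i - N a y * N i y)) y"
    by (rule dderiv_cong[OF U(1) y symmetric])
  ultimately show ?thesis by simp
qed

lemma dG_at: "dG j a l x = - (n a * (if l = j then lam l else 0) + (if a = j then lam a else 0) * n l)"
  by (simp add: dG_def n diagonal)

text \<open>The Codazzi equation. The right-hand side appears because the frame is constant and not parallel: it
is the commutator of the shape operator with the Christoffel symbols at \<open>x\<close>.\<close>

lemma b_codazzi:
  "b i j l - b l j i = (lam i - lam l) * lam j * ((if i = j then n l else 0) + (if l = j then n i else 0))"
proof -
  have "(\<Sum>a\<in>UNIV. M i a x * dG j a l x + dderiv (e j) (M i a) x * (C a l - N a x * N l x))
     = lam i * dG j i l x + b i l j" for i l
    unfolding sum.distrib C_at diagonal b_def by (simp add: if_distrib if_distribR sum.delta cong: if_cong)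
  then have "lam i * dG j i l x + b i l j = lam l * dG j l i x + b l i j"
    using first_derivative_symmetry[OF U(2), of i j l] by simp
  then show ?thesis unfolding b_swap[of i j l] b_swap[of l j i]
    by (auto simp: dG_at algebra_simps)
qed

lemma second_derivative_expand:
  "dderiv (e p) (\<lambda>y. \<Sum>a\<in>UNIV. M i a y * dG j a l y + dderiv (e j) (M i a) y * (C a l - N a y * N l y)) x
    = lam i * dderiv (e p) (dG j i l) x + (\<Sum>a\<in>UNIV. b i a p * dG j a l x)
      + (\<Sum>a\<in>UNIV. b i a j * dG p a l x) + dderiv (e p) (dderiv (e j) (M i l)) x"
proof -
  have "dderiv (e p) (\<lambda>y. \<Sum>a\<in>UNIV. M i a y * dG j a l y + dderiv (e j) (M i a) y * (C a l - N a y * N l y)) x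
    = (\<Sum>a\<in>UNIV. (M i a x * dderiv (e p) (dG j a l) x + b i a p * dG j a l x)
        + (b i a j * dG p a l x + dderiv (e p) (dderiv (e j) (M i a)) x * (C a l - N a x * N l x)))"
    unfolding b_def
    by (subst dderiv_sum)
       (auto intro!: differentiable_add differentiable_mult M_diff dM_diff dG_diff G_diff U(2)
          simp: dderiv_add dderiv_mult differentiable_mult M_diff dM_diff dG_diff G_diff U(2) dderiv_G)
  then show ?thesis
    unfolding sum.distrib C_at diagonal by (simp add: if_distrib if_distribR sum.delta cong: if_cong)
qed

lemma third_derivative_1: "dderiv (e i) (dderiv (e m) (M i m)) x = d2 i m"
proof -
  have "dderiv (e i) (dderiv (e m) (M i m)) x = dderiv (e m) (dderiv (e i) (M i m)) x"
    by (rule dderiv_commute[OF U M_C2])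
  also have "\<dots> = d2 i m" unfolding d2_def by (rule dderiv_cong[OF U]) (rule dM_swap)
  finally show ?thesis .
qed

lemma third_derivative_2: "dderiv (e i) (dderiv (e m) (M m i)) x = d2 m i"
  unfolding d2_def by (rule dderiv_cong[OF U]) (rule dM_swap)

text \<open>Simons' identity, in the only instances that are needed: the entry \<open>(i, m)\<close> of the symmetric matrix,
differentiated along \<open>e i\<close> and \<open>e m\<close>. Since the shape operator is a Jacobian, the second derivatives
of its entries \<open>(i, m)\<close> and \<open>(m, i)\<close> that arise are second derivatives of its two diagonal entries.\<close>

lemma simons:
  "d2 i m - d2 m i = lam m * (\<Sum>a\<in>UNIV. n a * b i i a) - lam i * (\<Sum>a\<in>UNIV. n a * b m m a)
     + 2 * lam i * b i i m * n m - 2 * lam m * b m m i * n i + lam i * lam m * (lam i - lam m)"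
proof (cases "i = m")
  case False
  have eq: "dderiv (e i) (\<lambda>y. \<Sum>a\<in>UNIV. M i a y * dG m a m y + dderiv (e m) (M i a) y * (C a m - N a y * N m y)) x
    = dderiv (e i) (\<lambda>y. \<Sum>a\<in>UNIV. M m a y * dG m a i y + dderiv (e m) (M m a) y * (C a i - N a y * N i y)) x"
    by (rule dderiv_cong[OF U first_derivative_symmetry])
  have s1: "(\<Sum>a\<in>UNIV. b i a i * dG m a m x) = - lam m * (\<Sum>a\<in>UNIV. n a * b i i a) - lam m * b i i m * n m"
  proof -
    have "(\<Sum>a\<in>UNIV. b i a i * dG m a m x)
      = (\<Sum>a\<in>UNIV. - lam m * (n a * b i i a) - (if a = m then lam m * b i i m * n m else 0))"
      by (intro sum.cong refl) (auto simp: dG_at b_swap[of i _ i] algebra_simps)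
    then show ?thesis by (simp add: sum_subtractf sum_distrib_left sum_negf)
  qed
  have s2: "(\<Sum>a\<in>UNIV. b i a m * dG i a m x) = - lam i * b i i m * n m"
  proof -
    have "(\<Sum>a\<in>UNIV. b i a m * dG i a m x) = (\<Sum>a\<in>UNIV. (if a = i then - lam i * b i i m * n m else 0))"
      using False by (intro sum.cong refl) (auto simp: dG_at)
    then show ?thesis by simp
  qed
  have s3: "(\<Sum>a\<in>UNIV. b m a i * dG m a i x) = - lam m * b m m i * n i"
  proof -
    have "(\<Sum>a\<in>UNIV. b m a i * dG m a i x) = (\<Sum>a\<in>UNIV. (if a = m then - lam m * b m m i * n i else 0))"
      using False by (intro sum.cong refl) (auto simp: dG_at)
    then show ?thesis by simp
  qed
  have s4: "(\<Sum>a\<in>UNIV. b m a m * dG i a i x) = - lam i * (\<Sum>a\<in>UNIV. n a * b m m a) - lam i * b m m i * n i"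
  proof -
    have "(\<Sum>a\<in>UNIV. b m a m * dG i a i x)
      = (\<Sum>a\<in>UNIV. - lam i * (n a * b m m a) - (if a = i then lam i * b m m i * n i else 0))"
      by (intro sum.cong refl) (auto simp: dG_at b_swap[of m _ m] algebra_simps)
    then show ?thesis by (simp add: sum_subtractf sum_distrib_left sum_negf)
  qed
  have t1: "dderiv (e i) (dG m i m) x = - (n i * b m m i + lam i * lam m + b i i m * n m)"
    using dderiv_dG[OF U(2), where i = i and j = m and a = i and l = m] False b_swap[of i m i] by (simp add: n diagonal b_def)
  have t2: "dderiv (e i) (dG m m i) x = - (n m * b i i m + lam m * lam i + b m m i * n i)"
    using dderiv_dG[OF U(2), where i = i and j = m and a = m and l = i] False b_swap[of i m i] by (simp add: n diagonal b_def)
  show ?thesis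
    using eq unfolding second_derivative_expand s1 s2 s3 s4 t1 t2 third_derivative_1 third_derivative_2
    by (simp add: algebra_simps)
qed simp

lemma B_n: "(\<Sum>i\<in>UNIV. B i j * n i) = V x * n j"
proof -
  have "(\<Sum>i\<in>UNIV. B i j * n i) = (\<Sum>i\<in>UNIV. (if i = j then n i else 0) - V x * n j * (n i)\<^sup>2)"
    by (intro sum.cong) (auto simp: B power2_eq_square algebra_simps)
  also have "\<dots> = n j * (1 - V x * (\<Sum>i\<in>UNIV. (n i)\<^sup>2))"
    by (simp add: sum_subtractf algebra_simps flip: sum_distrib_left)
  also have "1 - V x * (\<Sum>i\<in>UNIV. (n i)\<^sup>2) = V x" using V0 by (simp add: distrib_left)
  finally show ?thesis by (simp add: mult.commute)
qed

lemma B_sym: "B i j = B j i"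
  by (simp add: B mult.commute)

lemma V_C2: "cdiff 2 U V"
proof (rule cdiff_cong[OF U(1)])
  show "cdiff 2 U (\<lambda>y. 1 - (\<Sum>i\<in>UNIV. \<Sum>j\<in>UNIV. B i j * (N i y * N j y)))"
    by (intro cdiff_diff cdiff_const cdiff_sum cdiff_cmult cdiff_mult U cdiff_mono[OF N_C3]) auto
qed (simp add: V)

lemma dV: "y \<in> U \<Longrightarrow> dderiv (e m) V y = - 2 * (\<Sum>i\<in>UNIV. \<Sum>j\<in>UNIV. B i j * (N i y * M j m y))"
proof -
  assume y: "y \<in> U"
  have "dderiv (e m) V y = dderiv (e m) (\<lambda>y. 1 - (\<Sum>i\<in>UNIV. \<Sum>j\<in>UNIV. B i j * (N i y * N j y))) y"
    by (rule dderiv_cong[OF U(1) y V])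
  also have "\<dots> = - (\<Sum>i\<in>UNIV. \<Sum>j\<in>UNIV. B i j * (N i y * M j m y + M i m y * N j y))"
    by (subst dderiv_diff)
       (auto intro!: differentiable_sum differentiable_mult N_diff y
         simp: dderiv_sum dderiv_cmult dderiv_mult N_diff y differentiable_sum differentiable_mult)
  also have "\<dots> = - ((\<Sum>i\<in>UNIV. \<Sum>j\<in>UNIV. B i j * (N i y * M j m y)) + (\<Sum>i\<in>UNIV. \<Sum>j\<in>UNIV. B i j * (M i m y * N j y)))"
    by (simp add: distrib_left sum.distrib)
  also have "(\<Sum>i\<in>UNIV. \<Sum>j\<in>UNIV. B i j * (M i m y * N j y)) = (\<Sum>i\<in>UNIV. \<Sum>j\<in>UNIV. B i j * (N i y * M j m y))"
    by (subst sum.swap) (intro sum.cong refl; simp add: B_sym mult.commute)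
  finally show ?thesis by simp
qed

text \<open>This is \<open>\<partial>\<^sub>m log v = - n\<^sub>m \<lambda>\<^sub>m\<close>.\<close>

lemma dV_at: "dderiv (e m) V x = - 2 * V x * (n m * lam m)"
proof -
  have "(\<Sum>i\<in>UNIV. \<Sum>j\<in>UNIV. B i j * (N i x * M j m x)) = (\<Sum>i\<in>UNIV. B i m * n i * lam m)"
    by (intro sum.cong refl) (simp add: n diagonal if_distrib if_distribR sum.delta cong: if_cong)
  then show ?thesis by (simp add: dV U flip: sum_distrib_right) (simp add: B_n)
qed

text \<open>The equation satisfied by the last component of the normal. The Codazzi equation replaces the
derivatives \<open>b j m m\<close> by derivatives of the diagonal entry \<open>m\<close>.\<close>

lemma ddV_at: "dderiv (e m) (dderiv (e m) V) x
   = 2 * V x * (- (lam m)\<^sup>2 + (n m)\<^sup>2 * (lam m)\<^sup>2 - (\<Sum>a\<in>UNIV. n a * b m m a) - lam m * (\<Sum>a\<in>UNIV. (n a)\<^sup>2 * lam a))"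
proof -
  have "dderiv (e m) (dderiv (e m) V) x
    = dderiv (e m) (\<lambda>y. - 2 * (\<Sum>i\<in>UNIV. \<Sum>j\<in>UNIV. B i j * (N i y * M j m y))) x"
    by (rule dderiv_cong[OF U dV])
  also have "\<dots> = - 2 * dderiv (e m) (\<lambda>y. \<Sum>i\<in>UNIV. \<Sum>j\<in>UNIV. B i j * (N i y * M j m y)) x"
    by (rule dderiv_cmult) (auto intro!: differentiable_sum differentiable_mult N_diff M_diff U(2))
  also have "dderiv (e m) (\<lambda>y. \<Sum>i\<in>UNIV. \<Sum>j\<in>UNIV. B i j * (N i y * M j m y)) x
    = (\<Sum>i\<in>UNIV. \<Sum>j\<in>UNIV. B i j * (n i * b j m m + M i m x * M j m x))"
    by (simp add: dderiv_sum dderiv_cmult dderiv_mult N_diff M_diff U differentiable_sum differentiable_mult n b_def)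
  also have "\<dots> = (\<Sum>i\<in>UNIV. \<Sum>j\<in>UNIV. B i j * (n i * b j m m)) + (\<Sum>i\<in>UNIV. \<Sum>j\<in>UNIV. B i j * (M i m x * M j m x))"
    by (simp add: distrib_left sum.distrib)
  also have "(\<Sum>i\<in>UNIV. \<Sum>j\<in>UNIV. B i j * (n i * b j m m)) = V x * (\<Sum>j\<in>UNIV. n j * b j m m)"
  proof -
    have "(\<Sum>i\<in>UNIV. \<Sum>j\<in>UNIV. B i j * (n i * b j m m)) = (\<Sum>j\<in>UNIV. (\<Sum>i\<in>UNIV. B i j * n i) * b j m m)"
      by (subst sum.swap) (simp only: sum_distrib_right mult.assoc)
    then show ?thesis by (simp only: B_n sum_distrib_left mult.assoc)
  qed
  also have "(\<Sum>i\<in>UNIV. \<Sum>j\<in>UNIV. B i j * (M i m x * M j m x)) = (1 - V x * (n m)\<^sup>2) * (lam m)\<^sup>2"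
  proof -
    have "(\<Sum>j\<in>UNIV. B i j * (M i m x * M j m x)) = (if i = m then B m m * (lam m)\<^sup>2 else 0)" for i
    proof -
      have "(\<Sum>j\<in>UNIV. B i j * (M i m x * M j m x)) = (\<Sum>j\<in>UNIV. if j = m then (if i = m then B m m * (lam m)\<^sup>2 else 0) else 0)"
        by (intro sum.cong) (auto simp: diagonal power2_eq_square)
      then show ?thesis by simp
    qed
    then show ?thesis by (simp add: B power2_eq_square)
  qed
  also have "(\<Sum>j\<in>UNIV. n j * b j m m)
     = (\<Sum>a\<in>UNIV. n a * b m m a) + lam m * (\<Sum>a\<in>UNIV. (n a)\<^sup>2 * lam a) - (lam m)\<^sup>2 * (\<Sum>a\<in>UNIV. (n a)\<^sup>2)"
  proof -
    have eq: "b j m m = b m m j + (lam j - lam m) * lam m * n j" for j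
      using b_codazzi[of j m m] by (cases "j = m") auto
    have "(\<Sum>j\<in>UNIV. n j * b j m m)
      = (\<Sum>j\<in>UNIV. n j * b m m j + lam m * ((n j)\<^sup>2 * lam j) - (lam m)\<^sup>2 * (n j)\<^sup>2)"
    proof (rule sum.cong[OF refl])
      show "n j * b j m m = n j * b m m j + lam m * ((n j)\<^sup>2 * lam j) - (lam m)\<^sup>2 * (n j)\<^sup>2" for j
        by (subst eq) (simp add: power2_eq_square algebra_simps)
    qed
    then show ?thesis by (simp add: sum.distrib sum_subtractf sum_distrib_left)
  qed
  finally have "dderiv (e m) (dderiv (e m) V) x = - 2 * (V x * ((\<Sum>a\<in>UNIV. n a * b m m a) + lam m * (\<Sum>a\<in>UNIV. (n a)\<^sup>2 * lam a)
      - (lam m)\<^sup>2 * (\<Sum>a\<in>UNIV. (n a)\<^sup>2)) + (1 - V x * (n m)\<^sup>2) * (lam m)\<^sup>2)" .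
  moreover have "(lam m)\<^sup>2 = (lam m)\<^sup>2 * (V x * (1 + (\<Sum>a\<in>UNIV. (n a)\<^sup>2)))" using V0 by simp
  ultimately show ?thesis by (simp add: algebra_simps)
qed

end

section \<open>The algebra at a maximum point\<close>

text \<open>The second derivative of \<open>log \<sigma>\<^sub>k\<close> in off-diagonal directions, which for a parallel frame would be a sum
of squares. By the Codazzi equation the terms with three distinct indices are squares also in a
constant frame, and those with two equal indices miss a square by a term linear in \<open>b\<close>. The relation
between \<open>P\<close> and \<open>T\<close> turns the linear terms into the form in which they appear in Simons' identity.\<close>

lemma off_diagonal_third_order_terms:
  fixes b :: "'n::finite \<Rightarrow> 'n \<Rightarrow> 'n \<Rightarrow> real" and lam n T :: "'n \<Rightarrow> real" and P :: "'n \<Rightarrow> 'n \<Rightarrow> real"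
  assumes swap: "\<And>i j l. b i j l = b i l j"
    and codazzi: "\<And>i j l. b i j l - b l j i
      = (lam i - lam l) * lam j * ((if i = j then n l else 0) + (if l = j then n i else 0))"
    and P: "\<And>i j. i \<noteq> j \<Longrightarrow> P i j \<ge> 0" "\<And>i j. i \<noteq> j \<Longrightarrow> P i j * (lam i - lam j) = T j - T i"
  shows "2 * (\<Sum>i\<in>UNIV. \<Sum>j\<in>UNIV. (T j - T i) * lam j * n i * b j j i)
    \<le> (\<Sum>p\<in>UNIV. \<Sum>i\<in>UNIV. \<Sum>j\<in>UNIV - {i}. P i j * (b i j p * b j i p))"
proof -
  define Y where "Y i j = (lam i - lam j) * lam j * n i * b j j i" for i j
  have pw: "(if p = j then Y i j else 0) + (if p = i then Y j i else 0) \<le> b i j p * b j i p"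
    if ij: "i \<noteq> j" for i j p
  proof -
    have *: "Y i j \<le> b i j j * b j i j" if "i \<noteq> j" for i j
    proof -
      have e1: "b i j j = b j j i + (lam i - lam j) * lam j * n i" using codazzi[of i j j] that by simp
      have e2: "b j i j = b j j i" by (rule swap)
      have "b i j j * b j i j = (b j j i)\<^sup>2 + Y i j"
        unfolding e1 e2 by (simp add: Y_def power2_eq_square algebra_simps)
      then show ?thesis by simp
    qed
    consider "p = j" | "p = i" | "p \<noteq> i" "p \<noteq> j" by blast
    then show ?thesis
    proof cases
      case 1
      then show ?thesis using *[OF ij] ij by simp
    next
      case 2
      then show ?thesis using *[of j i] ij by (simp add: mult.commute)
    next
      case 3
      then have "b i p j = b j p i" using codazzi[of i p j] by auto
      then have "b i j p = b j i p" using swap by metis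
      then show ?thesis using 3 by simp
    qed
  qed
  have "2 * (\<Sum>i\<in>UNIV. \<Sum>j\<in>UNIV. (T j - T i) * lam j * n i * b j j i)
    = (\<Sum>i\<in>UNIV. \<Sum>j\<in>UNIV. (T j - T i) * lam j * n i * b j j i) + (\<Sum>i\<in>UNIV. \<Sum>j\<in>UNIV. (T i - T j) * lam i * n j * b i i j)"
    by (subst (2) sum.swap) simp
  also have "\<dots> = (\<Sum>i\<in>UNIV. \<Sum>j\<in>UNIV. (T j - T i) * lam j * n i * b j j i + (T i - T j) * lam i * n j * b i i j)"
    by (simp add: sum.distrib)
  also have "\<dots> = (\<Sum>i\<in>UNIV. \<Sum>j\<in>UNIV - {i}. (T j - T i) * lam j * n i * b j j i + (T i - T j) * lam i * n j * b i i j)"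
    by (intro sum.cong refl sum.mono_neutral_right) auto
  also have "\<dots> = (\<Sum>i\<in>UNIV. \<Sum>j\<in>UNIV - {i}. P i j * (Y i j + Y j i))"
  proof (intro sum.cong refl)
    fix i j :: 'n assume "j \<in> UNIV - {i}"
    then have "T j - T i = P i j * (lam i - lam j)" "T i - T j = P i j * (lam j - lam i)"
      using P(2)[of i j] by (auto simp: algebra_simps)
    then show "(T j - T i) * lam j * n i * b j j i + (T i - T j) * lam i * n j * b i i j = P i j * (Y i j + Y j i)"
      by (simp add: Y_def distrib_left mult.assoc)
  qed
  also have "\<dots> = (\<Sum>i\<in>UNIV. \<Sum>j\<in>UNIV - {i}. \<Sum>p\<in>UNIV. P i j * ((if p = j then Y i j else 0) + (if p = i then Y j i else 0)))"
    by (simp add: sum.distrib flip: sum_distrib_left)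
  also have "\<dots> \<le> (\<Sum>i\<in>UNIV. \<Sum>j\<in>UNIV - {i}. \<Sum>p\<in>UNIV. P i j * (b i j p * b j i p))"
    by (intro sum_mono mult_left_mono pw P) auto
  also have "\<dots> = (\<Sum>i\<in>UNIV. \<Sum>p\<in>UNIV. \<Sum>j\<in>UNIV - {i}. P i j * (b i j p * b j i p))"
    by (intro sum.cong refl sum.swap)
  also have "\<dots> = (\<Sum>p\<in>UNIV. \<Sum>i\<in>UNIV. \<Sum>j\<in>UNIV - {i}. P i j * (b i j p * b j i p))"
    by (rule sum.swap)
  finally show ?thesis .
qed

text \<open>Here \<open>T\<close> and \<open>P\<close> are the first and the off-diagonal second derivatives of \<open>\<sigma>\<^sub>k\<close> at \<open>lam\<close>, divided by
\<open>\<sigma>\<^sub>k\<close>; \<open>L p\<close> is the second derivative of \<open>log H\<close> along \<open>e p\<close>, \<open>b\<close> and \<open>d2\<close> are derivatives of the shape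
operator, and \<open>s\<close> is the mean curvature. The second-order conditions weighted by \<open>T\<close> bound
\<open>\<Sum> T m * d2 i m\<close> from above, the differentiated equation bounds \<open>\<Sum> T m * d2 m i\<close> from below, and Simons'
identity computes the difference. The terms containing \<open>\<Sum> T m * (lam m)\<^sup>2\<close>, \<open>\<beta>\<close>, \<open>\<kappa>\<close> and
the linear third-order terms \<open>X\<close> cancel.\<close>

lemma curvature_inequality_at_maximum:
  fixes b :: "'n::finite \<Rightarrow> 'n \<Rightarrow> 'n \<Rightarrow> real" and lam n T L :: "'n \<Rightarrow> real" and P d2 :: "'n \<Rightarrow> 'n \<Rightarrow> real"
    and kk q s :: real
  defines "\<beta> \<equiv> \<lambda>m. \<Sum>a\<in>UNIV. n a * b m m a" and "\<kappa> \<equiv> \<Sum>a\<in>UNIV. (n a)\<^sup>2 * lam a"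
  assumes swap: "\<And>i j l. b i j l = b i l j"
    and codazzi: "\<And>i j l. b i j l - b l j i
      = (lam i - lam l) * lam j * ((if i = j then n l else 0) + (if l = j then n i else 0))"
    and simons: "\<And>i m. d2 i m - d2 m i = lam m * \<beta> i - lam i * \<beta> m
      + 2 * lam i * b i i m * n m - 2 * lam m * b m m i * n i + lam i * lam m * (lam i - lam m)"
    and first: "\<And>m. (\<Sum>i\<in>UNIV. b i i m) = - s * (n m * lam m)"
    and second: "\<And>m. (\<Sum>i\<in>UNIV. d2 i m) \<le> - s * ((lam m)\<^sup>2 + \<beta> m + lam m * \<kappa>)"
    and equation: "\<And>p. (\<Sum>i\<in>UNIV. T i * d2 i p)
        + (\<Sum>i\<in>UNIV. \<Sum>j\<in>UNIV - {i}. P i j * (b i i p * b j j p - b i j p * b j i p))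
        - (\<Sum>i\<in>UNIV. T i * b i i p)\<^sup>2
      = L p - q * ((lam p)\<^sup>2 + (n p)\<^sup>2 * (lam p)\<^sup>2 + \<beta> p + lam p * \<kappa>)"
    and T: "\<And>i. T i \<ge> 0" "(\<Sum>i\<in>UNIV. T i * lam i) = kk"
    and P: "\<And>i j. i \<noteq> j \<Longrightarrow> P i j \<ge> 0" "\<And>i j. i \<noteq> j \<Longrightarrow> P i j * (lam i - lam j) = T j - T i"
    and concave: "\<And>\<xi>. ((\<Sum>i\<in>UNIV. \<xi> i) / s)\<^sup>2
      \<le> (\<Sum>i\<in>UNIV. T i * \<xi> i)\<^sup>2 - (\<Sum>i\<in>UNIV. \<Sum>j\<in>UNIV - {i}. P i j * (\<xi> i * \<xi> j))"
    and s: "s = (\<Sum>i\<in>UNIV. lam i)" "s > 0"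
  shows "(\<Sum>p\<in>UNIV. L p) + (kk - q) * (\<Sum>i\<in>UNIV. (lam i)\<^sup>2) + (1 - q) * (\<Sum>i\<in>UNIV. (n i)\<^sup>2 * (lam i)\<^sup>2) \<le> 0"
proof -
  define X where "X = (\<Sum>i\<in>UNIV. \<Sum>j\<in>UNIV. (T j - T i) * lam j * n i * b j j i)"
  define Q where "Q = (\<Sum>p\<in>UNIV. \<Sum>i\<in>UNIV. \<Sum>j\<in>UNIV - {i}. P i j * (b i j p * b j i p))"
  define SB where "SB = (\<Sum>m\<in>UNIV. \<beta> m)"
  define STB where "STB = (\<Sum>m\<in>UNIV. T m * \<beta> m)"
  define SL where "SL = (\<Sum>m\<in>UNIV. (lam m)\<^sup>2)"
  define STL where "STL = (\<Sum>m\<in>UNIV. T m * (lam m)\<^sup>2)"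
  define SN where "SN = (\<Sum>m\<in>UNIV. (n m)\<^sup>2 * (lam m)\<^sup>2)"
  have XQ: "2 * X \<le> Q"
    unfolding X_def Q_def by (rule off_diagonal_third_order_terms[OF swap codazzi P])
  have SB: "SB = - s * \<kappa>"
  proof -
    have "SB = (\<Sum>a\<in>UNIV. n a * (\<Sum>m\<in>UNIV. b m m a))"
      unfolding SB_def \<beta>_def by (subst sum.swap) (simp only: sum_distrib_left)
    also have "\<dots> = (\<Sum>a\<in>UNIV. - s * ((n a)\<^sup>2 * lam a))"
      unfolding first by (intro sum.cong refl) (simp add: power2_eq_square)
    finally show ?thesis unfolding \<kappa>_def by (simp only: sum_distrib_left)
  qed
  have A: "(\<Sum>m\<in>UNIV. T m * (\<Sum>i\<in>UNIV. d2 i m)) \<le> - s * (STL + STB + kk * \<kappa>)"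
  proof -
    have "(\<Sum>m\<in>UNIV. T m * (\<Sum>i\<in>UNIV. d2 i m)) \<le> (\<Sum>m\<in>UNIV. T m * (- s * ((lam m)\<^sup>2 + \<beta> m + lam m * \<kappa>)))"
      by (intro sum_mono mult_left_mono second T)
    also have "\<dots> = (\<Sum>m\<in>UNIV. - s * (T m * (lam m)\<^sup>2) + (- s * (T m * \<beta> m) + - s * \<kappa> * (T m * lam m)))"
      by (intro sum.cong refl) (simp add: algebra_simps)
    also have "\<dots> = - s * STL + (- s * STB + - s * \<kappa> * kk)"
      unfolding STL_def STB_def T(2)[symmetric] by (simp only: sum.distrib sum_distrib_left)
    finally show ?thesis by (simp add: algebra_simps)
  qed
  have Bid: "(\<Sum>m\<in>UNIV. T m * (\<Sum>i\<in>UNIV. d2 i m)) - (\<Sum>p\<in>UNIV. \<Sum>i\<in>UNIV. T i * d2 i p)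
      = kk * SB - s * STB - 2 * X + kk * SL - s * STL"
  proof -
    have "(\<Sum>p\<in>UNIV. \<Sum>i\<in>UNIV. T i * d2 i p) = (\<Sum>m\<in>UNIV. \<Sum>i\<in>UNIV. T m * d2 m i)" by (rule sum.swap)
    then have "(\<Sum>m\<in>UNIV. T m * (\<Sum>i\<in>UNIV. d2 i m)) - (\<Sum>p\<in>UNIV. \<Sum>i\<in>UNIV. T i * d2 i p)
      = (\<Sum>m\<in>UNIV. \<Sum>i\<in>UNIV. T m * (d2 i m - d2 m i))"
      by (simp add: sum_distrib_left right_diff_distrib sum_subtractf)
    also have "\<dots> = (\<Sum>m\<in>UNIV. \<Sum>i\<in>UNIV. ((T m * lam m) * \<beta> i + (T m * lam m) * (lam i)\<^sup>2)
        - (lam i * (T m * \<beta> m) + lam i * (T m * (lam m)\<^sup>2))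
        - 2 * (T m * lam m * n i * b m m i - T m * lam i * n m * b i i m))"
      unfolding simons by (intro sum.cong refl) (simp add: power2_eq_square algebra_simps)
    also have "\<dots> = (kk * SB + kk * SL) - (s * STB + s * STL)
       - 2 * ((\<Sum>m\<in>UNIV. \<Sum>i\<in>UNIV. T m * lam m * n i * b m m i) - (\<Sum>m\<in>UNIV. \<Sum>i\<in>UNIV. T m * lam i * n m * b i i m))"
    proof -
      have 1: "(\<Sum>m\<in>UNIV. \<Sum>i\<in>UNIV. (T m * lam m) * f i) = kk * (\<Sum>i\<in>UNIV. f i)" for f
        unfolding T(2)[symmetric] sum_product ..
      have 2: "(\<Sum>m\<in>UNIV. \<Sum>i\<in>UNIV. lam i * (T m * f m)) = s * (\<Sum>m\<in>UNIV. T m * f m)" for f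
        unfolding s(1) sum_product by (rule sum.swap)
      show ?thesis
        unfolding sum_subtractf sum.distrib 1 2 SB_def SL_def STB_def STL_def
        by (simp only: sum_subtractf sum_distrib_left[symmetric])
    qed
    also have "(\<Sum>m\<in>UNIV. \<Sum>i\<in>UNIV. T m * lam m * n i * b m m i) - (\<Sum>m\<in>UNIV. \<Sum>i\<in>UNIV. T m * lam i * n m * b i i m) = X"
      unfolding X_def left_diff_distrib sum_subtractf by (subst sum.swap) simp
    finally show ?thesis by simp
  qed
  have C: "(\<Sum>p\<in>UNIV. L p) - q * (SL + SN + SB + s * \<kappa>) + SN + Q \<le> (\<Sum>p\<in>UNIV. \<Sum>i\<in>UNIV. T i * d2 i p)"
  proof -
    have "L p - q * ((lam p)\<^sup>2 + (n p)\<^sup>2 * (lam p)\<^sup>2 + \<beta> p + lam p * \<kappa>) + (n p)\<^sup>2 * (lam p)\<^sup>2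
        + (\<Sum>i\<in>UNIV. \<Sum>j\<in>UNIV - {i}. P i j * (b i j p * b j i p)) \<le> (\<Sum>i\<in>UNIV. T i * d2 i p)" for p
    proof -
      have "(\<Sum>i\<in>UNIV. b i i p) / s = - (n p * lam p)" unfolding first using s(2) by simp
      then have "(n p)\<^sup>2 * (lam p)\<^sup>2
        \<le> (\<Sum>i\<in>UNIV. T i * b i i p)\<^sup>2 - (\<Sum>i\<in>UNIV. \<Sum>j\<in>UNIV - {i}. P i j * (b i i p * b j j p))"
        using concave[of "\<lambda>i. b i i p"] by (simp add: power_mult_distrib)
      moreover have "(\<Sum>i\<in>UNIV. \<Sum>j\<in>UNIV - {i}. P i j * (b i i p * b j j p - b i j p * b j i p))
        = (\<Sum>i\<in>UNIV. \<Sum>j\<in>UNIV - {i}. P i j * (b i i p * b j j p)) - (\<Sum>i\<in>UNIV. \<Sum>j\<in>UNIV - {i}. P i j * (b i j p * b j i p))"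
        by (simp only: right_diff_distrib sum_subtractf)
      ultimately show ?thesis using equation[of p] by linarith
    qed
    then have "(\<Sum>p\<in>UNIV. L p - q * ((lam p)\<^sup>2 + (n p)\<^sup>2 * (lam p)\<^sup>2 + \<beta> p + lam p * \<kappa>) + (n p)\<^sup>2 * (lam p)\<^sup>2
        + (\<Sum>i\<in>UNIV. \<Sum>j\<in>UNIV - {i}. P i j * (b i j p * b j i p))) \<le> (\<Sum>p\<in>UNIV. \<Sum>i\<in>UNIV. T i * d2 i p)"
      by (rule sum_mono)
    then show ?thesis
      unfolding sum.distrib sum_subtractf sum_distrib_left[symmetric] sum_distrib_right[symmetric]
        SL_def SN_def SB_def s(1) Q_def .
  qed
  have "kk * SB = - s * (kk * \<kappa>)" using SB by (simp add: mult.left_commute)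
  then have "(\<Sum>p\<in>UNIV. L p) - q * (SL + SN) + SN + kk * SL \<le> 0"
    using A Bid C XQ SB by (simp add: algebra_simps)
  then show ?thesis unfolding SL_def[symmetric] SN_def[symmetric] by (simp add: algebra_simps)
qed

section \<open>Frames that diagonalize the shape operator\<close>

text \<open>The spectral theorem. An orthonormal family that maximizes \<open>\<Sum> w i * (X i \<bullet> S (X i))\<close> for pairwise
distinct weights consists of eigenvectors: rotating \<open>X i\<close> and \<open>X j\<close> in their plane changes the sum at
the rate \<open>2 * (w i - w j) * (X i \<bullet> S (X j))\<close>.\<close>

lemma orthonormal_eigenframe:
  fixes S :: "real^'n \<Rightarrow> real^'n"
  assumes lin: "linear S" and sym: "\<And>y z. y \<bullet> S z = z \<bullet> S y"
  shows "\<exists>X :: 'n \<Rightarrow> real^'n. (\<forall>i j. X i \<bullet> X j = (if i = j then 1 else 0)) \<and> (\<forall>i j. i \<noteq> j \<longrightarrow> X i \<bullet> S (X j) = 0)"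
proof -
  obtain f :: "'n \<Rightarrow> nat" where "inj f"
    using finite_imp_inj_to_nat_seg[of "UNIV :: 'n set"] by auto
  define w where "w i = real (f i)" for i
  have w: "i \<noteq> j \<Longrightarrow> w i \<noteq> w j" for i j using \<open>inj f\<close> by (auto simp: w_def inj_eq)
  define K where "K = {X :: real^'n^'n. \<forall>i j. X $ i \<bullet> X $ j = (if i = j then 1 else 0)}"
  define F where "F X = (\<Sum>i\<in>UNIV. w i * (X $ i \<bullet> S (X $ i)))" for X :: "real^'n^'n"
  have "closed K"
    unfolding K_def by (intro closed_Collect_all closed_Collect_eq continuous_intros)
  moreover have "bounded K"
  proof (rule boundedI[of _ "real CARD('n)"])
    fix X assume "X \<in> K"
    then have "norm (X $ i) = 1" for i by (simp add: K_def norm_eq_1)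
    then have "(\<Sum>i\<in>UNIV. norm (X $ i)) = real CARD('n)" by simp
    then show "norm X \<le> real CARD('n)"
      using L2_set_le_sum[of UNIV "\<lambda>i. norm (X $ i)"] by (simp add: norm_vec_def)
  qed
  ultimately have "compact K" by (simp add: compact_eq_bounded_closed)
  moreover have "(\<chi> i. axis i 1) \<in> K" unfolding K_def by (simp add: inner_axis_axis)
  moreover have "continuous_on K F"
  proof -
    have "continuous_on K (\<lambda>X :: real^'n^'n. S (X $ i))" for i
    proof (rule continuous_on_compose2[where g = S and t = UNIV])
      show "continuous_on UNIV S"
        using lin by (simp add: linear_continuous_on linear_conv_bounded_linear)
      show "continuous_on K (\<lambda>X. X $ i)" by (intro continuous_intros)
    qed simp
    then show ?thesis unfolding F_def by (intro continuous_on_sum continuous_on_mult continuous_on_inner continuous_intros) auto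
  qed
  ultimately obtain X where X: "X \<in> K" "\<And>Y. Y \<in> K \<Longrightarrow> F Y \<le> F X"
    using continuous_attains_sup[of K F] by blast
  have ortho: "X $ i \<bullet> X $ j = (if i = j then 1 else 0)" for i j using X(1) by (simp add: K_def)
  have "X $ i \<bullet> S (X $ j) = 0" if ij: "i \<noteq> j" for i j
  proof -
    define a where "a = X $ i \<bullet> S (X $ i)"
    define d where "d = X $ j \<bullet> S (X $ j)"
    define m where "m = X $ i \<bullet> S (X $ j)"
    define Y where "Y t = (\<chi> l. if l = i then cos t *\<^sub>R X $ i + sin t *\<^sub>R X $ j
        else if l = j then cos t *\<^sub>R X $ j - sin t *\<^sub>R X $ i else X $ l)" for t :: real
    have "Y t \<in> K" for t
    proof -
      have cs: "cos t * cos t + sin t * sin t = 1" using sin_cos_squared_add3 .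
      have "Y t $ k \<bullet> Y t $ l = (if k = l then 1 else 0)" for k l
        using ij cs by (auto simp: Y_def inner_add inner_diff ortho inner_simps algebra_simps)
      then show ?thesis by (simp add: K_def)
    qed
    then have le: "F (Y t) \<le> F X" for t using X(2) by simp
    define c where "c = (\<Sum>l\<in>UNIV - {i} - {j}. w l * (X $ l \<bullet> S (X $ l)))"
    define h where "h t = w i * ((cos t)\<^sup>2 * a + 2 * cos t * sin t * m + (sin t)\<^sup>2 * d)
        + (w j * ((cos t)\<^sup>2 * d - 2 * cos t * sin t * m + (sin t)\<^sup>2 * a) + c)" for t
    have sm: "X $ j \<bullet> S (X $ i) = m" unfolding m_def by (rule sym)
    have "F (Y t) = h t" for t
    proof -
      have "F (Y t) = w i * (Y t $ i \<bullet> S (Y t $ i)) + (w j * (Y t $ j \<bullet> S (Y t $ j))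
          + (\<Sum>l\<in>UNIV - {i} - {j}. w l * (Y t $ l \<bullet> S (Y t $ l))))"
        unfolding F_def using ij by (subst sum.remove[of UNIV i]; simp) (subst sum.remove[of "UNIV - {i}" j]; simp)
      also have "(\<Sum>l\<in>UNIV - {i} - {j}. w l * (Y t $ l \<bullet> S (Y t $ l))) = c"
        unfolding c_def by (intro sum.cong) (auto simp: Y_def)
      also have "Y t $ i \<bullet> S (Y t $ i) = (cos t)\<^sup>2 * a + 2 * cos t * sin t * m + (sin t)\<^sup>2 * d"
        by (simp add: Y_def linear_add[OF lin] linear_scale[OF lin] inner_add inner_simps
            sm a_def[symmetric] d_def[symmetric] m_def[symmetric] power2_eq_square algebra_simps)
      also have "Y t $ j \<bullet> S (Y t $ j) = (cos t)\<^sup>2 * d - 2 * cos t * sin t * m + (sin t)\<^sup>2 * a"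
        using ij by (simp add: Y_def linear_diff[OF lin] linear_scale[OF lin] inner_diff inner_simps
            sm a_def[symmetric] d_def[symmetric] m_def[symmetric] power2_eq_square algebra_simps)
      finally show ?thesis by (simp add: h_def)
    qed
    moreover have "Y 0 = X" by (auto simp: Y_def vec_eq_iff)
    ultimately have hle: "h t \<le> h 0" for t using le by metis
    have "(h has_field_derivative 2 * (w i - w j) * m) (at 0)"
      unfolding h_def by (auto intro!: derivative_eq_intros simp: algebra_simps)
    then have "2 * (w i - w j) * m = 0"
      by (rule DERIV_local_max[of _ _ _ 1]) (use hle in auto)
    then show ?thesis using w[OF ij] by (simp add: m_def)
  qed
  then show ?thesis using ortho by (intro exI[of _ "\<lambda>i. X $ i"]) auto
qed

text \<open>The map \<open>a\<close> in the proof is the inverse square root of the metric \<open>1 + p p\<^sup>T\<close>. It transports an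
orthonormal eigenframe of \<open>v a H a\<close> to the required frame.\<close>

lemma orthonormal_frame_for_graph_metric:
  fixes p :: "real^'n" and H :: "real^'n^'n"
  assumes sym: "\<And>y z. y \<bullet> (H *v z) = z \<bullet> (H *v y)" and v: "v = 1 / sqrt (1 + p \<bullet> p)"
  shows "\<exists>(e :: 'n \<Rightarrow> real^'n) lam. (\<forall>i j. e i \<bullet> e j + (p \<bullet> e i) * (p \<bullet> e j) = (if i = j then 1 else 0))
     \<and> (\<forall>i j. v * (e i \<bullet> (H *v e j)) = (if i = j then lam i else 0))"
proof -
  have q: "1 + p \<bullet> p > 0" by (simp add: add_pos_nonneg)
  have v0: "v > 0" using q by (simp add: v)
  have v2: "v\<^sup>2 * (1 + p \<bullet> p) = 1" using q by (simp add: v power_divide)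
  define c where "c = v\<^sup>2 / (1 + v)"
  define a where "a y = y - (c * (p \<bullet> y)) *\<^sub>R p" for y
  have cp: "c * (p \<bullet> p) = 1 - v"
  proof -
    have "v\<^sup>2 * (p \<bullet> p) = (1 - v) * (1 + v)" using v2 by (simp add: algebra_simps power2_eq_square)
    then show ?thesis using v0 by (simp add: c_def)
  qed
  have pa: "p \<bullet> a y = v * (p \<bullet> y)" for y
  proof -
    have "p \<bullet> a y = (p \<bullet> y) * (1 - c * (p \<bullet> p))" by (simp add: a_def inner_simps algebra_simps)
    then show ?thesis by (simp add: cp)
  qed
  have aa: "a y \<bullet> a z + (p \<bullet> a y) * (p \<bullet> a z) = y \<bullet> z" for y z
  proof -
    have "a y \<bullet> a z = y \<bullet> a z - c * (p \<bullet> y) * (p \<bullet> a z)" by (simp add: a_def[of y] inner_simps)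
    also have "y \<bullet> a z = y \<bullet> z - c * (p \<bullet> y) * (p \<bullet> z)"
      by (simp add: a_def inner_simps inner_commute algebra_simps)
    finally have "a y \<bullet> a z + (p \<bullet> a y) * (p \<bullet> a z) = y \<bullet> z + (p \<bullet> y) * (p \<bullet> z) * (v\<^sup>2 - c * (1 + v))"
      by (simp add: pa algebra_simps power2_eq_square)
    moreover have "c * (1 + v) = v\<^sup>2" using v0 by (simp add: c_def)
    ultimately show ?thesis by simp
  qed
  have lin: "linear (\<lambda>z. v *\<^sub>R a (H *v a z))"
    by (rule linearI) (simp_all add: a_def inner_simps algebra_simps matrix_vector_mult_diff_distrib
        matrix_vector_right_distrib matrix_vector_mult_scaleR)
  define S where "S z = v *\<^sub>R a (H *v a z)" for z
  have asym: "y \<bullet> a z = a y \<bullet> z" for y z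
    by (simp add: a_def inner_simps inner_commute algebra_simps)
  have Ssym: "y \<bullet> (S z) = v * (a y \<bullet> (H *v a z))" for y z
    by (simp add: S_def asym)
  obtain X :: "'n \<Rightarrow> real^'n" where X: "\<forall>i j. X i \<bullet> X j = (if i = j then 1 else 0)"
    "\<forall>i j. i \<noteq> j \<longrightarrow> X i \<bullet> (S (X j)) = 0"
    using orthonormal_eigenframe[of S] lin Ssym sym unfolding S_def by metis
  show ?thesis
    by (rule exI[of _ "\<lambda>i. a (X i)"], rule exI[of _ "\<lambda>i. X i \<bullet> (S (X i))"])
       (use X Ssym aa in auto)
qed

lemma matrix_inv_eqI:
  fixes A B :: "real^'n^'n"
  assumes "A ** B = mat 1"
  shows "matrix_inv A = B"
proof -
  have BA: "B ** A = mat 1" using assms by (simp add: matrix_left_right_inverse)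
  have "A ** matrix_inv A = mat 1 \<and> matrix_inv A ** A = mat 1"
    unfolding matrix_inv_def by (rule someI[of _ B]) (use assms BA in simp)
  then have "B ** A ** matrix_inv A = B" by (simp flip: matrix_mul_assoc)
  then show ?thesis by (simp add: BA)
qed

text \<open>The last component of the upward unit normal.\<close>

definition slope_factor :: "(real^'n) set \<Rightarrow> (real^'n \<Rightarrow> real) \<Rightarrow> real^'n \<Rightarrow> real" where
  "slope_factor \<Omega> g x = 1 / sqrt (1 + grad \<Omega> g x \<bullet> grad \<Omega> g x)"

lemma slope_factor_pos: "slope_factor \<Omega> g x > 0"
  by (simp add: slope_factor_def add_pos_nonneg)

lemma slope_factor_square: "(slope_factor \<Omega> g x)\<^sup>2 * (1 + grad \<Omega> g x \<bullet> grad \<Omega> g x) = 1"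
proof -
  have "1 + grad \<Omega> g x \<bullet> grad \<Omega> g x > 0" by (simp add: add_pos_nonneg)
  then show ?thesis by (simp add: slope_factor_def power_divide)
qed

lemma slope_factor_le_1: "slope_factor \<Omega> g x \<le> 1"
proof -
  have "(slope_factor \<Omega> g x)\<^sup>2 \<le> (slope_factor \<Omega> g x)\<^sup>2 * (1 + grad \<Omega> g x \<bullet> grad \<Omega> g x)"
    by (simp add: distrib_left)
  then have "(slope_factor \<Omega> g x)\<^sup>2 \<le> 1\<^sup>2" by (simp add: slope_factor_square)
  then show ?thesis by (rule power2_le_imp_le) simp
qed

lemma symmetric_matrix_inner:
  fixes A :: "real^'n^'n"
  assumes "\<And>i j. A $ i $ j = A $ j $ i"
  shows "y \<bullet> (A *v z) = z \<bullet> (A *v y)"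
proof -
  have "y \<bullet> (A *v z) = (\<Sum>i\<in>UNIV. \<Sum>j\<in>UNIV. y $ i * A $ i $ j * z $ j)"
    by (simp add: inner_vec_def matrix_vector_mult_def sum_distrib_left mult.assoc)
  also have "\<dots> = (\<Sum>j\<in>UNIV. \<Sum>i\<in>UNIV. z $ j * A $ j $ i * y $ i)"
    by (subst sum.swap) (intro sum.cong refl; simp add: assms mult_ac)
  finally show ?thesis by (simp add: inner_vec_def matrix_vector_mult_def sum_distrib_left mult.assoc)
qed

lemma first_form_nth: "first_form \<Omega> g x $ i $ j = (if i = j then 1 else 0) + grad \<Omega> g x $ i * grad \<Omega> g x $ j"
  by (simp add: first_form_def tangent_def inner_axis_axis)

lemma second_form_nth: "second_form \<Omega> g x $ i $ j = slope_factor \<Omega> g x * hess \<Omega> g x $ i $ j"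
  by (simp add: second_form_def upward_normal_def slope_factor_def power2_norm_eq_inner)

lemma inverse_first_form_nth:
  "matrix_inv (first_form \<Omega> g x) $ i $ j
    = (if i = j then 1 else 0) - (slope_factor \<Omega> g x)\<^sup>2 * (grad \<Omega> g x $ i * grad \<Omega> g x $ j)"
proof -
  let ?p = "grad \<Omega> g x" and ?v2 = "(slope_factor \<Omega> g x)\<^sup>2"
  let ?J = "\<chi> i j. (if i = j then 1 else 0) - ?v2 * (?p $ i * ?p $ j)"
  have "(first_form \<Omega> g x ** ?J) $ i $ j = (if i = j then 1 else 0)" for i j
  proof -
    have "(first_form \<Omega> g x ** ?J) $ i $ j = (\<Sum>k\<in>UNIV. (if i = k then (if k = j then 1 else 0) - ?v2 * (?p $ k * ?p $ j) else 0)
        + ((if k = j then ?p $ i * ?p $ k else 0) - ?v2 * ?p $ i * ?p $ j * (?p $ k * ?p $ k)))"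
      unfolding matrix_matrix_mult_def by (auto simp: first_form_nth algebra_simps intro!: sum.cong)
    also have "\<dots> = ((if i = j then 1 else 0) - ?v2 * (?p $ i * ?p $ j)) + (?p $ i * ?p $ j - ?v2 * ?p $ i * ?p $ j * (?p \<bullet> ?p))"
      by (simp add: sum.distrib sum_subtractf inner_vec_def flip: sum_distrib_left)
    also have "\<dots> = (if i = j then 1 else 0) + ?p $ i * ?p $ j * (1 - ?v2 * (1 + ?p \<bullet> ?p))"
      by (simp add: algebra_simps)
    finally show ?thesis by (simp only: slope_factor_square) simp
  qed
  then have "first_form \<Omega> g x ** ?J = mat 1" by (simp add: vec_eq_iff mat_def)
  from matrix_inv_eqI[OF this] show ?thesis by simp
qed

lemma shape_operator_mult_vec:
  "shape_operator \<Omega> g x *v z = slope_factor \<Omega> g x *\<^sub>R (hess \<Omega> g x *v z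
     - ((slope_factor \<Omega> g x)\<^sup>2 * (grad \<Omega> g x \<bullet> (hess \<Omega> g x *v z))) *\<^sub>R grad \<Omega> g x)"
proof -
  let ?p = "grad \<Omega> g x" and ?v = "slope_factor \<Omega> g x" and ?H = "hess \<Omega> g x"
  have h: "second_form \<Omega> g x *v z = ?v *\<^sub>R (?H *v z)"
    by (simp add: vec_eq_iff matrix_vector_mult_def second_form_nth sum_distrib_left mult.assoc)
  have G: "(matrix_inv (first_form \<Omega> g x) *v y) $ i = y $ i - ?v\<^sup>2 * (?p \<bullet> y) * ?p $ i" for y i
  proof -
    have "(matrix_inv (first_form \<Omega> g x) *v y) $ i = (\<Sum>k\<in>UNIV. (if i = k then y $ k else 0) - ?v\<^sup>2 * ?p $ i * (?p $ k * y $ k))"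
      unfolding matrix_vector_mult_def by (auto simp: inverse_first_form_nth algebra_simps intro!: sum.cong)
    then show ?thesis by (simp add: sum_subtractf inner_vec_def flip: sum_distrib_left)
  qed
  show ?thesis
    unfolding shape_operator_def matrix_vector_mul_assoc[symmetric] h
    by (simp add: vec_eq_iff G algebra_simps)
qed

text \<open>Linear algebra at one point of a graph with gradient \<open>p\<close> and Hessian \<open>H\<close>: the frame \<open>e\<close> is orthonormal
for the induced metric and diagonalizes the second fundamental form \<open>v H\<close>.\<close>

locale graph_frame =
  fixes p :: "real^'n" and v :: real and H :: "real^'n^'n" and e :: "'n \<Rightarrow> real^'n" and lam :: "'n \<Rightarrow> real"
  assumes v: "v > 0" "v\<^sup>2 * (1 + p \<bullet> p) = 1"
    and metric: "\<And>i j. e i \<bullet> e j + (p \<bullet> e i) * (p \<bullet> e j) = (if i = j then 1 else 0)"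
    and diag: "\<And>i j. v * (e i \<bullet> (H *v e j)) = (if i = j then lam i else 0)"
begin

text \<open>The frame dual to \<open>e\<close>.\<close>

definition F :: "'n \<Rightarrow> real^'n" where "F i = e i + (p \<bullet> e i) *\<^sub>R p"

definition E :: "real^'n^'n" where "E = (\<chi> a j. e j $ a)"
definition Fm :: "real^'n^'n" where "Fm = (\<chi> i a. F i $ a)"

lemma F_e: "F i \<bullet> e j = (if i = j then 1 else 0)"
  using metric[of i j] by (simp add: F_def inner_simps)

lemma Fm_E: "Fm ** E = mat 1"
  using F_e by (simp add: vec_eq_iff matrix_matrix_mult_def mat_def Fm_def E_def inner_vec_def)

lemma E_Fm: "E ** Fm = mat 1"
  using Fm_E by (simp add: matrix_left_right_inverse)

lemma conj_nth: "(Fm ** S ** E) $ i $ j = F i \<bullet> (S *v e j)"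
  by (simp add: matrix_matrix_mult_def matrix_vector_mult_def Fm_def E_def inner_vec_def sum_distrib_left sum_distrib_right mult.assoc)
     (rule sum.swap)

lemma expand: "(\<Sum>i\<in>UNIV. (F i \<bullet> z) *\<^sub>R e i) = z"
proof -
  have "(\<Sum>i\<in>UNIV. (F i \<bullet> z) *\<^sub>R e i) = E *v (Fm *v z)"
    by (simp add: vec_eq_iff matrix_vector_mult_def E_def Fm_def inner_vec_def mult.commute)
  then show ?thesis by (simp add: matrix_vector_mul_assoc E_Fm)
qed

lemma expand_inner: "(\<Sum>i\<in>UNIV. (F i \<bullet> z) * (e i \<bullet> y)) = z \<bullet> y"
  using arg_cong[OF expand[of z], of "\<lambda>u. u \<bullet> y"] by (simp add: inner_sum_left)

lemma p_F: "v\<^sup>2 * (p \<bullet> F i) = p \<bullet> e i"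
proof -
  have "v\<^sup>2 * (p \<bullet> F i) = (p \<bullet> e i) * (v\<^sup>2 * (1 + p \<bullet> p))" by (simp add: F_def inner_simps algebra_simps)
  then show ?thesis by (simp add: v)
qed

lemma F_projected: "F i \<bullet> (y - (v\<^sup>2 * (p \<bullet> y)) *\<^sub>R p) = e i \<bullet> y"
proof -
  have "F i \<bullet> (y - (v\<^sup>2 * (p \<bullet> y)) *\<^sub>R p) = F i \<bullet> y - (p \<bullet> y) * (v\<^sup>2 * (p \<bullet> F i))"
    by (simp add: inner_simps inner_commute)
  then show ?thesis unfolding p_F by (simp add: F_def inner_simps)
qed

lemma sum_p_e: "(\<Sum>i\<in>UNIV. (p \<bullet> e i)\<^sup>2) = v\<^sup>2 * (p \<bullet> p)"
proof -
  have "(\<Sum>i\<in>UNIV. (p \<bullet> e i)\<^sup>2) = (\<Sum>i\<in>UNIV. v\<^sup>2 * ((F i \<bullet> p) * (e i \<bullet> p)))"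
  proof (rule sum.cong[OF refl])
    fix i
    have "(p \<bullet> e i)\<^sup>2 = (v\<^sup>2 * (p \<bullet> F i)) * (p \<bullet> e i)"
      unfolding p_F by (rule power2_eq_square)
    then show "(p \<bullet> e i)\<^sup>2 = v\<^sup>2 * ((F i \<bullet> p) * (e i \<bullet> p))" by (simp only: inner_commute mult.assoc)
  qed
  then show ?thesis by (simp add: expand_inner flip: sum_distrib_left)
qed

lemma conj_shape:
  assumes "\<And>z. S *v z = v *\<^sub>R (H *v z - (v\<^sup>2 * (p \<bullet> (H *v z))) *\<^sub>R p)"
  shows "F i \<bullet> (S *v e j) = (if i = j then lam i else 0)"
  unfolding assms inner_scaleR_right F_projected by (rule diag)

lemma conj_det: "det (mat t - Fm ** S ** E) = det (mat t - S)"
proof -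
  have "(mat t - S) *v z = t *\<^sub>R z - S *v z" for z
  proof -
    have "mat t *v z = t *\<^sub>R z"
      by (simp add: vec_eq_iff matrix_vector_mult_def mat_def if_distrib[of "\<lambda>a. a * _"] cong: if_cong)
    then show ?thesis by (simp add: matrix_vector_mult_diff_rdistrib)
  qed
  then have "(Fm ** (mat t - S) ** E) $ i $ j = (mat t - Fm ** S ** E) $ i $ j" for i j
    unfolding conj_nth vector_minus_component by (simp add: conj_nth inner_simps F_e mat_def)
  then have "mat t - Fm ** S ** E = Fm ** (mat t - S) ** E"
    by (simp add: vec_eq_iff)
  then have "det (mat t - Fm ** S ** E) = det Fm * det (mat t - S) * det E" by (simp add: det_mul)
  also have "\<dots> = det (Fm ** E) * det (mat t - S)" by (simp add: det_mul)
  finally show ?thesis by (simp add: Fm_E)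
qed

lemma trace_conj: "(\<Sum>i\<in>UNIV. F i \<bullet> (S *v e i)) = (\<Sum>i\<in>UNIV. S $ i $ i)"
proof -
  have "(\<Sum>i\<in>UNIV. F i \<bullet> (S *v e i)) = trace (Fm ** S ** E)" by (simp add: trace_def conj_nth)
  also have "\<dots> = trace (E ** (Fm ** S))" by (rule trace_mul_sym)
  also have "\<dots> = trace S" by (simp add: matrix_mul_assoc E_Fm)
  finally show ?thesis by (simp add: trace_def)
qed

lemma trace_shape:
  assumes "\<And>z. S *v z = v *\<^sub>R (H *v z - (v\<^sup>2 * (p \<bullet> (H *v z))) *\<^sub>R p)"
  shows "(\<Sum>i\<in>UNIV. S $ i $ i) = (\<Sum>i\<in>UNIV. lam i)"
    "(\<Sum>i\<in>UNIV. \<Sum>j\<in>UNIV. S $ i $ j * S $ j $ i) = (\<Sum>i\<in>UNIV. (lam i)\<^sup>2)"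
proof -
  show "(\<Sum>i\<in>UNIV. S $ i $ i) = (\<Sum>i\<in>UNIV. lam i)"
    using conj_shape[OF assms] by (simp flip: trace_conj)
  have e: "S *v e j = lam j *\<^sub>R e j" for j
    using expand[of "S *v e j"] by (simp add: conj_shape[OF assms] if_distrib if_distribR sum.delta cong: if_cong)
  have "(\<Sum>i\<in>UNIV. \<Sum>j\<in>UNIV. S $ i $ j * S $ j $ i) = (\<Sum>i\<in>UNIV. (S ** S) $ i $ i)"
    by (simp add: matrix_matrix_mult_def)
  also have "\<dots> = (\<Sum>i\<in>UNIV. F i \<bullet> (S *v (S *v e i)))"
    by (simp add: matrix_vector_mul_assoc trace_conj)
  also have "\<dots> = (\<Sum>i\<in>UNIV. (lam i)\<^sup>2)"
    by (simp add: e matrix_vector_mult_scaleR F_e power2_eq_square)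
  finally show "(\<Sum>i\<in>UNIV. \<Sum>j\<in>UNIV. S $ i $ j * S $ j $ i) = (\<Sum>i\<in>UNIV. (lam i)\<^sup>2)" .
qed

end

lemma norm_A_eq:
  assumes sym: "\<And>i j. hess \<Omega> g x $ i $ j = hess \<Omega> g x $ j $ i"
  shows "norm_A \<Omega> g x = sqrt (\<Sum>i\<in>UNIV. \<Sum>j\<in>UNIV. shape_operator \<Omega> g x $ i $ j * shape_operator \<Omega> g x $ j $ i)"
proof -
  let ?G = "matrix_inv (first_form \<Omega> g x)" and ?h = "second_form \<Omega> g x"
  have G: "?G $ i $ j = ?G $ j $ i" for i j by (simp add: inverse_first_form_nth mult.commute)
  have h: "?h $ i $ j = ?h $ j $ i" for i j using sym by (simp add: second_form_nth)
  have "(\<Sum>i\<in>UNIV. \<Sum>j\<in>UNIV. \<Sum>k\<in>UNIV. \<Sum>l\<in>UNIV. ?G $ i $ k * ?G $ j $ l * ?h $ i $ j * ?h $ k $ l)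
     = (\<Sum>j\<in>UNIV. \<Sum>k\<in>UNIV. \<Sum>i\<in>UNIV. \<Sum>l\<in>UNIV. ?G $ i $ k * ?G $ j $ l * ?h $ i $ j * ?h $ k $ l)"
    by (subst sum.swap, rule sum.cong[OF refl], rule sum.swap)
  also have "\<dots> = (\<Sum>j\<in>UNIV. \<Sum>k\<in>UNIV. shape_operator \<Omega> g x $ k $ j * shape_operator \<Omega> g x $ j $ k)"
  proof (intro sum.cong refl)
    fix j k
    have "(\<Sum>i\<in>UNIV. \<Sum>l\<in>UNIV. ?G $ i $ k * ?G $ j $ l * ?h $ i $ j * ?h $ k $ l)
       = (\<Sum>i\<in>UNIV. ?G $ k $ i * ?h $ i $ j) * (\<Sum>l\<in>UNIV. ?G $ j $ l * ?h $ l $ k)"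
      unfolding sum_product by (intro sum.cong refl) (simp add: G[of _ k] h[of k] mult_ac)
    then show "(\<Sum>i\<in>UNIV. \<Sum>l\<in>UNIV. ?G $ i $ k * ?G $ j $ l * ?h $ i $ j * ?h $ k $ l)
      = shape_operator \<Omega> g x $ k $ j * shape_operator \<Omega> g x $ j $ k"
      by (simp add: shape_operator_def matrix_matrix_mult_def)
  qed
  finally show ?thesis by (simp add: norm_A_def Let_def mult.commute)
qed

lemma graph_frame_exists:
  fixes \<Omega> :: "(real^'n) set"
  assumes sym: "\<And>i j. hess \<Omega> g x $ i $ j = hess \<Omega> g x $ j $ i"
  shows "\<exists>e lam. graph_frame (grad \<Omega> g x) (slope_factor \<Omega> g x) (hess \<Omega> g x) e lam"
proof -
  have "y \<bullet> (hess \<Omega> g x *v z) = z \<bullet> (hess \<Omega> g x *v y)" for y z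
    by (rule symmetric_matrix_inner[OF sym])
  from orthonormal_frame_for_graph_metric[OF this refl, of "grad \<Omega> g x"]
  obtain e :: "'n \<Rightarrow> real^'n" and lam :: "'n \<Rightarrow> real"
    where "\<forall>i j. e i \<bullet> e j + (grad \<Omega> g x \<bullet> e i) * (grad \<Omega> g x \<bullet> e j) = (if i = j then 1 else 0)"
    "\<forall>i j. slope_factor \<Omega> g x * (e i \<bullet> (hess \<Omega> g x *v e j)) = (if i = j then lam i else (0::real))"
    unfolding slope_factor_def by blast
  then have "graph_frame (grad \<Omega> g x) (slope_factor \<Omega> g x) (hess \<Omega> g x) e lam"
    by (simp add: graph_frame_def slope_factor_pos slope_factor_square)
  then show ?thesis by blast
qed

section \<open>Graphs of functions\<close>

lemma grad_eq: "x \<in> \<Omega> \<Longrightarrow> grad \<Omega> g x $ i = dderiv (axis i 1) g x"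
  by (simp add: grad_def cont_ext_def)

lemma hess_eq: "x \<in> \<Omega> \<Longrightarrow> hess \<Omega> g x $ i $ j = dderiv (axis i 1) (dderiv (axis j 1) g) x"
  by (simp add: hess_def cont_ext_def)

lemma vec_axis_expansion: "v = (\<Sum>j\<in>UNIV. (v $ j) *\<^sub>R axis j (1::real))"
  by (simp add: vec_eq_iff axis_def if_distrib[of "\<lambda>a. _ * a"] cong: if_cong)

locale c4_graph =
  fixes \<Omega> :: "(real^'n) set" and g :: "real^'n \<Rightarrow> real"
  assumes \<Omega>: "open \<Omega>" and g: "cdiff 4 \<Omega> g"
begin

abbreviation "v \<equiv> slope_factor \<Omega> g"
abbreviation "p \<equiv> grad \<Omega> g"

lemma p_C3: "cdiff 3 \<Omega> (\<lambda>y. p y $ i)"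
proof (rule cdiff_cong[OF \<Omega>])
  show "cdiff 3 \<Omega> (dderiv (axis i 1) g)" using g by (simp add: numeral_3_eq_3 numeral_eq_Suc)
qed (simp add: grad_eq)

lemma hess_symmetric: "x \<in> \<Omega> \<Longrightarrow> hess \<Omega> g x $ i $ j = hess \<Omega> g x $ j $ i"
  unfolding hess_eq by (rule dderiv_commute[OF \<Omega> _ cdiff_mono[OF g _ \<Omega>]]) auto

lemma dderiv_p: "x \<in> \<Omega> \<Longrightarrow> dderiv u (\<lambda>y. p y $ i) x = (hess \<Omega> g x *v u) $ i"
proof -
  assume x: "x \<in> \<Omega>"
  have "dderiv u (\<lambda>y. p y $ i) x = dderiv u (dderiv (axis i 1) g) x"
    by (rule dderiv_cong[OF \<Omega> x grad_eq])
  also have "\<dots> = (\<Sum>j\<in>UNIV. u $ j * dderiv (axis j 1) (dderiv (axis i 1) g) x)"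
    by (rule dderiv_linear_sum[OF _ vec_axis_expansion]) (use g x in \<open>simp add: numeral_eq_Suc\<close>)
  also have "\<dots> = (\<Sum>j\<in>UNIV. hess \<Omega> g x $ i $ j * u $ j)"
    using hess_symmetric[OF x] by (simp add: hess_eq[OF x] mult.commute)
  finally show ?thesis by (simp add: matrix_vector_mult_def)
qed

lemma slope_deriv:
  assumes x: "x \<in> \<Omega>"
  shows "v differentiable at x" "dderiv u v x = - ((v x)^3) * (\<Sum>a\<in>UNIV. p x $ a * dderiv u (\<lambda>y. p y $ a) x)"
proof -
  define W where "W y = 1 + (\<Sum>a\<in>UNIV. p y $ a * p y $ a)" for y
  have W: "v y = 1 / sqrt (W y)" for y by (simp add: slope_factor_def W_def inner_vec_def)
  have W0: "W y > 0" for y unfolding W_def by (simp add: add_pos_nonneg sum_nonneg)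
  have pd: "(\<lambda>y. p y $ a) differentiable at x" for a
    using p_C3[of a] x by (simp add: numeral_3_eq_3)
  have "((\<lambda>y. p y $ a) has_derivative (\<lambda>u. dderiv u (\<lambda>y. p y $ a) x)) (at x)" for a
    by (rule has_derivative_dderiv[OF pd])
  then have dW: "(W has_derivative (\<lambda>u. \<Sum>a\<in>UNIV. p x $ a * dderiv u (\<lambda>y. p y $ a) x + dderiv u (\<lambda>y. p y $ a) x * p x $ a)) (at x)"
    unfolding W_def by (auto intro!: derivative_eq_intros)
  have "((\<lambda>w. 1 / sqrt w) has_real_derivative - ((1 / sqrt (W x))^3) / 2) (at (W x))"
    using W0[of x] by (auto intro!: derivative_eq_intros simp: power3_eq_cube divide_simps)
  from has_derivative_compose[OF dW this[unfolded has_field_derivative_def]]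
  have D: "(v has_derivative (\<lambda>u. - ((v x)^3) / 2 *
      (\<Sum>a\<in>UNIV. p x $ a * dderiv u (\<lambda>y. p y $ a) x + dderiv u (\<lambda>y. p y $ a) x * p x $ a))) (at x)"
    by (simp add: W[abs_def])
  then show "v differentiable at x" by (auto simp: differentiable_def)
  have "dderiv u v x = - ((v x)^3) / 2 * (\<Sum>a\<in>UNIV. 2 * (p x $ a * dderiv u (\<lambda>y. p y $ a) x))"
    using dderiv_eqI[OF D, of u] by (simp add: mult.commute)
  then show "dderiv u v x = - ((v x)^3) * (\<Sum>a\<in>UNIV. p x $ a * dderiv u (\<lambda>y. p y $ a) x)"
    by (simp flip: sum_distrib_left)
qed

lemma slope_C3: "cdiff 3 \<Omega> v"
proof -
  have "m \<le> 3 \<Longrightarrow> cdiff m \<Omega> v" for m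
  proof (induction m)
    case 0
    show ?case using slope_deriv(1) by (auto intro!: continuous_at_imp_continuous_on differentiable_imp_continuous_within)
  next
    case (Suc m)
    have v: "cdiff m \<Omega> v" using Suc by simp
    have "cdiff m \<Omega> (dderiv u (\<lambda>y. p y $ a))" "cdiff m \<Omega> (\<lambda>y. p y $ a)" for u a
      using p_C3[of a] Suc.prems cdiff_mono[OF _ _ \<Omega>, of 2 _ m] cdiff_mono[OF _ _ \<Omega>, of 3 _ m]
      by (auto simp: numeral_3_eq_3 numeral_2_eq_2)
    then have C: "cdiff m \<Omega> (\<lambda>x. - 1 * (v x * (v x * v x)) * (\<Sum>a\<in>UNIV. p x $ a * dderiv u (\<lambda>y. p y $ a) x))" for u
      by (intro cdiff_mult cdiff_sum cdiff_const v \<Omega>)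
    have "cdiff m \<Omega> (dderiv u v)" for u
      by (rule cdiff_cong[OF \<Omega> _ C[of u]]) (simp add: slope_deriv(2) power3_eq_cube)
    then show ?case using slope_deriv(1) by simp
  qed
  then show ?thesis by simp
qed

definition N :: "'n \<Rightarrow> real^'n \<Rightarrow> real" where "N a y = p y $ a * v y"

lemma N_C3: "cdiff 3 \<Omega> (N a)"
  unfolding N_def[abs_def] by (intro cdiff_mult p_C3 slope_C3 \<Omega>)

text \<open>The shape operator is a Jacobian matrix; this is what makes the Codazzi equation a consequence of the
symmetry of second derivatives.\<close>

lemma dderiv_N:
  assumes x: "x \<in> \<Omega>"
  shows "dderiv u (N a) x = (shape_operator \<Omega> g x *v u) $ a"
proof -
  have pd: "(\<lambda>y. p y $ a) differentiable at x" using p_C3[of a] x by (simp add: numeral_3_eq_3)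
  have "dderiv u (N a) x = p x $ a * dderiv u v x + dderiv u (\<lambda>y. p y $ a) x * v x"
    unfolding N_def[abs_def] by (rule dderiv_mult[OF pd slope_deriv(1)[OF x]])
  also have "\<dots> = (shape_operator \<Omega> g x *v u) $ a"
    unfolding shape_operator_mult_vec slope_deriv(2)[OF x] dderiv_p[OF x]
    by (simp add: inner_vec_def power3_eq_cube power2_eq_square algebra_simps)
  finally show ?thesis .
qed

end

text \<open>The frame is constant on the whole domain and adapted at the point \<open>x\<close> only.\<close>

locale c4_graph_frame = c4_graph \<Omega> g + graph_frame "grad \<Omega> g x" "slope_factor \<Omega> g x" "hess \<Omega> g x" e lam
  for \<Omega> :: "(real^'n) set" and g x e lam +
  assumes x: "x \<in> \<Omega>"
begin

definition Nf :: "'n \<Rightarrow> real^'n \<Rightarrow> real" where "Nf i y = (\<Sum>a\<in>UNIV. F i $ a * N a y)"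

lemma Nf_eq: "Nf i y = v y * (F i \<bullet> p y)"
  by (simp add: Nf_def N_def inner_vec_def sum_distrib_left mult_ac)

lemma Nf_C3: "cdiff 3 \<Omega> (Nf i)"
  unfolding Nf_def[abs_def] by (intro cdiff_sum cdiff_cmult N_C3 \<Omega>)

lemma dderiv_Nf: "y \<in> \<Omega> \<Longrightarrow> dderiv (e j) (Nf i) y = F i \<bullet> (shape_operator \<Omega> g y *v e j)"
proof -
  assume y: "y \<in> \<Omega>"
  have d: "N a differentiable at y" for a using N_C3[of a] y by (simp add: numeral_3_eq_3)
  have "dderiv (e j) (Nf i) y = (\<Sum>a\<in>UNIV. F i $ a * dderiv (e j) (N a) y)"
    unfolding Nf_def[abs_def]
    by (subst dderiv_sum) (auto intro!: differentiable_mult d simp: dderiv_cmult d)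
  then show ?thesis by (simp add: dderiv_N[OF y] inner_vec_def)
qed

sublocale adapted_frame \<Omega> x Nf e "\<lambda>i j. F i \<bullet> F j" "\<lambda>i j. e i \<bullet> e j" lam "\<lambda>i. Nf i x" "\<lambda>y. (v y)\<^sup>2"
proof
  show "open \<Omega>" "x \<in> \<Omega>" "cdiff 3 \<Omega> (Nf i)" "Nf i x = Nf i x" for i by (rule \<Omega> x Nf_C3 refl)+
  have n: "Nf i x = (p x \<bullet> e i) / v x" for i
  proof -
    have "v x * Nf i x = p x \<bullet> e i" using p_F[of i] by (simp add: Nf_eq power2_eq_square inner_commute)
    then show ?thesis using graph_frame_axioms by (simp add: graph_frame_def field_simps)
  qed
  have v0: "v x > 0" by (rule slope_factor_pos)
  show "(\<Sum>l\<in>UNIV. dderiv (e l) (Nf i) y * (F l \<bullet> F j - Nf l y * Nf j y))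
      = (\<Sum>l\<in>UNIV. dderiv (e l) (Nf j) y * (F l \<bullet> F i - Nf l y * Nf i y))" if y: "y \<in> \<Omega>" for i j y
  proof -
    define z where "z j = F j - ((v y)\<^sup>2 * (p y \<bullet> F j)) *\<^sub>R p y" for j
    have z: "F l \<bullet> F j - Nf l y * Nf j y = F l \<bullet> z j" for l j
      by (simp add: z_def Nf_eq inner_simps power2_eq_square inner_commute)
    have "(\<Sum>l\<in>UNIV. dderiv (e l) (Nf i) y * (F l \<bullet> z j)) = v y * (z i \<bullet> (hess \<Omega> g y *v z j))" for i j
    proof -
      have "(\<Sum>l\<in>UNIV. dderiv (e l) (Nf i) y * (F l \<bullet> z j))
         = F i \<bullet> (shape_operator \<Omega> g y *v (\<Sum>l\<in>UNIV. (F l \<bullet> z j) *\<^sub>R e l))"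
        by (simp add: dderiv_Nf[OF y] linear_sum[OF matrix_vector_mul_linear] matrix_vector_mult_scaleR inner_sum_right mult.commute)
      also have "\<dots> = F i \<bullet> (shape_operator \<Omega> g y *v z j)" by (simp only: expand)
      also have "\<dots> = v y * (z i \<bullet> (hess \<Omega> g y *v z j))"
        by (simp add: shape_operator_mult_vec z_def[of i] inner_simps inner_commute)
      finally show ?thesis .
    qed
    moreover have "z i \<bullet> (hess \<Omega> g y *v z j) = z j \<bullet> (hess \<Omega> g y *v z i)"
      by (rule symmetric_matrix_inner[OF hess_symmetric[OF y]])
    ultimately show ?thesis unfolding z by simp
  qed
  show "F i \<bullet> F j = (if i = j then 1 else 0) + Nf i x * Nf j x" for i j
  proof -
    have "F i \<bullet> F j = F i \<bullet> e j + (p x \<bullet> e j) * (p x \<bullet> F i)" by (simp add: F_def[of j] inner_simps inner_commute)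
    also have "p x \<bullet> F i = (p x \<bullet> e i) / (v x)\<^sup>2" using p_F[of i] v0 by (simp add: field_simps)
    finally show ?thesis by (simp add: F_e n power2_eq_square)
  qed
  show "dderiv (e j) (Nf i) x = (if i = j then lam i else 0)" for i j
    unfolding dderiv_Nf[OF x] by (rule conj_shape[OF shape_operator_mult_vec])
  show "(v y)\<^sup>2 = 1 - (\<Sum>i\<in>UNIV. \<Sum>j\<in>UNIV. e i \<bullet> e j * (Nf i y * Nf j y))" for y
  proof -
    have "(\<Sum>i\<in>UNIV. Nf i y *\<^sub>R e i) = v y *\<^sub>R p y"
      using expand[of "p y"] by (simp add: Nf_eq scaleR_sum_right[symmetric] flip: scaleR_scaleR)
    then have "(\<Sum>i\<in>UNIV. Nf i y *\<^sub>R e i) \<bullet> (\<Sum>j\<in>UNIV. Nf j y *\<^sub>R e j) = (v y)\<^sup>2 * (p y \<bullet> p y)"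
      by (simp add: power2_eq_square)
    also have "(\<Sum>i\<in>UNIV. Nf i y *\<^sub>R e i) \<bullet> (\<Sum>j\<in>UNIV. Nf j y *\<^sub>R e j)
      = (\<Sum>i\<in>UNIV. \<Sum>j\<in>UNIV. e i \<bullet> e j * (Nf i y * Nf j y))"
      unfolding inner_sum_left inner_sum_right
      by (subst sum.swap, intro sum.cong refl) (simp add: inner_commute)
    finally show ?thesis using slope_factor_square[of \<Omega> g y] by (simp add: distrib_left)
  qed
  show "e i \<bullet> e j = (if i = j then 1 else 0) - (v x)\<^sup>2 * (Nf i x * Nf j x)" for i j
    using metric[of i j] v0 by (simp add: n power2_eq_square)
  show "(v x)\<^sup>2 * (1 + (\<Sum>i\<in>UNIV. (Nf i x)\<^sup>2)) = 1"
  proof -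
    have "(\<Sum>i\<in>UNIV. (Nf i x)\<^sup>2) = (\<Sum>i\<in>UNIV. (p x \<bullet> e i)\<^sup>2) / (v x)\<^sup>2"
      by (simp add: n power_divide sum_divide_distrib)
    also have "\<dots> = p x \<bullet> p x" using sum_p_e v0 by simp
    finally show ?thesis by (simp add: slope_factor_square)
  qed
qed

end

section \<open>The twice differentiated curvature equation\<close>

lemma cdiff_line_derivs_nhds:
  assumes "open U" "x \<in> U" "cdiff 2 U f"
  shows "\<forall>\<^sub>F t in nhds 0. ((\<lambda>t. f (x + t *\<^sub>R v)) has_field_derivative dderiv v f (x + t *\<^sub>R v)) (at t)"
proof -
  have d: "f differentiable at y" if "y \<in> U" for y
    using assms(3) that by (auto simp: numeral_2_eq_2)
  show ?thesis
    using eventually_line[OF assms(1,2), of v] by eventually_elim (rule has_derivative_along_line, rule d)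
qed

lemma ln_second_derivative:
  fixes f f1 :: "real \<Rightarrow> real"
  assumes f: "\<forall>\<^sub>F t in nhds 0. (f has_field_derivative f1 t) (at t)" and f1: "(f1 has_field_derivative f2) (at 0)"
    and pos: "f 0 > 0"
  shows "\<forall>\<^sub>F t in nhds 0. ((\<lambda>t. ln (f t)) has_field_derivative f1 t / f t) (at t)"
    "((\<lambda>t. f1 t / f t) has_field_derivative f2 / f 0 - (f1 0 / f 0)\<^sup>2) (at 0)"
proof -
  have f0: "(f has_field_derivative f1 0) (at 0)" using f by (rule eventually_nhds_x_imp_x)
  have "(f \<longlongrightarrow> f 0) (nhds 0)"
    using DERIV_isCont[OF f0] tendsto_at_iff_tendsto_nhds[of f 0] by (simp add: isCont_def)
  then have "\<forall>\<^sub>F t in nhds 0. f t > 0" using pos by (rule order_tendstoD)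
  with f show "\<forall>\<^sub>F t in nhds 0. ((\<lambda>t. ln (f t)) has_field_derivative f1 t / f t) (at t)"
  proof eventually_elim
    case (elim t)
    show ?case using DERIV_chain2[OF DERIV_ln[OF elim(2)] elim(1)] by (simp add: divide_inverse mult.commute)
  qed
  show "((\<lambda>t. f1 t / f t) has_field_derivative f2 / f 0 - (f1 0 / f 0)\<^sup>2) (at 0)"
    using DERIV_divide[OF f1 f0] pos by (simp add: power2_eq_square diff_divide_distrib)
qed

lemma second_log_derivative_eq:
  fixes f f1 g g1 w w1 :: "real \<Rightarrow> real"
  assumes f: "\<forall>\<^sub>F t in nhds 0. (f has_field_derivative f1 t) (at t)" "(f1 has_field_derivative f2) (at 0)" "f 0 > 0"
    and g: "\<forall>\<^sub>F t in nhds 0. (g has_field_derivative g1 t) (at t)" "(g1 has_field_derivative g2) (at 0)" "g 0 > 0"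
    and w: "\<forall>\<^sub>F t in nhds 0. (w has_field_derivative w1 t) (at t)" "(w1 has_field_derivative w2) (at 0)" "w 0 > 0"
    and eq: "\<forall>\<^sub>F t in nhds 0. ln (f t) = ln (g t) + c * ln (w t)"
  shows "f2 / f 0 - (f1 0 / f 0)\<^sup>2 = g2 / g 0 - (g1 0 / g 0)\<^sup>2 + c * (w2 / w 0 - (w1 0 / w 0)\<^sup>2)"
proof -
  note F = ln_second_derivative[OF f] and G = ln_second_derivative[OF g] and W = ln_second_derivative[OF w]
  have "\<forall>\<^sub>F t in nhds 0. \<forall>\<^sub>F s in nhds t. ln (f s) = ln (g s) + c * ln (w s)"
    using eq by (simp add: eventually_eventually)
  with F(1) G(1) W(1) have ev: "\<forall>\<^sub>F t in nhds 0. f1 t / f t = g1 t / g t + c * (w1 t / w t)"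
  proof eventually_elim
    case (elim t)
    have "((\<lambda>t. ln (g t) + c * ln (w t)) has_field_derivative g1 t / g t + c * (w1 t / w t)) (at t)"
      by (intro DERIV_add DERIV_cmult elim)
    then have "((\<lambda>t. ln (f t)) has_field_derivative g1 t / g t + c * (w1 t / w t)) (at t)"
      using DERIV_cong_ev[OF refl elim(4) refl] by blast
    then show ?case using DERIV_unique elim(1) by blast
  qed
  have "((\<lambda>t. g1 t / g t + c * (w1 t / w t)) has_field_derivative
      g2 / g 0 - (g1 0 / g 0)\<^sup>2 + c * (w2 / w 0 - (w1 0 / w 0)\<^sup>2)) (at 0)"
    by (intro DERIV_add DERIV_cmult G W)
  then have "((\<lambda>t. f1 t / f t) has_field_derivative g2 / g 0 - (g1 0 / g 0)\<^sup>2 + c * (w2 / w 0 - (w1 0 / w 0)\<^sup>2)) (at 0)"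
    using DERIV_cong_ev[OF refl ev refl] by blast
  then show ?thesis using DERIV_unique F(2) by blast
qed

context c4_graph_frame begin

definition shape_in_frame :: "real^'n \<Rightarrow> real^'n^'n" where "shape_in_frame y = (\<chi> i j. M i j y)"

lemma shape_in_frame_eq: "y \<in> \<Omega> \<Longrightarrow> shape_in_frame y = Fm ** shape_operator \<Omega> g y ** E"
  by (simp add: vec_eq_iff shape_in_frame_def conj_nth dderiv_Nf)

lemma minor_sum_shape_in_frame:
  assumes "y \<in> \<Omega>" "principal_curvatures \<Omega> g y \<kappa>" "l \<le> CARD('n)"
  shows "minor_sum l (shape_in_frame y) = sigma l \<kappa>"
  by (rule minor_sum_eq_sigma)
     (use assms in \<open>auto simp: shape_in_frame_eq conj_det principal_curvatures_def\<close>)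

lemma trace_shape_in_frame: "y \<in> \<Omega> \<Longrightarrow> (\<Sum>i\<in>UNIV. M i i y) = (\<Sum>i\<in>UNIV. shape_operator \<Omega> g y $ i $ i)"
  by (simp add: dderiv_Nf trace_conj)

lemma lam_esym:
  assumes "principal_curvatures \<Omega> g x \<kappa>" "l \<le> CARD('n)"
  shows "esym UNIV l lam = sigma l \<kappa>"
proof -
  have "minor_sum l (shape_in_frame x) = esym UNIV l (\<lambda>i. shape_in_frame x $ i $ i)"
    by (rule minor_sum_diagonal) (simp add: shape_in_frame_def diagonal)
  then show ?thesis using minor_sum_shape_in_frame[OF x assms] by (simp add: shape_in_frame_def diagonal)
qed

text \<open>At a maximum point of \<open>\<sigma>\<^sub>1\<^sup>2 / v\<^sup>2\<close> all hypotheses of the algebraic inequality hold, with \<open>T\<close> and \<open>P\<close> the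
normalized derivatives of \<open>\<sigma>\<^sub>k\<close>. Its last term is nonnegative for \<open>q \<le> 1\<close> and is dropped.\<close>

lemma interior_maximum_inequality:
  fixes \<kappa> :: "real^'n \<Rightarrow> real^'n" and h :: "real^'n \<Rightarrow> real" and k' :: nat and q :: real
  defines "k \<equiv> Suc (Suc k')"
  assumes k: "k \<le> CARD('n)" and q: "q \<le> 1"
    and pc: "\<And>y. y \<in> \<Omega> \<Longrightarrow> principal_curvatures \<Omega> g y (\<kappa> y)"
    and adm: "\<kappa> x \<in> Gamma_cone k"
    and h: "cdiff 2 \<Omega> h" "\<And>y. y \<in> \<Omega> \<Longrightarrow> h y > 0"
    and eq: "\<And>y. y \<in> \<Omega> \<Longrightarrow> sigma k (\<kappa> y) = h y * ((v y)\<^sup>2) powr (q / 2)"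
    and max: "\<And>y. y \<in> \<Omega> \<Longrightarrow> (\<Sum>i\<in>UNIV. shape_operator \<Omega> g y $ i $ i)\<^sup>2 / (v y)\<^sup>2
        \<le> (\<Sum>i\<in>UNIV. lam i)\<^sup>2 / (v x)\<^sup>2"
  shows "(\<Sum>p\<in>UNIV. dderiv (e p) (dderiv (e p) h) x / h x - (dderiv (e p) h x / h x)\<^sup>2)
    + (real k - q) * (\<Sum>i\<in>UNIV. (lam i)\<^sup>2) \<le> 0"
proof -
  define s where "s = (\<Sum>i\<in>UNIV. lam i)"
  define n where "n i = Nf i x" for i
  define V where "V y = (v y)\<^sup>2" for y
  have V0: "V y > 0" for y using slope_factor_pos[of \<Omega> g y] by (simp add: V_def)
  have cone: "lam \<in> garding_cone UNIV k"
    using adm k lam_esym[OF pc[OF x]] by (simp add: garding_cone_def Gamma_cone_def)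
  have s: "s > 0" unfolding s_def by (rule garding_cone_sum_pos[OF cone]) (auto simp: k_def)
  define c where "c = esym UNIV k lam"
  have c: "c > 0" unfolding c_def using garding_coneD[OF cone] by simp
  define T where "T i = esym (UNIV - {i}) (Suc k') lam / c" for i
  define P where "P i j = esym (UNIV - {i} - {j}) k' lam / c" for i j
  have cone1: "lam \<in> garding_cone (UNIV - {i}) (Suc k')" for i
    using garding_cone_remove[of UNIV lam "Suc k'" i] cone by (simp add: k_def)
  have cone2: "lam \<in> garding_cone (UNIV - {i} - {j}) k'" if "i \<noteq> j" for i j
    using garding_cone_remove[OF _ cone1] that by simp
  have T0: "T i \<ge> 0" for i
    using garding_coneD[OF cone1 order.refl] c by (simp add: T_def less_imp_le)
  have P0: "P i j \<ge> 0" if "i \<noteq> j" for i j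
    using garding_coneD[OF cone2[OF that] order.refl] c by (simp add: P_def less_imp_le)
  have PT: "P i j * (lam i - lam j) = T j - T i" if "i \<noteq> j" for i j
  proof -
    have "esym (UNIV - {i}) (Suc k') lam = esym (UNIV - {i} - {j}) (Suc k') lam + lam j * esym (UNIV - {i} - {j}) k' lam"
      "esym (UNIV - {j}) (Suc k') lam = esym (UNIV - {j} - {i}) (Suc k') lam + lam i * esym (UNIV - {j} - {i}) k' lam"
      using that by (auto intro!: esym_remove)
    moreover have "UNIV - {j} - {i} = UNIV - {i} - {j}" by auto
    ultimately have "T j - T i = (lam i * esym (UNIV - {i} - {j}) k' lam - lam j * esym (UNIV - {i} - {j}) k' lam) / c"
      unfolding T_def by (simp add: diff_divide_distrib add_divide_distrib)
    then show ?thesis by (simp add: P_def algebra_simps diff_divide_distrib)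
  qed
  have Tlam: "(\<Sum>i\<in>UNIV. T i * lam i) = real k"
  proof -
    have "(\<Sum>i\<in>UNIV. T i * lam i) = (\<Sum>i\<in>UNIV. lam i * esym (UNIV - {i}) (Suc k') lam) / c"
      by (simp add: T_def sum_divide_distrib mult.commute)
    then show ?thesis using esym_euler[of UNIV lam "Suc k'"] c by (simp add: c_def k_def)
  qed
  have concave: "((\<Sum>i\<in>UNIV. \<xi> i) / s)\<^sup>2
      \<le> (\<Sum>i\<in>UNIV. T i * \<xi> i)\<^sup>2 - (\<Sum>i\<in>UNIV. \<Sum>j\<in>UNIV - {i}. P i j * (\<xi> i * \<xi> j))" for \<xi>
    using esym_log_quotient_concave[of UNIV lam k' \<xi>] cone by (simp add: T_def P_def c_def k_def s_def)
  define \<beta> where "\<beta> m = (\<Sum>a\<in>UNIV. n a * b m m a)" for m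
  define \<tau> where "\<tau> = (\<Sum>a\<in>UNIV. (n a)\<^sup>2 * lam a)"
  have V1: "dderiv (e m) V x = - 2 * V x * (n m * lam m)" for m
    using dV_at[of m] by (simp add: V_def[abs_def] n_def)
  have V2: "dderiv (e m) (dderiv (e m) V) x = 2 * V x * (- (lam m)\<^sup>2 + (n m)\<^sup>2 * (lam m)\<^sup>2 - \<beta> m - lam m * \<tau>)" for m
    using ddV_at[of m] by (simp add: V_def[abs_def] n_def \<beta>_def \<tau>_def)
  have VC: "cdiff 2 \<Omega> V" using V_C2 by (simp add: V_def[abs_def])
  \<comment> \<open>Testing \<open>\<sigma>\<^sup>2 - K V\<close>, which is nonpositive and vanishes at \<open>x\<close>, avoids quotients and logarithms.\<close>
  define \<sigma> where "\<sigma> y = (\<Sum>i\<in>UNIV. M i i y)" for y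
  define K where "K = s\<^sup>2 / V x"
  have \<sigma>x: "\<sigma> x = s" by (simp add: \<sigma>_def s_def diagonal)
  have \<sigma>C: "cdiff 2 \<Omega> \<sigma>" unfolding \<sigma>_def[abs_def] by (intro cdiff_sum M_C2 \<Omega>)
  have d\<sigma>: "dderiv (e m) \<sigma> y = (\<Sum>i\<in>UNIV. dderiv (e m) (M i i) y)" if "y \<in> \<Omega>" for m y
    unfolding \<sigma>_def[abs_def] by (rule dderiv_sum) (rule M_diff[OF that])
  have \<sigma>1: "dderiv (e m) \<sigma> x = (\<Sum>i\<in>UNIV. b i i m)" for m
    unfolding d\<sigma>[OF x] b_def ..
  have \<sigma>2: "dderiv (e m) (dderiv (e m) \<sigma>) x = (\<Sum>i\<in>UNIV. d2 i m)" for m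
  proof -
    have "dderiv (e m) (dderiv (e m) \<sigma>) x = dderiv (e m) (\<lambda>y. \<Sum>i\<in>UNIV. dderiv (e m) (M i i) y) x"
      by (rule dderiv_cong[OF \<Omega> x d\<sigma>])
    also have "\<dots> = (\<Sum>i\<in>UNIV. d2 i m)" unfolding d2_def by (rule dderiv_sum) (rule dM_diff[OF x])
    finally show ?thesis .
  qed
  define \<phi> where "\<phi> y = \<sigma> y * \<sigma> y - K * V y" for y
  have \<phi>C: "cdiff 2 \<Omega> \<phi>"
    unfolding \<phi>_def[abs_def] by (intro cdiff_diff cdiff_mult cdiff_cmult cdiff_const \<sigma>C VC \<Omega>)
  have \<phi>max: "\<phi> y \<le> \<phi> x" if y: "y \<in> \<Omega>" for y
  proof -
    have "(\<sigma> y)\<^sup>2 / V y \<le> K"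
      using max[OF y] trace_shape_in_frame[OF y] by (simp add: \<sigma>_def V_def K_def s_def)
    then have "(\<sigma> y)\<^sup>2 \<le> K * V y" using V0[of y] by (simp add: divide_simps split: if_splits)
    moreover have "\<phi> x = 0" using V0[of x] by (simp add: \<phi>_def K_def \<sigma>x power2_eq_square)
    ultimately show ?thesis by (simp add: \<phi>_def power2_eq_square)
  qed
  have diffs: "\<sigma> differentiable at y" "V differentiable at y" "dderiv u \<sigma> differentiable at y" "dderiv u V differentiable at y"
    if "y \<in> \<Omega>" for y u
    using \<sigma>C VC that by (simp_all add: numeral_2_eq_2)
  have d\<phi>: "dderiv u \<phi> y = 2 * (\<sigma> y * dderiv u \<sigma> y) - K * dderiv u V y" if "y \<in> \<Omega>" for u y
    unfolding \<phi>_def[abs_def] using diffs[OF that]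
    by (subst dderiv_diff) (auto simp: dderiv_mult dderiv_cmult intro!: differentiable_mult)
  have dd\<phi>: "dderiv u (dderiv u \<phi>) x = 2 * (\<sigma> x * dderiv u (dderiv u \<sigma>) x + (dderiv u \<sigma> x)\<^sup>2) - K * dderiv u (dderiv u V) x" for u
  proof -
    have "dderiv u (dderiv u \<phi>) x = dderiv u (\<lambda>y. 2 * (\<sigma> y * dderiv u \<sigma> y) - K * dderiv u V y) x"
      by (rule dderiv_cong[OF \<Omega> x d\<phi>])
    also have "\<dots> = 2 * (\<sigma> x * dderiv u (dderiv u \<sigma>) x + (dderiv u \<sigma> x)\<^sup>2) - K * dderiv u (dderiv u V) x"
      using diffs[OF x]
      by (subst dderiv_diff) (auto simp: dderiv_mult dderiv_cmult power2_eq_square intro!: differentiable_mult)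
    finally show ?thesis .
  qed
  have first: "(\<Sum>i\<in>UNIV. b i i m) = - s * (n m * lam m)" for m
  proof -
    have "2 * (s * (\<Sum>i\<in>UNIV. b i i m)) - K * (- 2 * V x * (n m * lam m)) = 0"
      using cdiff_local_max(1)[OF \<Omega> x \<phi>C \<phi>max, of "e m"] unfolding d\<phi>[OF x] \<sigma>x \<sigma>1 V1 by simp
    then have "s * ((\<Sum>i\<in>UNIV. b i i m) + s * (n m * lam m)) = 0"
      using V0[of x] by (simp add: K_def algebra_simps power2_eq_square)
    then show ?thesis using s by simp
  qed
  have second: "(\<Sum>i\<in>UNIV. d2 i m) \<le> - s * ((lam m)\<^sup>2 + \<beta> m + lam m * \<tau>)" for m
  proof -
    have "2 * (s * (\<Sum>i\<in>UNIV. d2 i m) + (- s * (n m * lam m))\<^sup>2)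
       - K * (2 * V x * (- (lam m)\<^sup>2 + (n m)\<^sup>2 * (lam m)\<^sup>2 - \<beta> m - lam m * \<tau>)) \<le> 0"
      using cdiff_local_max(2)[OF \<Omega> x \<phi>C \<phi>max, of "e m"] unfolding dd\<phi> \<sigma>x \<sigma>1 \<sigma>2 V2 first .
    moreover have "K * (2 * V x * (- (lam m)\<^sup>2 + (n m)\<^sup>2 * (lam m)\<^sup>2 - \<beta> m - lam m * \<tau>))
      = 2 * s\<^sup>2 * (- (lam m)\<^sup>2 + (n m)\<^sup>2 * (lam m)\<^sup>2 - \<beta> m - lam m * \<tau>)"
      using V0[of x] by (simp add: K_def)
    ultimately have "s * ((\<Sum>i\<in>UNIV. d2 i m) + s * ((lam m)\<^sup>2 + \<beta> m + lam m * \<tau>)) \<le> 0"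
      by (simp add: algebra_simps power2_eq_square)
    then show ?thesis using s by (simp add: mult_le_0_iff)
  qed
  \<comment> \<open>Since \<open>v\<^sup>q = V powr (q / 2)\<close>, the right-hand side contributes \<open>q\<close> times the second
    derivative of \<open>log v\<close>, and \<open>V1\<close>, \<open>V2\<close> evaluate it.\<close>
  have equation: "(\<Sum>i\<in>UNIV. T i * d2 i p)
        + (\<Sum>i\<in>UNIV. \<Sum>j\<in>UNIV - {i}. P i j * (b i i p * b j j p - b i j p * b j i p))
        - (\<Sum>i\<in>UNIV. T i * b i i p)\<^sup>2
      = (dderiv (e p) (dderiv (e p) h) x / h x - (dderiv (e p) h x / h x)\<^sup>2)
        - q * ((lam p)\<^sup>2 + (n p)\<^sup>2 * (lam p)\<^sup>2 + \<beta> p + lam p * \<tau>)" for p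
  proof -
    let ?l = "\<lambda>t. x + t *\<^sub>R e p"
    define A where "A t = shape_in_frame (?l t)" for t
    define A1 where "A1 t = (\<chi> i j. dderiv (e p) (M i j) (?l t))" for t
    define A2 where "A2 = (\<chi> i j. dderiv (e p) (dderiv (e p) (M i j)) x)"
    have A: "((\<lambda>t. A t $ i $ j) has_field_derivative A1 t $ i $ j) (at t)" if "?l t \<in> \<Omega>" for i j t
      unfolding A_def A1_def shape_in_frame_def using has_derivative_along_line[OF M_diff[OF that]] by simp
    have A1: "((\<lambda>t. A1 t $ i $ j) has_field_derivative A2 $ i $ j) (at 0)" for i j
      unfolding A1_def A2_def using cdiff_line_derivs(3)[OF \<Omega> x M_C2, where v = "e p"] by simp
    have ev: "\<forall>\<^sub>F t in nhds 0. ?l t \<in> \<Omega>" by (rule eventually_line[OF \<Omega> x])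
    have A0: "A 0 $ i $ j = (if i = j then lam i else 0)" for i j by (simp add: A_def shape_in_frame_def diagonal)
    have A10: "A1 0 $ i $ j = b i j p" for i j by (simp add: A1_def b_def)
    have A2i: "A2 $ i $ i = d2 i p" for i by (simp add: A2_def d2_def)
    have z1: "\<forall>\<^sub>F t in nhds 0. ((\<lambda>t. minor_sum k (A t)) has_field_derivative minor_sum_deriv k (A t) (A1 t)) (at t)"
      using ev by eventually_elim (rule minor_sum_has_derivative, rule A)
    have z2: "((\<lambda>t. minor_sum_deriv k (A t) (A1 t)) has_field_derivative
      ((\<Sum>i\<in>UNIV. esym (UNIV - {i}) (Suc k') lam * d2 i p)
     + (\<Sum>i\<in>UNIV. \<Sum>j\<in>UNIV - {i}. esym (UNIV - {i} - {j}) k' lam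
         * (b i i p * b j j p - b i j p * b j i p)))) (at 0)"
    proof -
      have "((\<lambda>t. A t $ i $ j) has_field_derivative A1 0 $ i $ j) (at 0)" for i j
        using A[of 0] x by simp
      from minor_sum_second_derivative[of A A1 0 A2 k', OF this A1] show ?thesis
        by (simp add: A0 A10 A2i k_def)
    qed
    have z0: "minor_sum k (A 0) = c"
      using minor_sum_diagonal[of "A 0" k] by (simp add: A0 c_def)
    have z10: "minor_sum_deriv k (A 0) (A1 0) = (\<Sum>i\<in>UNIV. esym (UNIV - {i}) (Suc k') lam * b i i p)"
      using minor_sum_deriv_diagonal[of "A 0" "Suc k'" "A1 0"] by (simp add: A0 A10 k_def)
    have lneq: "\<forall>\<^sub>F t in nhds 0. ln (minor_sum k (A t)) = ln (h (?l t)) + q / 2 * ln (V (?l t))"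
      using ev
    proof eventually_elim
      case (elim t)
      have "minor_sum k (A t) = h (?l t) * V (?l t) powr (q / 2)"
        using minor_sum_shape_in_frame[OF elim pc[OF elim] k] eq[OF elim] by (simp add: A_def V_def)
      then show ?case using h(2)[OF elim] V0[of "?l t"] by (simp add: ln_mult ln_powr)
    qed
    have "((\<Sum>i\<in>UNIV. esym (UNIV - {i}) (Suc k') lam * d2 i p)
     + (\<Sum>i\<in>UNIV. \<Sum>j\<in>UNIV - {i}. esym (UNIV - {i} - {j}) k' lam
         * (b i i p * b j j p - b i j p * b j i p))) / c - ((\<Sum>i\<in>UNIV. esym (UNIV - {i}) (Suc k') lam * b i i p) / c)\<^sup>2
      = dderiv (e p) (dderiv (e p) h) x / h x - (dderiv (e p) h x / h x)\<^sup>2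
        + q / 2 * (dderiv (e p) (dderiv (e p) V) x / V x - (dderiv (e p) V x / V x)\<^sup>2)"
      using second_log_derivative_eq[OF z1 z2 _ cdiff_line_derivs_nhds[OF \<Omega> x h(1), of "e p"]
          cdiff_line_derivs(3)[OF \<Omega> x h(1), of "e p"] _ cdiff_line_derivs_nhds[OF \<Omega> x VC, of "e p"]
          cdiff_line_derivs(3)[OF \<Omega> x VC, of "e p"] _ lneq] c h(2)[OF x] V0[of x]
      by (simp add: z0 z10)
    also have "dderiv (e p) (dderiv (e p) V) x / V x = 2 * (- (lam p)\<^sup>2 + (n p)\<^sup>2 * (lam p)\<^sup>2 - \<beta> p - lam p * \<tau>)"
      unfolding V2 using V0[of x] by simp
    also have "dderiv (e p) V x / V x = - 2 * (n p * lam p)"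
      unfolding V1 using V0[of x] by simp
    also have "q / 2 * (2 * (- (lam p)\<^sup>2 + (n p)\<^sup>2 * (lam p)\<^sup>2 - \<beta> p - lam p * \<tau>) - (- 2 * (n p * lam p))\<^sup>2)
       = - (q * ((lam p)\<^sup>2 + (n p)\<^sup>2 * (lam p)\<^sup>2 + \<beta> p + lam p * \<tau>))"
      by (simp add: algebra_simps power2_eq_square)
    finally show ?thesis
      by (simp add: T_def P_def sum_divide_distrib add_divide_distrib)
  qed
  have "(\<Sum>p\<in>UNIV. dderiv (e p) (dderiv (e p) h) x / h x - (dderiv (e p) h x / h x)\<^sup>2)
    + (real k - q) * (\<Sum>i\<in>UNIV. (lam i)\<^sup>2) + (1 - q) * (\<Sum>i\<in>UNIV. (n i)\<^sup>2 * (lam i)\<^sup>2) \<le> 0"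
  proof (rule curvature_inequality_at_maximum[where b = b and T = T and P = P and s = s and n = n and lam = lam])
    show "b i j l = b i l j" for i j l by (rule b_swap)
    show "b i j l - b l j i = (lam i - lam l) * lam j * ((if i = j then n l else 0) + (if l = j then n i else 0))" for i j l
      unfolding n_def by (rule b_codazzi)
    show "d2 i m - d2 m i = lam m * (\<Sum>a\<in>UNIV. n a * b i i a) - lam i * (\<Sum>a\<in>UNIV. n a * b m m a)
      + 2 * lam i * b i i m * n m - 2 * lam m * b m m i * n i + lam i * lam m * (lam i - lam m)" for i m
      unfolding n_def by (rule simons)
    show "(\<Sum>i\<in>UNIV. b i i m) = - s * (n m * lam m)" for m by (rule first)
    show "(\<Sum>i\<in>UNIV. d2 i m) \<le> - s * ((lam m)\<^sup>2 + (\<Sum>a\<in>UNIV. n a * b m m a) + lam m * (\<Sum>a\<in>UNIV. (n a)\<^sup>2 * lam a))" for m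
      by (rule second[unfolded \<beta>_def \<tau>_def])
    show "(\<Sum>i\<in>UNIV. T i * d2 i p)
        + (\<Sum>i\<in>UNIV. \<Sum>j\<in>UNIV - {i}. P i j * (b i i p * b j j p - b i j p * b j i p))
        - (\<Sum>i\<in>UNIV. T i * b i i p)\<^sup>2
      = (dderiv (e p) (dderiv (e p) h) x / h x - (dderiv (e p) h x / h x)\<^sup>2)
        - q * ((lam p)\<^sup>2 + (n p)\<^sup>2 * (lam p)\<^sup>2 + (\<Sum>a\<in>UNIV. n a * b p p a) + lam p * (\<Sum>a\<in>UNIV. (n a)\<^sup>2 * lam a))" for p
      by (rule equation[unfolded \<beta>_def \<tau>_def])
    show "0 \<le> T i" for i by (rule T0)
    show "(\<Sum>i\<in>UNIV. T i * lam i) = real k" by (rule Tlam)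
    show "0 \<le> P i j" if "i \<noteq> j" for i j using that by (rule P0)
    show "P i j * (lam i - lam j) = T j - T i" if "i \<noteq> j" for i j using that by (rule PT)
    show "((\<Sum>i\<in>UNIV. \<xi> i) / s)\<^sup>2
      \<le> (\<Sum>i\<in>UNIV. T i * \<xi> i)\<^sup>2 - (\<Sum>i\<in>UNIV. \<Sum>j\<in>UNIV - {i}. P i j * (\<xi> i * \<xi> j))" for \<xi>
      by (rule concave)
    show "s = (\<Sum>i\<in>UNIV. lam i)" "0 < s" by (rule s_def, rule s)
  qed
  moreover have "(1 - q) * (\<Sum>i\<in>UNIV. (n i)\<^sup>2 * (lam i)\<^sup>2) \<ge> 0"
    using q by (intro mult_nonneg_nonneg sum_nonneg) auto
  ultimately show ?thesis by linarith
qed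

end

section \<open>Bounds for the source term\<close>

lemma dderiv_graph_compose:
  fixes g :: "'a::euclidean_space \<Rightarrow> real" and \<Phi> :: "'a \<times> real \<Rightarrow> real"
  assumes g: "g differentiable at x" and \<Phi>: "\<Phi> differentiable at (x, g x)"
  shows "(\<lambda>y. \<Phi> (y, g y)) differentiable at x"
    "dderiv u (\<lambda>y. \<Phi> (y, g y)) x = dderiv (u, 0) \<Phi> (x, g x) + dderiv u g x * dderiv (0, 1) \<Phi> (x, g x)"
proof -
  have "((\<lambda>y. (y, g y)) has_derivative (\<lambda>u. (u, dderiv u g x))) (at x)"
    by (intro has_derivative_Pair has_derivative_ident has_derivative_dderiv g)
  from has_derivative_compose[OF this has_derivative_dderiv[OF \<Phi>]]
  have D: "((\<lambda>y. \<Phi> (y, g y)) has_derivative (\<lambda>u. dderiv (u, dderiv u g x) \<Phi> (x, g x))) (at x)" .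
  then show "(\<lambda>y. \<Phi> (y, g y)) differentiable at x" by (auto simp: differentiable_def)
  interpret linear "\<lambda>v. dderiv v \<Phi> (x, g x)" by (rule dderiv_linear[OF \<Phi>])
  have "(u, dderiv u g x) = (u, 0) + dderiv u g x *\<^sub>R (0, 1)" by simp
  then have "dderiv (u, dderiv u g x) \<Phi> (x, g x) = dderiv (u, 0) \<Phi> (x, g x) + dderiv u g x * dderiv (0, 1) \<Phi> (x, g x)"
    by (simp only: add scale real_scaleR_def)
  then show "dderiv u (\<lambda>y. \<Phi> (y, g y)) x = dderiv (u, 0) \<Phi> (x, g x) + dderiv u g x * dderiv (0, 1) \<Phi> (x, g x)"
    using dderiv_eqI[OF D] by simp
qed

lemma cdiff_graph_compose:
  fixes g :: "'a::euclidean_space \<Rightarrow> real" and \<Phi> :: "'a \<times> real \<Rightarrow> real"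
  assumes U: "open U" and "cdiff m U g" "cdiff m (U \<times> UNIV) \<Phi>"
  shows "cdiff m U (\<lambda>y. \<Phi> (y, g y))"
  using assms(2,3)
proof (induction m arbitrary: \<Phi>)
  case 0
  have p: "continuous_on U (\<lambda>y. (y, g y))" using 0 by (intro continuous_intros) auto
  have "continuous_on (U \<times> UNIV) \<Phi>" using 0 by simp
  from continuous_on_compose2[OF this p] show ?case by (simp add: image_subset_iff)
next
  case (Suc m)
  have d: "g differentiable at y" "\<Phi> differentiable at (y, g y)" if "y \<in> U" for y
    using Suc.prems[unfolded cdiff.simps(2)] that by blast+
  have gm: "cdiff m U g" by (rule cdiff_SucD[OF Suc.prems(1) U])
  have "cdiff m U (\<lambda>y. dderiv (u, 0) \<Phi> (y, g y) + dderiv u g y * dderiv (0, 1) \<Phi> (y, g y))" for u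
    using Suc.prems[unfolded cdiff.simps(2)] by (intro cdiff_add cdiff_mult Suc.IH gm U) blast+
  note C = this
  have "cdiff m U (dderiv u (\<lambda>y. \<Phi> (y, g y)))" for u
    by (rule cdiff_cong[OF U _ C[of u]]) (simp add: dderiv_graph_compose(2)[OF d])
  then show ?case using dderiv_graph_compose(1)[OF d] by simp
qed

lemma dderiv_horizontal_bound:
  fixes \<Phi> :: "(real^'n) \<times> real \<Rightarrow> real"
  assumes "\<Phi> differentiable at z" "\<And>j. \<bar>dderiv (axis j 1, 0) \<Phi> z\<bar> \<le> K" "norm u \<le> 1"
  shows "\<bar>dderiv (u, 0) \<Phi> z\<bar> \<le> real CARD('n) * K"
proof -
  have "(u, 0) = (\<Sum>j\<in>UNIV. (u $ j) *\<^sub>R (axis j 1, 0::real))"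
    by (simp add: prod_eq_iff fst_sum snd_sum vec_axis_expansion[symmetric])
  from dderiv_linear_sum[OF assms(1) this]
  have "\<bar>dderiv (u, 0) \<Phi> z\<bar> = \<bar>\<Sum>j\<in>UNIV. u $ j * dderiv (axis j 1, 0) \<Phi> z\<bar>" by simp
  also have "\<dots> \<le> (\<Sum>j\<in>UNIV. \<bar>u $ j * dderiv (axis j 1, 0) \<Phi> z\<bar>)" by (rule sum_abs)
  also have "\<dots> \<le> (\<Sum>j\<in>(UNIV::'n set). 1 * K)"
  proof (rule sum_mono)
    fix j
    have "\<bar>u $ j\<bar> \<le> 1" using component_le_norm_cart[of u j] assms(3) by simp
    then show "\<bar>u $ j * dderiv (axis j 1, 0) \<Phi> z\<bar> \<le> 1 * K"
      unfolding abs_mult by (intro mult_mono assms(2)) auto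
  qed
  finally show ?thesis by simp
qed

context c4_graph_frame begin

lemma frame_bounds: "norm (e i) \<le> 1" "\<bar>p x \<bullet> e i\<bar> \<le> 1"
proof -
  have "e i \<bullet> e i + (p x \<bullet> e i)\<^sup>2 = 1" using metric[of i i] by (simp add: power2_eq_square)
  then have "e i \<bullet> e i \<le> 1" "(p x \<bullet> e i)\<^sup>2 \<le> 1"
    using inner_ge_zero[of "e i"] zero_le_power2[of "p x \<bullet> e i"] by linarith+
  then show "norm (e i) \<le> 1" "\<bar>p x \<bullet> e i\<bar> \<le> 1"
    by (simp_all add: norm_eq_sqrt_inner abs_square_le_1)
qed

lemma dderiv_g: "y \<in> \<Omega> \<Longrightarrow> dderiv u g y = p y \<bullet> u"
proof -
  assume y: "y \<in> \<Omega>"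
  have "dderiv u g y = (\<Sum>j\<in>UNIV. u $ j * dderiv (axis j 1) g y)"
    by (rule dderiv_linear_sum[OF _ vec_axis_expansion]) (use g y in \<open>simp add: numeral_eq_Suc\<close>)
  then show ?thesis by (simp add: inner_vec_def grad_eq[OF y] mult.commute)
qed

lemma dderiv2_g: "dderiv (e m) (dderiv (e m) g) x = lam m / v x"
proof -
  have "dderiv (e m) (dderiv (e m) g) x = dderiv (e m) (\<lambda>y. \<Sum>a\<in>UNIV. e m $ a * p y $ a) x"
    by (rule dderiv_cong[OF \<Omega> x]) (simp add: dderiv_g inner_vec_def mult.commute)
  also have "\<dots> = (\<Sum>a\<in>UNIV. e m $ a * dderiv (e m) (\<lambda>y. p y $ a) x)"
    using p_C3 x by (subst dderiv_sum) (auto simp: dderiv_cmult numeral_3_eq_3 intro!: differentiable_mult)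
  also have "\<dots> = e m \<bullet> (hess \<Omega> g x *v e m)" by (simp add: dderiv_p[OF x] inner_vec_def)
  also have "\<dots> = lam m / v x" using diag[of m m] slope_factor_pos[of \<Omega> g x] by (simp add: field_simps)
  finally show ?thesis .
qed

text \<open>Along the graph the second derivative of \<open>H\<close> contains the second derivative \<open>lam m / v\<close> of the height,
multiplied by the vertical derivative of \<open>H\<close>; it is the only term not bounded by \<open>K\<close> and the
dimension.\<close>

lemma source_term_bound:
  assumes H: "cdiff 2 (\<Omega> \<times> UNIV) H"
    and K: "K \<ge> 1" "H (x, g x) \<ge> 1 / K" "\<And>b. b \<in> Basis \<Longrightarrow> \<bar>dderiv b H (x, g x)\<bar> \<le> K"
      "\<And>b b'. b \<in> Basis \<Longrightarrow> b' \<in> Basis \<Longrightarrow> \<bar>dderiv b (dderiv b' H) (x, g x)\<bar> \<le> K"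
  defines "h \<equiv> \<lambda>y. H (y, g y)" and "c \<equiv> real CARD('n)"
  shows "- (8 * c\<^sup>2 * K ^ 4 + K\<^sup>2 * \<bar>lam m\<bar> / v x)
    \<le> dderiv (e m) (dderiv (e m) h) x / h x - (dderiv (e m) h x / h x)\<^sup>2"
proof -
  define u where "u = e m"
  define z where "z = (x, g x)"
  have c: "c \<ge> 1" unfolding c_def by (simp add: Suc_leI card_gt_0_iff)
  have basis: "(axis j 1, 0) \<in> (Basis :: ((real^'n) \<times> real) set)" "(0, 1) \<in> (Basis :: ((real^'n) \<times> real) set)" for j
    by (auto simp: Basis_prod_def axis_in_Basis_iff)
  have open2: "open (\<Omega> \<times> (UNIV :: real set))" using \<Omega> by (simp add: open_Times)
  have zU: "z \<in> \<Omega> \<times> UNIV" using x by (simp add: z_def)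
  have dH: "H differentiable at w" "dderiv a H differentiable at w" if "w \<in> \<Omega> \<times> UNIV" for w a
    using H[unfolded numeral_2_eq_2 cdiff.simps(2)] that by blast+
  have dg: "g differentiable at y" "dderiv u g differentiable at y" if "y \<in> \<Omega>" for y
    using g that by (simp_all add: numeral_eq_Suc)
  have gu: "\<bar>dderiv u g x\<bar> \<le> 1" using frame_bounds(2)[of m] by (simp add: dderiv_g[OF x] u_def)
  have guu: "dderiv u (dderiv u g) x = lam m / v x" unfolding u_def by (rule dderiv2_g)
  have u1: "norm u \<le> 1" unfolding u_def by (rule frame_bounds)
  have h1: "dderiv u h y = dderiv (u, 0) H (y, g y) + dderiv u g y * dderiv (0, 1) H (y, g y)" if "y \<in> \<Omega>" for y
    unfolding h_def by (rule dderiv_graph_compose(2)) (use that dg dH in auto)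
  have c2: "(\<lambda>y. dderiv a H (y, g y)) differentiable at x"
    "dderiv u (\<lambda>y. dderiv a H (y, g y)) x = dderiv (u, 0) (dderiv a H) z + dderiv u g x * dderiv (0, 1) (dderiv a H) z" for a
    unfolding z_def by (rule dderiv_graph_compose; use x dg dH in auto)+
  have h2: "dderiv u (dderiv u h) x = (dderiv (u, 0) (dderiv (u, 0) H) z + dderiv u g x * dderiv (0, 1) (dderiv (u, 0) H) z)
      + (dderiv u g x * (dderiv (u, 0) (dderiv (0, 1) H) z + dderiv u g x * dderiv (0, 1) (dderiv (0, 1) H) z)
         + dderiv u (dderiv u g) x * dderiv (0, 1) H z)"
  proof -
    have "dderiv u (dderiv u h) x = dderiv u (\<lambda>y. dderiv (u, 0) H (y, g y) + dderiv u g y * dderiv (0, 1) H (y, g y)) x"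
      by (rule dderiv_cong[OF \<Omega> x h1])
    also have "\<dots> = dderiv u (\<lambda>y. dderiv (u, 0) H (y, g y)) x
        + (dderiv u g x * dderiv u (\<lambda>y. dderiv (0, 1) H (y, g y)) x + dderiv u (dderiv u g) x * dderiv (0, 1) H (x, g x))"
      using dg[OF x] c2(1) by (subst dderiv_add) (auto simp: dderiv_mult intro!: differentiable_mult)
    finally show ?thesis by (simp only: c2(2) z_def)
  qed
  have swap: "dderiv a (dderiv a' H) z = dderiv a' (dderiv a H) z" for a a'
    by (rule dderiv_commute[OF open2 zU H])
  have b1: "\<bar>dderiv (u, 0) H z\<bar> \<le> c * K" "\<bar>dderiv (0, 1) H z\<bar> \<le> K"
    unfolding c_def
    by (rule dderiv_horizontal_bound[OF dH(1)[OF zU] _ u1]; unfold z_def; rule K(3)[OF basis(1)])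
       (unfold z_def, rule K(3)[OF basis(2)])
  have b2: "\<bar>dderiv (u, 0) (dderiv b H) z\<bar> \<le> c * K" if "b \<in> Basis" for b
    unfolding c_def
    by (rule dderiv_horizontal_bound[OF dH(2)[OF zU] _ u1]) (unfold z_def, rule K(4)[OF basis(1) that])
  have b3: "\<bar>dderiv (u, 0) (dderiv (u, 0) H) z\<bar> \<le> c * (c * K)"
    unfolding c_def
  proof (rule dderiv_horizontal_bound[OF dH(2)[OF zU] _ u1])
    show "\<bar>dderiv (axis j 1, 0) (dderiv (u, 0) H) z\<bar> \<le> real CARD('n) * K" for j
      using b2[OF basis(1)[of j]] unfolding swap[of "(axis j 1, 0)"] c_def .
  qed
  have b4: "\<bar>dderiv (u, 0) (dderiv (0, 1) H) z\<bar> \<le> c * K" "\<bar>dderiv (0, 1) (dderiv (u, 0) H) z\<bar> \<le> c * K"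
    "\<bar>dderiv (0, 1) (dderiv (0, 1) H) z\<bar> \<le> K"
    using b2[OF basis(2)] K(4)[OF basis(2) basis(2)] swap[of "(0, 1)" "(u, 0)"] by (simp_all add: z_def)
  have prod1: "\<bar>dderiv u g x * w\<bar> \<le> B" if "\<bar>w\<bar> \<le> B" for w B
    using mult_mono[OF gu that] by (simp add: abs_mult)
  define y where "y = \<bar>lam m\<bar> / v x"
  have y: "y \<ge> 0" using slope_factor_pos[of \<Omega> g x] by (simp add: y_def)
  have last: "\<bar>dderiv u (dderiv u g) x * dderiv (0, 1) H z\<bar> \<le> y * K"
    unfolding guu abs_mult using slope_factor_pos[of \<Omega> g x] b1(2) by (intro mult_mono) (auto simp: y_def)
  have H1: "\<bar>dderiv u h x\<bar> \<le> 2 * (c * K)"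
  proof -
    have "\<bar>dderiv u h x\<bar> \<le> c * K + K"
      unfolding h1[OF x] z_def[symmetric] using b1(1) prod1[OF b1(2)] by linarith
    moreover have "K \<le> c * K" using c K(1) by simp
    ultimately show ?thesis by linarith
  qed
  have H2: "\<bar>dderiv u (dderiv u h) x\<bar> \<le> 4 * (c\<^sup>2 * K) + y * K"
  proof -
    have "\<bar>dderiv u (dderiv u h) x\<bar> \<le> (c * (c * K) + c * K) + ((c * K + K) + y * K)"
    proof -
      have "\<bar>dderiv (u, 0) (dderiv (0, 1) H) z + dderiv u g x * dderiv (0, 1) (dderiv (0, 1) H) z\<bar> \<le> c * K + K"
        using b4(1) prod1[OF b4(3)] by linarith
      from prod1[OF this] show ?thesis unfolding h2 using b3 prod1[OF b4(2)] last by linarith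
    qed
    moreover have "K \<le> c * K" "c * K \<le> c * (c * K)" using c K(1) by simp_all
    moreover have "c * (c * K) = c\<^sup>2 * K" by (simp add: power2_eq_square)
    ultimately show ?thesis by linarith
  qed
  have hx: "h x \<ge> 1 / K" "h x > 0"
    using K(1,2) by (auto simp: h_def intro: less_le_trans[of 0 "1 / K"])
  have inv: "1 / h x \<le> K" using hx K(1) by (simp add: divide_simps mult.commute)
  have Q2: "\<bar>dderiv u (dderiv u h) x / h x\<bar> \<le> (4 * (c\<^sup>2 * K) + y * K) * K"
  proof -
    have "\<bar>dderiv u (dderiv u h) x / h x\<bar> = \<bar>dderiv u (dderiv u h) x\<bar> * (1 / h x)" using hx by simp
    also have "\<dots> \<le> (4 * (c\<^sup>2 * K) + y * K) * K"
      by (rule mult_mono[OF H2 inv]) (use hx y K(1) in auto)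
    finally show ?thesis .
  qed
  have Q1: "(dderiv u h x / h x)\<^sup>2 \<le> (2 * (c * K) * K)\<^sup>2"
  proof -
    have "\<bar>dderiv u h x / h x\<bar> = \<bar>dderiv u h x\<bar> * (1 / h x)" using hx by simp
    also have "\<dots> \<le> 2 * (c * K) * K"
      by (rule mult_mono[OF H1 inv]) (use hx c K(1) in auto)
    finally show ?thesis by (rule abs_le_square_iff[THEN iffD1, OF order_trans]) simp
  qed
  have "K\<^sup>2 \<le> K ^ 4" using K(1) by (intro power_increasing) auto
  then have "4 * (c\<^sup>2 * K\<^sup>2) \<le> 4 * (c\<^sup>2 * K ^ 4)" by (intro mult_left_mono) auto
  then have "(4 * (c\<^sup>2 * K) + y * K) * K + (2 * (c * K) * K)\<^sup>2 \<le> 8 * c\<^sup>2 * K ^ 4 + K\<^sup>2 * y"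
    by (simp add: power2_eq_square power4_eq_xxxx algebra_simps)
  then show ?thesis using Q1 Q2 unfolding u_def[symmetric] y_def by (simp only: times_divide_eq_right)
qed

text \<open>In the inequality at the maximum, \<open>(k - q) * \<Sum> (lam i)\<^sup>2\<close> is quadratic in the mean curvature and
the source contributes at most linearly.\<close>

lemma interior_maximum_bound:
  fixes \<kappa> :: "real^'n \<Rightarrow> real^'n" and k :: nat and q :: real
  assumes k: "2 \<le> k" "k \<le> CARD('n)" and q: "q \<le> 1"
    and pc: "\<And>y. y \<in> \<Omega> \<Longrightarrow> principal_curvatures \<Omega> g y (\<kappa> y)"
    and adm: "\<kappa> x \<in> Gamma_cone k"
    and H: "cdiff 2 (\<Omega> \<times> UNIV) H" "\<And>y. y \<in> \<Omega> \<Longrightarrow> H (y, g y) > 0"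
    and eq: "\<And>y. y \<in> \<Omega> \<Longrightarrow> sigma k (\<kappa> y) = H (y, g y) * ((v y)\<^sup>2) powr (q / 2)"
    and max: "\<And>y. y \<in> \<Omega> \<Longrightarrow> (\<Sum>i\<in>UNIV. shape_operator \<Omega> g y $ i $ i)\<^sup>2 / (v y)\<^sup>2
        \<le> (\<Sum>i\<in>UNIV. lam i)\<^sup>2 / (v x)\<^sup>2"
    and K: "K \<ge> 1" "H (x, g x) \<ge> 1 / K" "\<And>b. b \<in> Basis \<Longrightarrow> \<bar>dderiv b H (x, g x)\<bar> \<le> K"
      "\<And>b b'. b \<in> Basis \<Longrightarrow> b' \<in> Basis \<Longrightarrow> \<bar>dderiv b (dderiv b' H) (x, g x)\<bar> \<le> K"
  shows "0 < (\<Sum>i\<in>UNIV. lam i)" "(\<Sum>i\<in>UNIV. lam i) \<le> 9 * real CARD('n) ^ 4 * K ^ 4 / v x"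
proof -
  define c where "c = real CARD('n)"
  define s where "s = (\<Sum>i\<in>UNIV. lam i)"
  define W where "W = 1 / v x"
  have c: "c \<ge> 1" unfolding c_def by (simp add: Suc_leI card_gt_0_iff)
  obtain k' where k': "k = Suc (Suc k')" using k(1) by (metis add_2_eq_Suc le_Suc_ex)
  have v0: "v x > 0" by (rule slope_factor_pos)
  have W1: "W \<ge> 1"
    using slope_factor_le_1[of \<Omega> g x] v0 by (simp add: W_def)
  have cone: "lam \<in> garding_cone UNIV k"
    using adm k lam_esym[OF pc[OF x]] by (simp add: garding_cone_def Gamma_cone_def)
  have s: "s > 0" unfolding s_def by (rule garding_cone_sum_pos[OF cone]) (use k in auto)
  then show "0 < (\<Sum>i\<in>UNIV. lam i)" by (simp add: s_def)
  have "(\<Sum>i\<in>UNIV. (lam i)\<^sup>2) \<le> s\<^sup>2"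
    unfolding s_def by (rule garding_cone_sum_squares_le[OF _ cone k(1)]) simp
  then have lam_s: "\<bar>lam m\<bar> \<le> s" for m
    using member_le_sum[of m UNIV "\<lambda>i. (lam i)\<^sup>2"] s abs_le_square_iff[of "lam m" s] by simp
  let ?L = "\<lambda>m. dderiv (e m) (dderiv (e m) (\<lambda>y. H (y, g y))) x / H (x, g x) - (dderiv (e m) (\<lambda>y. H (y, g y)) x / H (x, g x))\<^sup>2"
  have hC: "cdiff 2 \<Omega> (\<lambda>y. H (y, g y))"
    by (rule cdiff_graph_compose[OF \<Omega> cdiff_mono[OF g _ \<Omega>] H(1)]) simp
  have main: "(\<Sum>m\<in>UNIV. ?L m) + (real k - q) * (\<Sum>i\<in>UNIV. (lam i)\<^sup>2) \<le> 0"
    using interior_maximum_inequality[of k' q \<kappa> "\<lambda>y. H (y, g y)", folded k', OF k(2) q pc adm hC H(2) eq max] .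
  have "- (8 * c\<^sup>2 * K ^ 4 + K\<^sup>2 * (s * W)) \<le> ?L m" for m
  proof -
    have "K\<^sup>2 * \<bar>lam m\<bar> / v x \<le> K\<^sup>2 * (s * W)"
      using lam_s[of m] v0 by (simp add: W_def divide_right_mono mult_left_mono)
    then show ?thesis using source_term_bound[OF H(1) K, of m] by (simp add: c_def)
  qed
  then have "(\<Sum>m\<in>(UNIV::'n set). - (8 * c\<^sup>2 * K ^ 4 + K\<^sup>2 * (s * W))) \<le> (\<Sum>m\<in>UNIV. ?L m)" by (rule sum_mono)
  then have lower: "- (c * (8 * c\<^sup>2 * K ^ 4 + K\<^sup>2 * (s * W))) \<le> (\<Sum>m\<in>UNIV. ?L m)"
    by (simp only: sum_constant c_def mult_minus_right)
  have "1 * (\<Sum>i\<in>UNIV. (lam i)\<^sup>2) \<le> (real k - q) * (\<Sum>i\<in>UNIV. (lam i)\<^sup>2)"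
    using k(1) q by (intro mult_right_mono sum_nonneg) auto
  then have sq: "(\<Sum>i\<in>UNIV. (lam i)\<^sup>2) \<le> c * (8 * c\<^sup>2 * K ^ 4 + K\<^sup>2 * (s * W))"
    using main lower by linarith
  have cs: "s\<^sup>2 \<le> c * (\<Sum>i\<in>UNIV. (lam i)\<^sup>2)"
    using Cauchy_Schwarz_ineq_sum[of "\<lambda>_. 1" lam UNIV] by (simp add: s_def c_def)
  show "(\<Sum>i\<in>UNIV. lam i) \<le> 9 * real CARD('n) ^ 4 * K ^ 4 / v x"
  proof -
    have one: "1 \<le> c ^ 4 * K ^ 4 * W"
      using mult_mono[of 1 "c ^ 4" 1 "K ^ 4"] mult_mono[of 1 "c ^ 4 * K ^ 4" 1 W] c K(1) W1
      by (simp add: one_le_power)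
    have "s \<le> 9 * (c ^ 4 * K ^ 4 * W)"
    proof (cases "s \<le> 1")
      case True
      then show ?thesis using one by simp
    next
      case False
      have "s * s \<le> c * (c * (8 * c\<^sup>2 * K ^ 4 + K\<^sup>2 * (s * W)))"
        using cs sq c by (metis (no_types, lifting) mult_left_mono order_trans power2_eq_square zero_le_one)
      also have "\<dots> \<le> s * (9 * (c ^ 4 * K ^ 4 * W))"
      proof -
        have "c ^ 4 * K ^ 4 \<le> c ^ 4 * K ^ 4 * W" using W1 c K(1) by simp
        also have "\<dots> \<le> s * (c ^ 4 * K ^ 4 * W)"
          using mult_right_mono[of 1 s "c ^ 4 * K ^ 4 * W"] one False by linarith
        finally have "c * (c * (8 * c\<^sup>2 * K ^ 4)) \<le> s * (8 * (c ^ 4 * K ^ 4 * W))"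
          by (simp add: power2_eq_square power4_eq_xxxx mult_ac)
        moreover have "c * (c * (K\<^sup>2 * (s * W))) \<le> s * (c ^ 4 * K ^ 4 * W)"
        proof -
          have "c\<^sup>2 * K\<^sup>2 \<le> c ^ 4 * K ^ 4"
            using c K(1) by (intro mult_mono power_increasing) auto
          then have "(c\<^sup>2 * K\<^sup>2) * (s * W) \<le> (c ^ 4 * K ^ 4) * (s * W)"
            using s W1 by (intro mult_right_mono) auto
          then show ?thesis by (simp add: power2_eq_square mult_ac)
        qed
        ultimately show ?thesis by (simp add: algebra_simps)
      qed
      finally show ?thesis using s by simp
    qed
    then show ?thesis by (simp add: s_def c_def W_def mult.assoc)
  qed
qed

end

section \<open>The source bound is determined by the data\<close>

lemma iter_partial_cong:
  assumes "open W" "\<And>w. w \<in> W \<Longrightarrow> f w = g w" "w \<in> W"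
  shows "iter_partial bs f w = iter_partial bs g w"
  using assms(3)
proof (induction bs arbitrary: w)
  case (Cons b bs)
  show ?case
    using dderiv_cong[OF assms(1) Cons.prems Cons.IH] by simp
qed (simp add: assms(2))

lemma Ck_closure_extension:
  assumes "Ck_closure m U f" "bs \<in> lists Basis" "length bs \<le> m"
  shows "\<exists>F. continuous_on (closure U) F \<and> (\<forall>x\<in>U. F x = iter_partial bs f x)"
  using assms(1)[unfolded Ck_closure_def, THEN conjunct2, THEN conjunct2, rule_format, OF assms(2,3)] .

lemma bound_at_closure_point:
  fixes f :: "'a::metric_space \<Rightarrow> real"
  assumes "continuous_on S f" "z \<in> S" "W \<subseteq> S" "z \<in> closure W" "\<And>w. w \<in> W \<Longrightarrow> f w \<le> K"
  shows "f z \<le> K"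
proof -
  obtain s where s: "\<And>n. s n \<in> W" "s \<longlonglongrightarrow> z" using assms(4) unfolding closure_sequential by blast
  have "(\<lambda>n. f (s n)) \<longlonglongrightarrow> f z"
    using s(1) assms(3) by (intro continuous_on_tendsto_compose[OF assms(1) s(2) assms(2)] always_eventually) blast
  then show ?thesis by (rule LIMSEQ_le_const2) (use s assms(5) in auto)
qed

text \<open>Everything that the estimate needs to know about \<open>H\<close>, with one number for the lower bound and for
all derivatives of order at most two.\<close>

definition source_bound :: "(real^'n) set \<Rightarrow> real set \<Rightarrow> ((real^'n) \<times> real \<Rightarrow> real) \<Rightarrow> real \<Rightarrow> bool" where
  "source_bound \<Omega> I H K \<longleftrightarrow> K \<ge> 1 \<and> (\<forall>z\<in>\<Omega> \<times> I. 1 / K \<le> H z \<and>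
     (\<forall>bs\<in>lists Basis. length bs \<le> 2 \<longrightarrow> \<bar>iter_partial bs H z\<bar> \<le> K))"

lemma source_bound_exists:
  fixes H :: "(real^'n) \<times> real \<Rightarrow> real"
  assumes H: "smooth_closure (\<Omega> \<times> UNIV) H" "\<And>x z. x \<in> closure \<Omega> \<Longrightarrow> H (x, z) > 0" and "bounded \<Omega>"
  shows "\<exists>K. source_bound \<Omega> {a..b} H K"
proof -
  define S where "S = closure \<Omega> \<times> {a..b}"
  have S: "compact S" unfolding S_def using assms(3) by (intro compact_Times) (auto simp: compact_closure)
  have sub: "S \<subseteq> closure (\<Omega> \<times> UNIV)" by (auto simp: S_def closure_Times)
  have C2: "Ck_closure 2 (\<Omega> \<times> UNIV) H" using H(1) by (simp add: smooth_closure_def)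
  define B where "B = {bs :: ((real^'n) \<times> real) list. bs \<in> lists Basis \<and> length bs \<le> 2}"
  have "finite B"
    using finite_lists_length_le[of "Basis :: ((real^'n) \<times> real) set" 2] by (simp add: B_def lists_eq_set)
  have "\<exists>k. \<forall>z\<in>\<Omega> \<times> {a..b}. \<bar>iter_partial bs H z\<bar> \<le> k" if "bs \<in> B" for bs
  proof -
    have bs: "bs \<in> lists Basis" "length bs \<le> 2" using that unfolding B_def by blast+
    from Ck_closure_extension[OF C2 bs] obtain F
      where F0: "continuous_on (closure (\<Omega> \<times> UNIV)) F \<and> (\<forall>z\<in>\<Omega> \<times> UNIV. F z = iter_partial bs H z)" ..
    note F = conjunct1[OF F0] conjunct2[OF F0]
    have "compact (F ` S)" by (rule compact_continuous_image[OF continuous_on_subset[OF F(1) sub] S])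
    then have "bounded (F ` S)" by (rule compact_imp_bounded)
    then obtain k where k: "\<And>z. z \<in> S \<Longrightarrow> \<bar>F z\<bar> \<le> k"
      unfolding bounded_iff by (metis imageI real_norm_def)
    show ?thesis
    proof (intro exI ballI)
      fix z assume z: "z \<in> \<Omega> \<times> {a..b}"
      then have "z \<in> S" using closure_subset by (auto simp: S_def)
      then show "\<bar>iter_partial bs H z\<bar> \<le> k" using k F(2) z by force
    qed
  qed
  then obtain k where k: "\<And>bs z. bs \<in> B \<Longrightarrow> z \<in> \<Omega> \<times> {a..b} \<Longrightarrow> \<bar>iter_partial bs H z\<bar> \<le> k bs" by metis
  obtain m where m: "m > 0" "\<And>z. z \<in> S \<Longrightarrow> m \<le> H z"
  proof (cases "S = {}")
    case False
    have "continuous_on S H"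
      by (rule continuous_on_subset[OF C2[unfolded Ck_closure_def, THEN conjunct1] sub])
    then obtain z where "z \<in> S" "\<And>w. w \<in> S \<Longrightarrow> H z \<le> H w"
      using continuous_attains_inf[OF S False] by blast
    then show ?thesis using that[of "H z"] H(2) by (force simp: S_def)
  qed (use that[of 1] in auto)
  define K where "K = 1 + (\<Sum>bs\<in>B. \<bar>k bs\<bar>) + 1 / m"
  have K: "K \<ge> 1" "1 / m \<le> K" "\<And>bs. bs \<in> B \<Longrightarrow> k bs \<le> K"
  proof -
    have 0: "(\<Sum>bs\<in>B. \<bar>k bs\<bar>) \<ge> 0" by (simp add: sum_nonneg)
    then show "K \<ge> 1" "1 / m \<le> K" using m(1) by (simp_all add: K_def)
    fix bs assume "bs \<in> B"
    then have "\<bar>k bs\<bar> \<le> (\<Sum>bs\<in>B. \<bar>k bs\<bar>)" using \<open>finite B\<close> by (intro member_le_sum) auto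
    moreover have "1 / m > 0" using m(1) by simp
    ultimately show "k bs \<le> K" unfolding K_def by linarith
  qed
  have "source_bound \<Omega> {a..b} H K"
    unfolding source_bound_def
  proof (intro conjI ballI impI)
    show "K \<ge> 1" by (rule K)
    fix z assume z: "z \<in> \<Omega> \<times> {a..b}"
    then have "z \<in> S" using closure_subset by (auto simp: S_def)
    then have "m \<le> H z" by (rule m)
    moreover have "1 / K \<le> m" using K(1,2) m(1) by (simp add: divide_simps mult.commute)
    ultimately show "1 / K \<le> H z" by simp
    fix bs :: "((real^'n) \<times> real) list" assume "bs \<in> lists Basis" "length bs \<le> 2"
    then have "bs \<in> B" by (simp add: B_def)
    then show "\<bar>iter_partial bs H z\<bar> \<le> K" using k[OF _ z] K(3) by (meson order_trans)
  qed
  then show ?thesis ..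
qed

text \<open>Two sources that agree on \<open>closure \<Omega> \<times> {a..b}\<close> have the same derivatives on the open set
\<open>(\<Omega> \<inter> \<Omega>0) \<times> {a<..<b}\<close>, which is dense in \<open>\<Omega> \<times> {a..b}\<close> because \<open>\<Omega>\<close> and \<open>\<Omega>0\<close> are open and have the same
closure. Continuity of the derivatives does the rest.\<close>

lemma source_bound_transfer:
  fixes H H0 :: "(real^'n) \<times> real \<Rightarrow> real"
  assumes K: "source_bound \<Omega>0 {a..b} H0 K"
    and open_sets: "open \<Omega>" "open \<Omega>0" and cl: "closure \<Omega> = closure \<Omega>0" and ab: "a < b"
    and eq: "\<And>x z. x \<in> closure \<Omega> \<Longrightarrow> z \<in> {a..b} \<Longrightarrow> H (x, z) = H0 (x, z)"
    and H: "Ck_on 2 (\<Omega> \<times> UNIV) H"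
  shows "source_bound \<Omega> {a..b} H K"
proof -
  define W where "W = (\<Omega> \<inter> \<Omega>0) \<times> {a<..<b}"
  have W: "open W" unfolding W_def using open_sets by (auto intro!: open_Times)
  have HW: "H w = H0 w" if "w \<in> W" for w
    using that eq closure_subset[of \<Omega>] by (cases w) (auto simp: W_def)
  have clW: "z \<in> closure W" if "z \<in> \<Omega> \<times> {a..b}" for z
  proof -
    have "fst z \<in> closure (\<Omega> \<inter> \<Omega>0)"
      using open_Int_closure_subset[OF open_sets(1), of \<Omega>0] that cl closure_subset[of \<Omega>] by auto
    then show ?thesis using that ab by (auto simp: W_def closure_Times closure_greaterThanLessThan mem_Times_iff)
  qed
  have WS: "W \<subseteq> \<Omega> \<times> UNIV" by (auto simp: W_def)
  have WK: "w \<in> \<Omega>0 \<times> {a..b}" if "w \<in> W" for w using that by (auto simp: W_def)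
  have cont: "continuous_on (\<Omega> \<times> UNIV) (iter_partial bs H)" if "bs \<in> lists Basis" "length bs \<le> 2" for bs
    using H that unfolding Ck_on_def by blast
  show ?thesis
    unfolding source_bound_def
  proof (intro conjI ballI impI)
    show "K \<ge> 1" using K by (simp add: source_bound_def)
    fix z assume z: "z \<in> \<Omega> \<times> {a..b}"
    then have zS: "z \<in> \<Omega> \<times> UNIV" by auto
    have "- H z \<le> - (1 / K)"
    proof (rule bound_at_closure_point[OF _ zS WS clW[OF z]])
      show "continuous_on (\<Omega> \<times> UNIV) (\<lambda>z. - H z)" using cont[of "[]"] by (auto intro: continuous_intros)
      show "- H w \<le> - (1 / K)" if "w \<in> W" for w
      proof -
        have "1 / K \<le> H0 w" using K WK[OF that] unfolding source_bound_def by blast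
        then show ?thesis using HW[OF that] by simp
      qed
    qed
    then show "1 / K \<le> H z" by simp
    fix bs :: "((real^'n) \<times> real) list" assume bs: "bs \<in> lists Basis" "length bs \<le> 2"
    show "\<bar>iter_partial bs H z\<bar> \<le> K"
    proof (rule bound_at_closure_point[OF _ zS WS clW[OF z]])
      show "continuous_on (\<Omega> \<times> UNIV) (\<lambda>z. \<bar>iter_partial bs H z\<bar>)" using cont[OF bs] by (auto intro: continuous_intros)
      show "\<bar>iter_partial bs H w\<bar> \<le> K" if "w \<in> W" for w
      proof -
        have "\<bar>iter_partial bs H0 w\<bar> \<le> K" using K WK[OF that] bs unfolding source_bound_def by blast
        then show ?thesis using iter_partial_cong[OF W HW that, where bs = bs] by simp
      qed
    qed
  qed
qed

text \<open>On the frontier the limit defining the extension is the value of any continuous extension.\<close>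

lemma cont_ext_eq:
  fixes f F :: "'a::metric_space \<Rightarrow> 'b::t2_space"
  assumes "continuous_on (closure \<Omega>) F" "\<And>x. x \<in> \<Omega> \<Longrightarrow> F x = f x" "x \<in> closure \<Omega>"
  shows "cont_ext \<Omega> f x = F x"
proof (cases "x \<in> \<Omega>")
  case False
  then have "x islimpt \<Omega>" using assms(3) by (simp add: closure_def)
  then have nt: "at x within \<Omega> \<noteq> bot" by (simp add: trivial_limit_within)
  have "(F \<longlongrightarrow> F x) (at x within \<Omega>)"
    using assms(1)[unfolded continuous_on_def, rule_format, OF assms(3)] closure_subset
    by (rule tendsto_within_subset)
  then have "(f \<longlongrightarrow> F x) (at x within \<Omega>)"
    by (rule Lim_transform_eventually) (auto simp: eventually_at_filter assms(2))
  then show ?thesis using False tendsto_Lim[OF nt] by (simp add: cont_ext_def)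
qed (simp add: cont_ext_def assms(2))

lemma grad_continuous:
  assumes "Ck_closure 2 \<Omega> g"
  shows "continuous_on (closure \<Omega>) (grad \<Omega> g)"
proof -
  have "\<exists>F. continuous_on (closure \<Omega>) F \<and> (\<forall>x\<in>\<Omega>. F x = iter_partial [axis i 1] g x)" for i
    by (rule Ck_closure_extension[OF assms]) (auto simp: axis_in_Basis_iff)
  then obtain F where F: "\<And>i. continuous_on (closure \<Omega>) (F i)" "\<And>i x. x \<in> \<Omega> \<Longrightarrow> F i x = iter_partial [axis i 1] g x"
    by metis
  have c: "continuous_on (closure \<Omega>) (\<lambda>x. \<chi> i. F i x)" using F(1) by (intro continuous_on_vec_lambda)
  have "grad \<Omega> g x = (\<chi> i. F i x)" if "x \<in> closure \<Omega>" for x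
    unfolding grad_def by (rule cont_ext_eq[OF c _ that]) (simp add: F(2))
  then show ?thesis using c by (simp cong: continuous_on_cong)
qed

lemma hess_continuous:
  assumes "Ck_closure 2 \<Omega> g"
  shows "continuous_on (closure \<Omega>) (hess \<Omega> g)"
proof -
  have "\<exists>F. continuous_on (closure \<Omega>) F \<and> (\<forall>x\<in>\<Omega>. F x = iter_partial [axis i 1, axis j 1] g x)" for i j
    by (rule Ck_closure_extension[OF assms]) (auto simp: axis_in_Basis_iff)
  then obtain F where F: "\<And>i j. continuous_on (closure \<Omega>) (F i j)"
    "\<And>i j x. x \<in> \<Omega> \<Longrightarrow> F i j x = iter_partial [axis i 1, axis j 1] g x"
    by metis
  have c: "continuous_on (closure \<Omega>) (\<lambda>x. \<chi> i j. F i j x)" using F(1) by (intro continuous_on_vec_lambda)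
  have "hess \<Omega> g x = (\<chi> i j. F i j x)" if "x \<in> closure \<Omega>" for x
    unfolding hess_def by (rule cont_ext_eq[OF c _ that]) (simp add: F(2))
  then show ?thesis using c by (simp cong: continuous_on_cong)
qed

lemma slope_factor_continuous:
  assumes "Ck_closure 2 \<Omega> g"
  shows "continuous_on (closure \<Omega>) (slope_factor \<Omega> g)"
proof -
  have "1 + grad \<Omega> g x \<bullet> grad \<Omega> g x > 0" for x by (simp add: add_pos_nonneg)
  then have "sqrt (1 + grad \<Omega> g x \<bullet> grad \<Omega> g x) \<noteq> 0" for x by (simp add: less_imp_neq[symmetric])
  then show ?thesis
    unfolding slope_factor_def by (intro continuous_intros grad_continuous[OF assms]) auto
qed

lemma shape_operator_continuous:
  assumes "Ck_closure 2 \<Omega> g"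
  shows "continuous_on (closure \<Omega>) (\<lambda>x. shape_operator \<Omega> g x $ i $ j)"
proof -
  have eq: "shape_operator \<Omega> g x $ i $ j = (\<Sum>k\<in>UNIV. ((if i = k then 1 else 0)
      - (slope_factor \<Omega> g x)\<^sup>2 * (grad \<Omega> g x $ i * grad \<Omega> g x $ k)) * (slope_factor \<Omega> g x * hess \<Omega> g x $ k $ j))" for x
    by (simp add: shape_operator_def matrix_matrix_mult_def inverse_first_form_nth second_form_nth)
  have g: "continuous_on (closure \<Omega>) (\<lambda>x. grad \<Omega> g x $ k)" for k
    by (intro continuous_intros grad_continuous assms)
  have h: "continuous_on (closure \<Omega>) (\<lambda>x. hess \<Omega> g x $ k $ l)" for k l
    by (intro continuous_intros hess_continuous assms)
  show ?thesis unfolding eq by (intro continuous_intros g h slope_factor_continuous assms)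
qed

section \<open>Admissible solutions and the estimate\<close>

locale admissible_solution =
  fixes k :: nat and q :: real and \<Omega> :: "(real^'n) set" and H :: "(real^'n) \<times> real \<Rightarrow> real"
    and g :: "real^'n \<Rightarrow> real" and \<kappa> :: "real^'n \<Rightarrow> real^'n"
  assumes k: "2 \<le> k" "k \<le> CARD('n)" and q: "q \<le> 1"
    and dom: "open \<Omega>" "bounded \<Omega>" "\<Omega> \<noteq> {}"
    and H: "smooth_closure (\<Omega> \<times> UNIV) H" "\<And>x z. x \<in> closure \<Omega> \<Longrightarrow> H (x, z) > 0"
    and reg: "Ck_on 4 \<Omega> g" "Ck_closure 2 \<Omega> g"
    and pc: "\<And>x. x \<in> \<Omega> \<Longrightarrow> principal_curvatures \<Omega> g x (\<kappa> x)"
    and adm: "\<And>x. x \<in> \<Omega> \<Longrightarrow> \<kappa> x \<in> Gamma_cone k"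
    and eq: "\<And>x. x \<in> \<Omega> \<Longrightarrow> sigma k (\<kappa> x) = H (x, g x) / (1 + (norm (grad \<Omega> g x))\<^sup>2) powr (q / 2)"
begin

sublocale c4_graph \<Omega> g
  by unfold_locales (use dom reg Ck_on_imp_cdiff in auto)

lemma frame_at:
  assumes "x \<in> \<Omega>"
  obtains e lam where "c4_graph_frame \<Omega> g x e lam"
proof -
  obtain e lam where "graph_frame (p x) (v x) (hess \<Omega> g x) e lam"
    using graph_frame_exists[of \<Omega> g x] hess_symmetric[OF assms] by blast
  then have "c4_graph_frame \<Omega> g x e lam"
    by (simp add: c4_graph_frame_def c4_graph_frame_axioms_def assms c4_graph_axioms)
  then show ?thesis by (rule that)
qed

lemma compact_closure_domain: "compact (closure \<Omega>)"
  using dom by (simp add: compact_closure)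

lemma frontier_nonempty: "frontier \<Omega> \<noteq> {}"
  using dom frontier_eq_empty[of \<Omega>] not_bounded_UNIV by metis

lemma hess_symmetric_closure:
  assumes "x \<in> closure \<Omega>"
  shows "hess \<Omega> g x $ i $ j = hess \<Omega> g x $ j $ i"
proof -
  have "continuous_on (closure \<Omega>) (\<lambda>x. hess \<Omega> g x $ i $ j - hess \<Omega> g x $ j $ i)"
    by (intro continuous_intros hess_continuous reg)
  from continuous_constant_on_closure[OF this _ assms, of 0] show ?thesis
    using hess_symmetric by simp
qed

lemma norm_A_closure:
  "x \<in> closure \<Omega> \<Longrightarrow> norm_A \<Omega> g x
    = sqrt (\<Sum>i\<in>UNIV. \<Sum>j\<in>UNIV. shape_operator \<Omega> g x $ i $ j * shape_operator \<Omega> g x $ j $ i)"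
  by (rule norm_A_eq) (rule hess_symmetric_closure)

lemma norm_A_continuous: "continuous_on (closure \<Omega>) (norm_A \<Omega> g)"
proof -
  have "continuous_on (closure \<Omega>) (\<lambda>x. sqrt (\<Sum>i\<in>UNIV. \<Sum>j\<in>UNIV.
      shape_operator \<Omega> g x $ i $ j * shape_operator \<Omega> g x $ j $ i))"
    by (intro continuous_on_real_sqrt continuous_on_sum continuous_on_mult shape_operator_continuous reg)
  then show ?thesis by (rule continuous_on_eq) (rule norm_A_closure[symmetric])
qed

abbreviation tr :: "real^'n \<Rightarrow> real" where "tr x \<equiv> \<Sum>i\<in>UNIV. shape_operator \<Omega> g x $ i $ i"

lemma tr_square_le_norm_A:
  assumes "x \<in> closure \<Omega>"
  shows "(tr x)\<^sup>2 \<le> real CARD('n) * (norm_A \<Omega> g x)\<^sup>2" "norm_A \<Omega> g x \<ge> 0"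
proof -
  obtain e lam where "graph_frame (p x) (v x) (hess \<Omega> g x) e lam"
    using graph_frame_exists[of \<Omega> g x] hess_symmetric_closure[OF assms] by blast
  then interpret graph_frame "p x" "v x" "hess \<Omega> g x" e lam .
  have "(\<Sum>i\<in>UNIV. lam i)\<^sup>2 \<le> real CARD('n) * (\<Sum>i\<in>UNIV. (lam i)\<^sup>2)"
    using Cauchy_Schwarz_ineq_sum[of "\<lambda>_. 1" lam UNIV] by simp
  then show "(tr x)\<^sup>2 \<le> real CARD('n) * (norm_A \<Omega> g x)\<^sup>2" "norm_A \<Omega> g x \<ge> 0"
    by (simp_all add: norm_A_closure[OF assms] trace_shape[OF shape_operator_mult_vec] sum_nonneg)
qed

lemma tr_pos: "x \<in> \<Omega> \<Longrightarrow> tr x > 0"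
  and norm_A_le_tr: "x \<in> \<Omega> \<Longrightarrow> norm_A \<Omega> g x \<le> tr x"
proof -
  assume x: "x \<in> \<Omega>"
  obtain e lam where "c4_graph_frame \<Omega> g x e lam" using frame_at[OF x] .
  then interpret c4_graph_frame \<Omega> g x e lam .
  have cone: "lam \<in> garding_cone UNIV k"
    using adm[OF x] k lam_esym[OF pc[OF x]] by (simp add: garding_cone_def Gamma_cone_def)
  have t: "tr x = (\<Sum>i\<in>UNIV. lam i)" by (rule trace_shape(1)[OF shape_operator_mult_vec])
  show pos: "tr x > 0" unfolding t by (rule garding_cone_sum_pos[OF cone]) (use k in auto)
  have "(\<Sum>i\<in>UNIV. (lam i)\<^sup>2) \<le> (tr x)\<^sup>2"
    unfolding t by (rule garding_cone_sum_squares_le[OF _ cone k(1)]) simp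
  then have "norm_A \<Omega> g x \<le> sqrt ((tr x)\<^sup>2)"
    using x closure_subset
    by (subst norm_A_closure) (auto simp: trace_shape(2)[OF shape_operator_mult_vec] simp del: real_sqrt_abs)
  then show "norm_A \<Omega> g x \<le> tr x" using pos by simp
qed

lemma g_continuous: "continuous_on (closure \<Omega>) g"
  using reg(2) by (simp add: Ck_closure_def)

text \<open>At an interior maximum of \<open>g\<close> the gradient vanishes and the mean curvature is the trace of the Hessian,
which is nonpositive; but admissible solutions have positive mean curvature.\<close>

lemma strict_maximum_principle:
  assumes x: "x \<in> \<Omega>"
  shows "g x < (SUP y\<in>frontier \<Omega>. g y)"
proof (rule ccontr)
  assume not: "\<not> ?thesis"
  obtain y where y: "y \<in> closure \<Omega>" "\<And>z. z \<in> closure \<Omega> \<Longrightarrow> g z \<le> g y"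
    using continuous_attains_sup[OF compact_closure_domain _ g_continuous] dom(3) by auto
  have "\<exists>y\<in>\<Omega>. \<forall>z\<in>closure \<Omega>. g z \<le> g y"
  proof (cases "y \<in> \<Omega>")
    case False
    then have "y \<in> frontier \<Omega>" using y(1) dom(1) by (simp add: frontier_def interior_open)
    moreover have "bdd_above (g ` frontier \<Omega>)" using y(2) by (auto intro!: bdd_aboveI[of _ "g y"] simp: frontier_def)
    ultimately have "g y \<le> (SUP y\<in>frontier \<Omega>. g y)" by (rule cSUP_upper)
    then show ?thesis using not x y(2) by (meson not_le order_trans)
  qed (use y in auto)
  then obtain y where y: "y \<in> \<Omega>" "\<And>z. z \<in> \<Omega> \<Longrightarrow> g z \<le> g y" using closure_subset by blast
  have C2: "cdiff 2 \<Omega> g" by (rule cdiff_mono[OF g _ dom(1)]) simp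
  have grad0: "grad \<Omega> g y = 0"
    using cdiff_local_max(1)[OF dom(1) y(1) C2 y(2)] by (simp add: vec_eq_iff grad_eq[OF y(1)])
  have "hess \<Omega> g y $ i $ i \<le> 0" for i
    using cdiff_local_max(2)[OF dom(1) y(1) C2 y(2)] by (simp add: hess_eq[OF y(1)])
  moreover have "shape_operator \<Omega> g y $ i $ i = hess \<Omega> g y $ i $ i" for i
    by (simp add: shape_operator_def matrix_matrix_mult_def inverse_first_form_nth second_form_nth grad0
        slope_factor_def if_distrib if_distribR sum.delta cong: if_cong)
  ultimately have "tr y \<le> 0" by (simp add: sum_nonpos)
  then show False using tr_pos[OF y(1)] by simp
qed

lemma g_range: "x \<in> \<Omega> \<Longrightarrow> g x \<in> {(INF x\<in>\<Omega>. g x)..(SUP x\<in>frontier \<Omega>. g x)}"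
  and range_nontrivial: "(INF x\<in>\<Omega>. g x) < (SUP x\<in>frontier \<Omega>. g x)"
proof -
  have "bounded (g ` closure \<Omega>)"
    by (intro compact_imp_bounded compact_continuous_image g_continuous compact_closure_domain)
  then have "bdd_below (g ` \<Omega>)"
    using bounded_imp_bdd_below bdd_below_mono closure_subset image_mono by metis
  then have inf: "(INF x\<in>\<Omega>. g x) \<le> g x" if "x \<in> \<Omega>" for x using that by (rule cINF_lower)
  then show "g x \<in> {(INF x\<in>\<Omega>. g x)..(SUP x\<in>frontier \<Omega>. g x)}" if "x \<in> \<Omega>" for x
    using strict_maximum_principle[OF that] that by auto
  obtain x where "x \<in> \<Omega>" using dom by blast
  then show "(INF x\<in>\<Omega>. g x) < (SUP x\<in>frontier \<Omega>. g x)"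
    using inf strict_maximum_principle by (meson le_less_trans)
qed

lemma norm_grad_le:
  assumes "x \<in> closure \<Omega>"
  shows "norm (grad \<Omega> g x) \<le> C1_norm \<Omega> g"
proof -
  have c: "continuous_on (closure \<Omega>) (\<lambda>x. norm (grad \<Omega> g x))" by (intro continuous_intros grad_continuous reg)
  have "bounded ((\<lambda>x. norm (grad \<Omega> g x)) ` closure \<Omega>)" "bounded ((\<lambda>x. \<bar>g x\<bar>) ` closure \<Omega>)"
    by (intro compact_imp_bounded compact_continuous_image c compact_closure_domain continuous_intros g_continuous)+
  then have bdd: "bdd_above ((\<lambda>x. norm (grad \<Omega> g x)) ` \<Omega>)" "bdd_above ((\<lambda>x. \<bar>g x\<bar>) ` \<Omega>)"
    using bounded_imp_bdd_above bdd_above_mono closure_subset image_mono by metis+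
  obtain y where "y \<in> \<Omega>" using dom by blast
  then have "0 \<le> (SUP x\<in>\<Omega>. \<bar>g x\<bar>)" using cSUP_upper[OF _ bdd(2)] abs_ge_zero order_trans by metis
  then have "norm (grad \<Omega> g x) \<le> C1_norm \<Omega> g" if "x \<in> \<Omega>" for x
    using cSUP_upper[OF that bdd(1)] by (simp add: C1_norm_def)
  from continuous_le_on_closure[OF c assms this] show ?thesis .
qed

lemma inverse_slope_le: "x \<in> closure \<Omega> \<Longrightarrow> 1 / v x \<le> sqrt (1 + (C1_norm \<Omega> g)\<^sup>2)"
  using power_mono[OF norm_grad_le norm_ge_zero, of x 2]
  by (simp add: slope_factor_def power2_norm_eq_inner)

text \<open>The maximum of \<open>R = \<sigma>\<^sub>1 / v\<close> over the closed domain dominates \<open>|A|\<close>, since \<open>v \<le> 1\<close>. On the frontier it is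
controlled by \<open>|A|\<close>, in the interior by the bound of the previous sections.\<close>

lemma curvature_estimate:
  assumes K: "source_bound \<Omega> {(INF x\<in>\<Omega>. g x)..(SUP x\<in>frontier \<Omega>. g x)} H K"
  defines "W \<equiv> sqrt (1 + (C1_norm \<Omega> g)\<^sup>2)"
  shows "(SUP x\<in>\<Omega>. norm_A \<Omega> g x)
    \<le> ((9 * real CARD('n) ^ 4 * K ^ 4 * W + real CARD('n)) * W) * (1 + (SUP x\<in>frontier \<Omega>. norm_A \<Omega> g x))"
proof -
  define R where "R x = \<bar>tr x\<bar> / v x" for x
  define S where "S = (SUP x\<in>frontier \<Omega>. norm_A \<Omega> g x)"
  define B where "B = 9 * real CARD('n) ^ 4 * K ^ 4 * W"
  have v0: "v x > 0" for x by (rule slope_factor_pos)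
  have W1: "W \<ge> 1" by (simp add: W_def)
  have K1: "K \<ge> 1" using K by (simp add: source_bound_def)
  have B0: "B \<ge> 0" using W1 K1 by (simp add: B_def)
  have "continuous_on (closure \<Omega>) R"
    unfolding R_def using v0 less_imp_neq[OF v0]
    by (intro continuous_on_divide continuous_on_rabs continuous_on_sum shape_operator_continuous slope_factor_continuous reg) auto
  then obtain x0 where x0: "x0 \<in> closure \<Omega>" "\<And>y. y \<in> closure \<Omega> \<Longrightarrow> R y \<le> R x0"
    using continuous_attains_sup[OF compact_closure_domain, of R] dom(3) by auto
  have A0: "norm_A \<Omega> g y \<ge> 0" if "y \<in> closure \<Omega>" for y
    by (rule tr_square_le_norm_A(2)[OF that])
  have fr: "frontier \<Omega> \<subseteq> closure \<Omega>" by (auto simp: frontier_def)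
  have "bdd_above (norm_A \<Omega> g ` frontier \<Omega>)"
    by (intro bounded_imp_bdd_above bounded_subset[OF compact_imp_bounded[OF compact_continuous_image[OF norm_A_continuous compact_closure_domain]]]
        image_mono fr)
  then have S: "norm_A \<Omega> g y \<le> S" if "y \<in> frontier \<Omega>" for y
    unfolding S_def using that by (rule cSUP_upper[rotated])
  have S0: "S \<ge> 0" using frontier_nonempty S A0 fr by (meson all_not_in_conv order_trans subsetD)
  have main: "R x0 \<le> ((B + real CARD('n)) * W) * (1 + S)"
  proof (cases "x0 \<in> \<Omega>")
    case False
    then have x0f: "x0 \<in> frontier \<Omega>" using x0(1) dom(1) by (simp add: frontier_def interior_open)
    have "\<bar>tr x0\<bar> \<le> real CARD('n) * norm_A \<Omega> g x0"
    proof -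
      have c: "real CARD('n) \<ge> 1" by (simp add: Suc_leI card_gt_0_iff)
      have "(tr x0)\<^sup>2 \<le> real CARD('n) * (norm_A \<Omega> g x0)\<^sup>2" by (rule tr_square_le_norm_A(1)[OF x0(1)])
      also have "\<dots> \<le> (real CARD('n))\<^sup>2 * (norm_A \<Omega> g x0)\<^sup>2"
        using c by (intro mult_right_mono) (auto simp: power2_eq_square)
      finally have "(tr x0)\<^sup>2 \<le> (real CARD('n) * norm_A \<Omega> g x0)\<^sup>2" by (simp add: power_mult_distrib)
      then show ?thesis using A0[OF x0(1)] abs_le_square_iff[of "tr x0" "real CARD('n) * norm_A \<Omega> g x0"] by simp
    qed
    also have "\<dots> \<le> real CARD('n) * S" using S[OF x0f] by (intro mult_left_mono) auto
    finally have "\<bar>tr x0\<bar> * (1 / v x0) \<le> (real CARD('n) * S) * W"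
      using inverse_slope_le[OF x0(1)] v0[of x0] S0 unfolding W_def by (intro mult_mono) auto
    also have "\<dots> = (real CARD('n) * W) * S" by simp
    also have "\<dots> \<le> ((B + real CARD('n)) * W) * (1 + S)"
      using B0 W1 S0 by (intro mult_mono) auto
    finally show ?thesis by (simp add: R_def)
  next
    case True
    obtain e lam where "c4_graph_frame \<Omega> g x0 e lam" using frame_at[OF True] .
    then interpret c4_graph_frame \<Omega> g x0 e lam .
    have t: "tr x0 = (\<Sum>i\<in>UNIV. lam i)" by (rule trace_shape(1)[OF shape_operator_mult_vec])
    have "(\<Sum>i\<in>UNIV. lam i) \<le> 9 * real CARD('n) ^ 4 * K ^ 4 / v x0"
    proof (rule interior_maximum_bound(2)[OF k q pc adm[OF True]])
      show "cdiff 2 (\<Omega> \<times> UNIV) H"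
        using H(1) dom(1) by (intro Ck_on_imp_cdiff open_Times) (auto simp: smooth_closure_def Ck_closure_def)
      show "0 < H (y, g y)" if "y \<in> \<Omega>" for y using H(2) that closure_subset by blast
      show "sigma k (\<kappa> y) = H (y, g y) * ((v y)\<^sup>2) powr (q / 2)" if "y \<in> \<Omega>" for y
      proof -
        have "1 + (norm (p y))\<^sup>2 \<noteq> 0" by (metis add_pos_nonneg less_irrefl zero_le_power2 zero_less_one)
        then have "(v y)\<^sup>2 = 1 / (1 + (norm (p y))\<^sup>2)"
          using slope_factor_square[of \<Omega> g y] unfolding power2_norm_eq_inner by (metis nonzero_eq_divide_eq)
        then show ?thesis using eq[OF that] by (simp add: powr_divide)
      qed
      show "(tr y)\<^sup>2 / (v y)\<^sup>2 \<le> (\<Sum>i\<in>UNIV. lam i)\<^sup>2 / (v x0)\<^sup>2" if "y \<in> \<Omega>" for y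
      proof -
        have "(R y)\<^sup>2 \<le> (R x0)\<^sup>2"
          using x0(2)[of y] that closure_subset v0[of y] by (intro power_mono) (auto simp: R_def)
        then show ?thesis by (simp add: R_def t power_divide)
      qed
      show "K \<ge> 1" by (rule K1)
      have z: "(x0, g x0) \<in> \<Omega> \<times> {(INF x\<in>\<Omega>. g x)..(SUP x\<in>frontier \<Omega>. g x)}"
        using g_range[OF True] True by auto
      show "1 / K \<le> H (x0, g x0)" using K z unfolding source_bound_def by blast
      have it: "\<bar>iter_partial bs H (x0, g x0)\<bar> \<le> K" if "bs \<in> lists Basis" "length bs \<le> 2" for bs
        using K z that unfolding source_bound_def by blast
      show "\<bar>dderiv b H (x0, g x0)\<bar> \<le> K" if "b \<in> Basis" for b using it[of "[b]"] that by simp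
      show "\<bar>dderiv b (dderiv b' H) (x0, g x0)\<bar> \<le> K" if "b \<in> Basis" "b' \<in> Basis" for b b'
        using it[of "[b, b']"] that by simp
    qed
    also have "\<dots> = 9 * real CARD('n) ^ 4 * K ^ 4 * (1 / v x0)" by simp
    also have "\<dots> \<le> B" unfolding B_def using inverse_slope_le[OF x0(1)] K1 unfolding W_def by (intro mult_left_mono) auto
    finally have "\<bar>tr x0\<bar> * (1 / v x0) \<le> B * W"
      using inverse_slope_le[OF x0(1)] v0[of x0] B0 tr_pos[OF True] unfolding W_def t by (intro mult_mono) auto
    also have "\<dots> \<le> (B + real CARD('n)) * W" using W1 by (intro mult_right_mono) auto
    also have "\<dots> \<le> ((B + real CARD('n)) * W) * (1 + S)"
      using mult_left_mono[of 1 "1 + S" "(B + real CARD('n)) * W"] B0 W1 S0 by simp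
    finally show ?thesis by (simp add: R_def)
  qed
  have "norm_A \<Omega> g x \<le> ((B + real CARD('n)) * W) * (1 + S)" if x: "x \<in> \<Omega>" for x
  proof -
    have "v x \<le> 1" by (rule slope_factor_le_1)
    then have "tr x \<le> R x" using tr_pos[OF x] v0[of x] by (simp add: R_def pos_le_divide_eq mult_left_le)
    then show ?thesis using norm_A_le_tr[OF x] x0(2)[of x] main x closure_subset by fastforce
  qed
  then show ?thesis unfolding S_def B_def using dom(3) by (intro cSUP_least) auto
qed

end

text \<open>One source bound \<open>K\<close>, taken from any solution with the data \<open>d\<close>, serves all of them: the data determine
the closure of the domain, the interval of heights and the values of \<open>H\<close> there.\<close>

lemma constant_for_given_data:
  fixes d :: "(real^'n) \<times> real \<rightharpoonup> real" and k :: nat and q c :: real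
  shows "\<exists>C. \<forall>(\<Omega> :: (real^'n) set) H g \<kappa>. admissible_solution k q \<Omega> H g \<kappa> \<and> C1_norm \<Omega> g = c \<and> H_data \<Omega> g H = d
    \<longrightarrow> (SUP x\<in>\<Omega>. norm_A \<Omega> g x) \<le> C * (1 + (SUP x\<in>frontier \<Omega>. norm_A \<Omega> g x))"
proof (cases "\<exists>(\<Omega>0 :: (real^'n) set) H0 g0 \<kappa>0. admissible_solution k q \<Omega>0 H0 g0 \<kappa>0 \<and> H_data \<Omega>0 g0 H0 = d")
  case True
  then obtain \<Omega>0 :: "(real^'n) set" and H0 g0 \<kappa>0
    where s0: "admissible_solution k q \<Omega>0 H0 g0 \<kappa>0" and d0: "H_data \<Omega>0 g0 H0 = d" by blast
  let ?I = "\<lambda>\<Omega> g. {(INF x\<in>\<Omega>. g x)..(SUP x\<in>frontier \<Omega>. g x)} :: real set"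
  interpret s0: admissible_solution k q \<Omega>0 H0 g0 \<kappa>0 by (rule s0)
  obtain K where K: "source_bound \<Omega>0 (?I \<Omega>0 g0) H0 K"
    using source_bound_exists[OF s0.H s0.dom(2)] by blast
  let ?W = "sqrt (1 + c\<^sup>2)"
  show ?thesis
  proof (rule exI[of _ "(9 * real CARD('n) ^ 4 * K ^ 4 * ?W + real CARD('n)) * ?W"], intro allI impI)
    fix \<Omega> :: "(real^'n) set" and H g \<kappa>
    assume *: "admissible_solution k q \<Omega> H g \<kappa> \<and> C1_norm \<Omega> g = c \<and> H_data \<Omega> g H = d"
    then interpret s: admissible_solution k q \<Omega> H g \<kappa> by blast
    have dd: "H_data \<Omega> g H = H_data \<Omega>0 g0 H0" using * d0 by simp
    have "closure \<Omega> \<times> ?I \<Omega> g = closure \<Omega>0 \<times> ?I \<Omega>0 g0"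
      using arg_cong[OF dd, of dom] by (simp add: H_data_def)
    then have cl: "closure \<Omega> = closure \<Omega>0" and I: "?I \<Omega> g = ?I \<Omega>0 g0"
      using s.dom(3) s.range_nontrivial s0.dom(3) s0.range_nontrivial by (auto simp: times_eq_iff)
    have "source_bound \<Omega> (?I \<Omega> g) H K"
    proof (rule source_bound_transfer[OF K[folded I] s.dom(1) s0.dom(1) cl s.range_nontrivial])
      show "H (x, z) = H0 (x, z)" if "x \<in> closure \<Omega>" "z \<in> ?I \<Omega> g" for x z
      proof -
        have "H_data \<Omega> g H (x, z) = Some (H (x, z))" using that by (simp add: H_data_def)
        moreover have "H_data \<Omega>0 g0 H0 (x, z) = Some (H0 (x, z))" using that unfolding cl I by (simp add: H_data_def)
        ultimately show ?thesis using dd by simp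
      qed
      show "Ck_on 2 (\<Omega> \<times> UNIV) H" using s.H(1) by (simp add: smooth_closure_def Ck_closure_def)
    qed
    from s.curvature_estimate[OF this] *
    show "(SUP x\<in>\<Omega>. norm_A \<Omega> g x) \<le> ((9 * real CARD('n) ^ 4 * K ^ 4 * ?W + real CARD('n)) * ?W)
        * (1 + (SUP x\<in>frontier \<Omega>. norm_A \<Omega> g x))" by simp
  qed
qed blast

theorem theorem1p3:
  fixes k :: nat and q :: real
  assumes "2 \<le> k" and "k \<le> CARD('n::finite)" and "q \<le> 1"
  shows "\<exists>C :: real \<Rightarrow> ((real^'n) \<times> real \<rightharpoonup> real) \<Rightarrow> real.
    \<forall>(\<Omega> :: (real^'n) set) (H :: (real^'n) \<times> real \<Rightarrow> real) (g :: real^'n \<Rightarrow> real)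
      (lam :: real^'n \<Rightarrow> real^'n).
      open \<Omega> \<and> connected \<Omega> \<and> bounded \<Omega> \<and> \<Omega> \<noteq> {} \<and>
      smooth_closure (\<Omega> \<times> UNIV) H \<and> (\<forall>x\<in>closure \<Omega>. \<forall>z. H (x, z) > 0) \<and>
      Ck_on 4 \<Omega> g \<and> Ck_closure 2 \<Omega> g \<and>
      (\<forall>x\<in>\<Omega>. principal_curvatures \<Omega> g x (lam x)) \<and>
      (\<forall>x\<in>\<Omega>. lam x \<in> Gamma_cone k) \<and>
      (\<forall>x\<in>\<Omega>. sigma k (lam x) = H (x, g x) / (1 + (norm (grad \<Omega> g x))\<^sup>2) powr (q / 2))
      \<longrightarrow> (SUP x\<in>\<Omega>. norm_A \<Omega> g x) \<le>
            C (C1_norm \<Omega> g) (H_data \<Omega> g H) * (1 + (SUP x\<in>frontier \<Omega>. norm_A \<Omega> g x))"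
proof -
  obtain C :: "real \<Rightarrow> ((real^'n) \<times> real \<rightharpoonup> real) \<Rightarrow> real" where
    C: "\<And>c d \<Omega> H g \<kappa>. admissible_solution k q \<Omega> H g \<kappa> \<Longrightarrow> C1_norm \<Omega> g = c \<Longrightarrow> H_data \<Omega> g H = d \<Longrightarrow>
      (SUP x\<in>\<Omega>. norm_A \<Omega> g x) \<le> C c d * (1 + (SUP x\<in>frontier \<Omega>. norm_A \<Omega> g x))"
    using constant_for_given_data[where k = k and q = q and ?'n = 'n] by metis
  show ?thesis
  proof (rule exI[of _ C], intro allI impI, elim conjE)
    fix \<Omega> :: "(real^'n) set" and H :: "(real^'n) \<times> real \<Rightarrow> real" and g and lam
    assume "open \<Omega>" "bounded \<Omega>" "\<Omega> \<noteq> {}" "smooth_closure (\<Omega> \<times> UNIV) H" "\<forall>x\<in>closure \<Omega>. \<forall>z. H (x, z) > 0"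
      "Ck_on 4 \<Omega> g" "Ck_closure 2 \<Omega> g" "\<forall>x\<in>\<Omega>. principal_curvatures \<Omega> g x (lam x)"
      "\<forall>x\<in>\<Omega>. lam x \<in> Gamma_cone k"
      "\<forall>x\<in>\<Omega>. sigma k (lam x) = H (x, g x) / (1 + (norm (grad \<Omega> g x))\<^sup>2) powr (q / 2)"
    then have "admissible_solution k q \<Omega> H g lam"
      using assms by (intro admissible_solution.intro) auto
    then show "(SUP x\<in>\<Omega>. norm_A \<Omega> g x) \<le>
        C (C1_norm \<Omega> g) (H_data \<Omega> g H) * (1 + (SUP x\<in>frontier \<Omega>. norm_A \<Omega> g x))"
      by (rule C) (rule refl)+
  qed
qed

end
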